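(* Let $A$ and $B$ be nontrivial finitely generated groups and suppose the word problem in both $A$ and $B$ has a polynomial time solution. Let $G=A\ast B$ be the free product of $A$ and $B$. Then the average-case time complexity of the word problem in $G$ is linear. In fact, the average-case time complexity of reducing an element of $G$ (given by a word) to the standard normal form is linear.
   Context: Algorithms run on multitape Turing machines. Let $A$ be generated by nontrivial elements $a_1,\ldots,a_s$ and $B$ by nontrivial elements $b_1,\ldots,b_t$. Inputs for $G=A\ast B$ are arbitrary (not necessarily freely reduced) words in the alphabet $a_1^{\pm1},\ldots,a_s^{\pm1},b_1^{\pm1},\ldots,b_t^{\pm1}$, and $W_n$ is the set of all such words of length $n$. The word problem in a group: given a word $w$ in its generators and their inverses, decide whether $w$ represents $1$; it has a polynomial time solution if some algorithm solves it in time $O(n^d)$ for some $d$, $n$ being the length of $w$. Reducing $w$ to the standard normal form means producing either the empty word or a word $w_1w_2\cdots w_k$ equal to $w$ in $G$, where each $w_i$ is either a word in the letters $a_j^{\pm1}$ representing a nontrivial element of $A$ or a word in the letters $b_j^{\pm1}$ representing a nontrivial element of $B$, and successive $w_i$, $w_{i+1}$ represent elements of different free factors. For an algorithm, $T(w)$ is its running time on input $w$. The average-case time complexity of a problem is linear if there is an algorithm solving it for which $\frac{1}{|W_n|}\sum_{w\in W_n}T(w)=O(n)$. *)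

theory Defs
  imports
    "HOL-Algebra.Generated_Groups"
    "HOL-Library.Landau_Symbols"
begin

section \<open>Words in generators and their inverses\<close>

text \<open>
  Generators are indexed by a set \<open>X\<close>.  The letter \<open>(x, True)\<close> stands for the generator with
  index \<open>x\<close> and \<open>(x, False)\<close> for its formal inverse; the two are always different letters, even
  when the group elements coincide.
\<close>

type_synonym 'x letter = "'x \<times> bool"
type_synonym 'x word = "'x letter list"

definition letters :: "'x set \<Rightarrow> 'x letter set" where
  "letters X = X \<times> UNIV"

definition words :: "'x set \<Rightarrow> 'x word set" where
  "words X = lists (letters X)"

definition words_of_length :: "'x set \<Rightarrow> nat \<Rightarrow> 'x word set" where
  "words_of_length X n = {w \<in> words X. length w = n}"

definition letter_value :: "('g, 'm) monoid_scheme \<Rightarrow> ('x \<Rightarrow> 'g) \<Rightarrow> 'x letter \<Rightarrow> 'g" where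
  "letter_value G g l = (if snd l then g (fst l) else inv\<^bsub>G\<^esub> g (fst l))"

primrec word_value :: "('g, 'm) monoid_scheme \<Rightarrow> ('x \<Rightarrow> 'g) \<Rightarrow> 'x word \<Rightarrow> 'g" where
  "word_value G g [] = \<one>\<^bsub>G\<^esub>"
| "word_value G g (l # w) = letter_value G g l \<otimes>\<^bsub>G\<^esub> word_value G g w"

definition generated_by_nontrivial :: "('g, 'm) monoid_scheme \<Rightarrow> 'x set \<Rightarrow> ('x \<Rightarrow> 'g) \<Rightarrow> bool" where
  "generated_by_nontrivial G X g \<longleftrightarrow>
     g ` X \<subseteq> carrier G - {\<one>\<^bsub>G\<^esub>} \<and> generate G (g ` X) = carrier G"

definition trivial_word :: "('g, 'm) monoid_scheme \<Rightarrow> ('x \<Rightarrow> 'g) \<Rightarrow> 'x word \<Rightarrow> bool" where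
  "trivial_word G g w \<longleftrightarrow> word_value G g w = \<one>\<^bsub>G\<^esub>"


section \<open>Free products\<close>

text \<open>
  The free product is the set of all finite sequences of elements of the two factors modulo the
  least congruence for concatenation that multiplies adjacent entries from the same factor and
  deletes the identities of the factors.
\<close>

definition fp_seqs :: "('a, 'm) monoid_scheme \<Rightarrow> ('b, 'n) monoid_scheme \<Rightarrow> ('a + 'b) list set" where
  "fp_seqs A B = lists (carrier A <+> carrier B)"

inductive_set fp_rel ::
    "('a, 'm) monoid_scheme \<Rightarrow> ('b, 'n) monoid_scheme \<Rightarrow> (('a + 'b) list \<times> ('a + 'b) list) set"
  for A :: "('a, 'm) monoid_scheme" and B :: "('b, 'n) monoid_scheme" where
  refl: "u \<in> fp_seqs A B \<Longrightarrow> (u, u) \<in> fp_rel A B"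
| sym: "(u, v) \<in> fp_rel A B \<Longrightarrow> (v, u) \<in> fp_rel A B"
| trans: "(u, v) \<in> fp_rel A B \<Longrightarrow> (v, w) \<in> fp_rel A B \<Longrightarrow> (u, w) \<in> fp_rel A B"
| mult_left: "\<lbrakk>u \<in> fp_seqs A B; v \<in> fp_seqs A B; x \<in> carrier A; y \<in> carrier A\<rbrakk>
    \<Longrightarrow> (u @ [Inl x, Inl y] @ v, u @ [Inl (x \<otimes>\<^bsub>A\<^esub> y)] @ v) \<in> fp_rel A B"
| mult_right: "\<lbrakk>u \<in> fp_seqs A B; v \<in> fp_seqs A B; x \<in> carrier B; y \<in> carrier B\<rbrakk>
    \<Longrightarrow> (u @ [Inr x, Inr y] @ v, u @ [Inr (x \<otimes>\<^bsub>B\<^esub> y)] @ v) \<in> fp_rel A B"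
| one_left: "\<lbrakk>u \<in> fp_seqs A B; v \<in> fp_seqs A B\<rbrakk>
    \<Longrightarrow> (u @ [Inl \<one>\<^bsub>A\<^esub>] @ v, u @ v) \<in> fp_rel A B"
| one_right: "\<lbrakk>u \<in> fp_seqs A B; v \<in> fp_seqs A B\<rbrakk>
    \<Longrightarrow> (u @ [Inr \<one>\<^bsub>B\<^esub>] @ v, u @ v) \<in> fp_rel A B"

definition fp_class ::
    "('a, 'm) monoid_scheme \<Rightarrow> ('b, 'n) monoid_scheme \<Rightarrow> ('a + 'b) list \<Rightarrow> ('a + 'b) list set" where
  "fp_class A B u = fp_rel A B `` {u}"

definition free_product ::
    "('a, 'm) monoid_scheme \<Rightarrow> ('b, 'n) monoid_scheme \<Rightarrow> ('a + 'b) list set monoid" where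
  "free_product A B =
     \<lparr>carrier = fp_seqs A B // fp_rel A B,
      monoid.mult = (\<lambda>U V. \<Union>u\<in>U. \<Union>v\<in>V. fp_class A B (u @ v)),
      one = fp_class A B []\<rparr>"

definition fp_inl ::
    "('a, 'm) monoid_scheme \<Rightarrow> ('b, 'n) monoid_scheme \<Rightarrow> 'a \<Rightarrow> ('a + 'b) list set" where
  "fp_inl A B x = fp_class A B [Inl x]"

definition fp_inr ::
    "('a, 'm) monoid_scheme \<Rightarrow> ('b, 'n) monoid_scheme \<Rightarrow> 'b \<Rightarrow> ('a + 'b) list set" where
  "fp_inr A B y = fp_class A B [Inr y]"

definition fp_generators ::
    "('a, 'm) monoid_scheme \<Rightarrow> ('b, 'n) monoid_scheme \<Rightarrow> ('x \<Rightarrow> 'a) \<Rightarrow> ('y \<Rightarrow> 'b)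
      \<Rightarrow> 'x + 'y \<Rightarrow> ('a + 'b) list set" where
  "fp_generators A B a b = case_sum (\<lambda>i. fp_inl A B (a i)) (\<lambda>j. fp_inr A B (b j))"

lemma fp_seqs_append [simp]:
  "u @ v \<in> fp_seqs A B \<longleftrightarrow> u \<in> fp_seqs A B \<and> v \<in> fp_seqs A B"
  by (simp add: fp_seqs_def)

lemma fp_seqs_Nil [simp]: "[] \<in> fp_seqs A B"
  by (simp add: fp_seqs_def)

lemma fp_seqs_Cons_Inl [simp]:
  "Inl x # u \<in> fp_seqs A B \<longleftrightarrow> x \<in> carrier A \<and> u \<in> fp_seqs A B"
  by (auto simp: fp_seqs_def)

lemma fp_seqs_Cons_Inr [simp]:
  "Inr y # u \<in> fp_seqs A B \<longleftrightarrow> y \<in> carrier B \<and> u \<in> fp_seqs A B"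
  by (auto simp: fp_seqs_def)

lemma fp_rel_in_seqs:
  assumes "monoid A" "monoid B" "(u, v) \<in> fp_rel A B"
  shows "u \<in> fp_seqs A B \<and> v \<in> fp_seqs A B"
  using assms(3,1,2)
  by (induction rule: fp_rel.induct) (auto simp: monoid.m_closed monoid.one_closed)

lemma equiv_fp_rel:
  assumes "monoid A" "monoid B"
  shows "equiv (fp_seqs A B) (fp_rel A B)"
proof (rule equivI)
  show "fp_rel A B \<subseteq> fp_seqs A B \<times> fp_seqs A B"
    using fp_rel_in_seqs[OF assms] by auto
  show "refl_on (fp_seqs A B) (fp_rel A B)"
    by (simp add: refl_on_def fp_rel.refl)
  show "sym (fp_rel A B)"
    by (rule symI) (rule fp_rel.sym)
  show "trans (fp_rel A B)"
    by (rule transI) (rule fp_rel.trans)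
qed

lemma fp_rel_context:
  assumes "(u, v) \<in> fp_rel A B" "p \<in> fp_seqs A B" "q \<in> fp_seqs A B"
  shows "(p @ u @ q, p @ v @ q) \<in> fp_rel A B"
  using assms
proof (induction rule: fp_rel.induct)
  case (refl u)
  then show ?case by (intro fp_rel.refl) simp
next
  case (sym u v)
  then show ?case by (blast intro: fp_rel.sym)
next
  case (trans u v w)
  then show ?case by (blast intro: fp_rel.trans)
next
  case (mult_left u v x y)
  then show ?case using fp_rel.mult_left[of "p @ u" A B "v @ q" x y] by simp
next
  case (mult_right u v x y)
  then show ?case using fp_rel.mult_right[of "p @ u" A B "v @ q" x y] by simp
next
  case (one_left u v)
  then show ?case using fp_rel.one_left[of "p @ u" A B "v @ q"] by simp
next
  case (one_right u v)
  then show ?case using fp_rel.one_right[of "p @ u" A B "v @ q"] by simp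
qed

lemma fp_rel_append:
  assumes "monoid A" "monoid B" "(u, u') \<in> fp_rel A B" "(v, v') \<in> fp_rel A B"
  shows "(u @ v, u' @ v') \<in> fp_rel A B"
proof -
  have "(u @ v, u' @ v) \<in> fp_rel A B"
    using fp_rel_context[OF assms(3), of "[]" v] fp_rel_in_seqs[OF assms(1,2,4)] by simp
  moreover have "(u' @ v, u' @ v') \<in> fp_rel A B"
    using fp_rel_context[OF assms(4), of u' "[]"] fp_rel_in_seqs[OF assms(1,2,3)] by simp
  ultimately show ?thesis by (rule fp_rel.trans)
qed

lemma fp_class_eq_iff:
  assumes "monoid A" "monoid B" "u \<in> fp_seqs A B" "v \<in> fp_seqs A B"
  shows "fp_class A B u = fp_class A B v \<longleftrightarrow> (u, v) \<in> fp_rel A B"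
  unfolding fp_class_def using eq_equiv_class_iff[OF equiv_fp_rel[OF assms(1,2)]] assms(3,4) by blast

lemma carrier_free_product: "carrier (free_product A B) = fp_class A B ` fp_seqs A B"
  by (auto simp: free_product_def quotient_def fp_class_def)

lemma one_free_product: "\<one>\<^bsub>free_product A B\<^esub> = fp_class A B []"
  by (simp add: free_product_def)

lemma mult_free_product:
  assumes "monoid A" "monoid B" "u \<in> fp_seqs A B" "v \<in> fp_seqs A B"
  shows "fp_class A B u \<otimes>\<^bsub>free_product A B\<^esub> fp_class A B v = fp_class A B (u @ v)"
proof -
  have "fp_class A B (u' @ v') = fp_class A B (u @ v)"
    if "u' \<in> fp_class A B u" "v' \<in> fp_class A B v" for u' v'
  proof -
    have r: "(u, u') \<in> fp_rel A B" "(v, v') \<in> fp_rel A B"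
      using that by (auto simp: fp_class_def)
    then have "(u' @ v', u @ v) \<in> fp_rel A B"
      by (intro fp_rel.sym[OF fp_rel_append[OF assms(1,2)]])
    then show ?thesis
      using fp_class_eq_iff[OF assms(1,2)] fp_rel_in_seqs[OF assms(1,2)] by blast
  qed
  moreover have "u \<in> fp_class A B u" "v \<in> fp_class A B v"
    using assms by (simp_all add: fp_class_def fp_rel.refl)
  ultimately have "(\<Union>u'\<in>fp_class A B u. \<Union>v'\<in>fp_class A B v. fp_class A B (u' @ v')) = fp_class A B (u @ v)"
    by blast
  then show ?thesis
    by (simp add: free_product_def)
qed

lemma fp_inverse_exists:
  assumes "group A" "group B" "u \<in> fp_seqs A B"
  shows "\<exists>v\<in>fp_seqs A B. (v @ u, []) \<in> fp_rel A B"
  using assms(3)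
proof (induction u)
  case Nil
  have "([] @ [], []) \<in> fp_rel A B" by (simp add: fp_rel.refl)
  then show ?case by (intro bexI[of _ "[]"]) simp_all
next
  case (Cons z u)
  interpret A: group A by fact
  interpret B: group B by fact
  have u: "u \<in> fp_seqs A B" using Cons.prems by (cases z) auto
  then obtain v where v: "v \<in> fp_seqs A B" "(v @ u, []) \<in> fp_rel A B"
    using Cons.IH by blast
  obtain z' where z': "z' # v \<in> fp_seqs A B" "(v @ [z', z] @ u, v @ u) \<in> fp_rel A B"
  proof (cases z)
    case (Inl x)
    then have x: "x \<in> carrier A" using Cons.prems by simp
    have "(v @ [Inl (inv\<^bsub>A\<^esub> x), Inl x] @ u, v @ u) \<in> fp_rel A B"
      using fp_rel.trans[OF fp_rel.mult_left[OF v(1) u A.inv_closed[OF x] x]] fp_rel.one_left[OF v(1) u]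
      by (simp add: x)
    then show ?thesis using that[of "Inl (inv\<^bsub>A\<^esub> x)"] x v(1) Inl by simp
  next
    case (Inr y)
    then have y: "y \<in> carrier B" using Cons.prems by simp
    have "(v @ [Inr (inv\<^bsub>B\<^esub> y), Inr y] @ u, v @ u) \<in> fp_rel A B"
      using fp_rel.trans[OF fp_rel.mult_right[OF v(1) u B.inv_closed[OF y] y]] fp_rel.one_right[OF v(1) u]
      by (simp add: y)
    then show ?thesis using that[of "Inr (inv\<^bsub>B\<^esub> y)"] y v(1) Inr by simp
  qed
  have "((v @ [z']) @ (z # u), []) \<in> fp_rel A B"
    using fp_rel.trans[OF z'(2) v(2)] by simp
  moreover have "v @ [z'] \<in> fp_seqs A B"
    using z'(1) v(1) by (cases z') auto
  ultimately show ?case by blast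
qed

lemma group_free_product:
  assumes "group A" "group B"
  shows "group (free_product A B)"
proof -
  have m: "monoid A" "monoid B" using assms by (auto simp: group.is_monoid)
  note simps = carrier_free_product one_free_product mult_free_product[OF m]
  show ?thesis
  proof (rule groupI, goal_cases)
    case (5 X)
    then obtain u where u: "u \<in> fp_seqs A B" "X = fp_class A B u"
      by (auto simp: carrier_free_product)
    obtain v where v: "v \<in> fp_seqs A B" "(v @ u, []) \<in> fp_rel A B"
      using fp_inverse_exists[OF assms u(1)] by blast
    have "fp_class A B v \<otimes>\<^bsub>free_product A B\<^esub> X = \<one>\<^bsub>free_product A B\<^esub>"
      using u v by (simp add: simps fp_class_eq_iff[OF m])
    then show ?case using v by (auto simp: carrier_free_product)
  qed (auto simp: simps)
qed

lemma fp_inl_hom: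
  assumes "monoid A" "monoid B"
  shows "fp_inl A B \<in> hom A (free_product A B)"
proof (rule homI)
  fix x y assume xy: "x \<in> carrier A" "y \<in> carrier A"
  then show "fp_inl A B (x \<otimes>\<^bsub>A\<^esub> y) = fp_inl A B x \<otimes>\<^bsub>free_product A B\<^esub> fp_inl A B y"
    using fp_rel.sym[OF fp_rel.mult_left[of "[]" A B "[]" x y]] assms
    by (simp add: fp_inl_def mult_free_product fp_class_eq_iff monoid.m_closed)
qed (auto simp: fp_inl_def carrier_free_product)

lemma fp_inr_hom:
  assumes "monoid A" "monoid B"
  shows "fp_inr A B \<in> hom B (free_product A B)"
proof (rule homI)
  fix x y assume xy: "x \<in> carrier B" "y \<in> carrier B"
  then show "fp_inr A B (x \<otimes>\<^bsub>B\<^esub> y) = fp_inr A B x \<otimes>\<^bsub>free_product A B\<^esub> fp_inr A B y"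
    using fp_rel.sym[OF fp_rel.mult_right[of "[]" A B "[]" x y]] assms
    by (simp add: fp_inr_def mult_free_product fp_class_eq_iff monoid.m_closed)
qed (auto simp: fp_inr_def carrier_free_product)

primrec fp_lift_seq ::
    "('h, 'k) monoid_scheme \<Rightarrow> ('a \<Rightarrow> 'h) \<Rightarrow> ('b \<Rightarrow> 'h) \<Rightarrow> ('a + 'b) list \<Rightarrow> 'h" where
  "fp_lift_seq H f g [] = \<one>\<^bsub>H\<^esub>"
| "fp_lift_seq H f g (z # u) = case_sum f g z \<otimes>\<^bsub>H\<^esub> fp_lift_seq H f g u"

lemma fp_lift_seq_closed:
  assumes "group H" "f \<in> hom A H" "g \<in> hom B H" "u \<in> fp_seqs A B"
  shows "fp_lift_seq H f g u \<in> carrier H"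
  using assms(4)
proof (induction u)
  case Nil
  then show ?case using assms(1) by (simp add: group.is_monoid monoid.one_closed)
next
  case (Cons z u)
  then show ?case using assms(1-3)
    by (cases z) (simp_all add: group.is_monoid monoid.m_closed hom_in_carrier)
qed

lemma fp_lift_seq_append:
  assumes "group H" "f \<in> hom A H" "g \<in> hom B H" "u \<in> fp_seqs A B" "v \<in> fp_seqs A B"
  shows "fp_lift_seq H f g (u @ v) = fp_lift_seq H f g u \<otimes>\<^bsub>H\<^esub> fp_lift_seq H f g v"
  using assms(4)
proof (induction u)
  case Nil
  then show ?case
    using fp_lift_seq_closed[OF assms(1-3,5)] assms(1) by (simp add: group.is_monoid monoid.l_one)
next
  case (Cons z u)
  then have "u \<in> fp_seqs A B" "case_sum f g z \<in> carrier H"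
    using assms(2,3) by (cases z; simp add: hom_in_carrier)+
  with Cons.IH show ?case
    using fp_lift_seq_closed[OF assms(1-3)] assms(1,5) by (simp add: group.is_monoid monoid.m_assoc)
qed

lemma fp_lift_seq_cong:
  assumes "group A" "group B" "group H" "f \<in> hom A H" "g \<in> hom B H" "(u, v) \<in> fp_rel A B"
  shows "fp_lift_seq H f g u = fp_lift_seq H f g v"
proof -
  interpret H: group H by fact
  note app = fp_lift_seq_append[OF assms(3-5)] and closed = fp_lift_seq_closed[OF assms(3-5)]
  have fg: "f x \<in> carrier H" "g y \<in> carrier H" if "x \<in> carrier A" "y \<in> carrier B" for x y
    using that assms(4,5) by (simp_all add: hom_in_carrier)
  show ?thesis
    using assms(6)
  proof (induction rule: fp_rel.induct)
    case (mult_left u v x y)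
    then show ?case
      using assms(1,4)
      by (simp add: app closed hom_in_carrier hom_mult H.m_assoc group.is_monoid monoid.m_closed)
  next
    case (mult_right u v x y)
    then show ?case
      using assms(2,5)
      by (simp add: app closed hom_in_carrier hom_mult H.m_assoc group.is_monoid monoid.m_closed)
  next
    case (one_left u v)
    then show ?case
      using assms(1,3,4)
      by (simp add: app closed hom_one group.is_monoid monoid.one_closed)
  next
    case (one_right u v)
    then show ?case
      using assms(2,3,5)
      by (simp add: app closed hom_one group.is_monoid monoid.one_closed)
  qed simp_all
qed

lemma fp_universal:
  assumes "group A" "group B" "group H" "f \<in> hom A H" "g \<in> hom B H"
  shows "\<exists>h \<in> hom (free_product A B) H.
    (\<forall>x \<in> carrier A. h (fp_inl A B x) = f x) \<and> (\<forall>y \<in> carrier B. h (fp_inr A B y) = g y)"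
proof -
  interpret H: group H by fact
  have m: "monoid A" "monoid B" using assms by (auto simp: group.is_monoid)
  define h where "h U = fp_lift_seq H f g (SOME u. u \<in> U)" for U
  have h: "h (fp_class A B u) = fp_lift_seq H f g u" if "u \<in> fp_seqs A B" for u
  proof -
    have "u \<in> fp_class A B u" using that by (simp add: fp_class_def fp_rel.refl)
    then have "(SOME u'. u' \<in> fp_class A B u) \<in> fp_class A B u" by (rule someI)
    then show ?thesis
      using fp_lift_seq_cong[OF assms] by (simp add: h_def fp_class_def)
  qed
  show ?thesis
  proof (intro bexI[of _ h] conjI ballI homI)
    fix U V
    assume "U \<in> carrier (free_product A B)" "V \<in> carrier (free_product A B)"
    then obtain u v where "u \<in> fp_seqs A B" "v \<in> fp_seqs A B" "U = fp_class A B u" "V = fp_class A B v"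
      by (auto simp: carrier_free_product)
    then show "h (U \<otimes>\<^bsub>free_product A B\<^esub> V) = h U \<otimes>\<^bsub>H\<^esub> h V"
      by (simp add: mult_free_product[OF m] h fp_lift_seq_append[OF assms(3-5)])
  qed (use assms in \<open>auto simp: carrier_free_product h fp_lift_seq_closed fp_inl_def fp_inr_def hom_in_carrier\<close>)
qed


section \<open>Normal forms in a free product\<close>

definition left_syllable ::
    "('a, 'm) monoid_scheme \<Rightarrow> 'x set \<Rightarrow> ('x \<Rightarrow> 'a) \<Rightarrow> ('x + 'y) word \<Rightarrow> bool" where
  "left_syllable A X a v \<longleftrightarrow>
     (\<exists>w \<in> words X. v = map (apfst Inl) w \<and> \<not> trivial_word A a w)"

definition right_syllable ::
    "('b, 'n) monoid_scheme \<Rightarrow> 'y set \<Rightarrow> ('y \<Rightarrow> 'b) \<Rightarrow> ('x + 'y) word \<Rightarrow> bool" where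
  "right_syllable B Y b v \<longleftrightarrow>
     (\<exists>w \<in> words Y. v = map (apfst Inr) w \<and> \<not> trivial_word B b w)"

text \<open>
  The list \<open>ws\<close> is determined by \<open>u\<close>: its entries are the maximal blocks of letters from one
  factor.  For \<open>ws = []\<close> this is the empty word.
\<close>

definition in_normal_form ::
    "('a, 'm) monoid_scheme \<Rightarrow> 'x set \<Rightarrow> ('x \<Rightarrow> 'a) \<Rightarrow>
     ('b, 'n) monoid_scheme \<Rightarrow> 'y set \<Rightarrow> ('y \<Rightarrow> 'b) \<Rightarrow> ('x + 'y) word \<Rightarrow> bool" where
  "in_normal_form A X a B Y b u \<longleftrightarrow>
     (\<exists>ws. u = concat ws \<and>
        (\<forall>v \<in> set ws. left_syllable A X a v \<or> right_syllable B Y b v) \<and>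
        successively (\<lambda>v v'. left_syllable A X a v \<and> right_syllable B Y b v' \<or>
                             right_syllable B Y b v \<and> left_syllable A X a v') ws)"

definition normal_form_of ::
    "('a, 'm) monoid_scheme \<Rightarrow> 'x set \<Rightarrow> ('x \<Rightarrow> 'a) \<Rightarrow>
     ('b, 'n) monoid_scheme \<Rightarrow> 'y set \<Rightarrow> ('y \<Rightarrow> 'b) \<Rightarrow> ('x + 'y) word \<Rightarrow> ('x + 'y) word \<Rightarrow> bool" where
  "normal_form_of A X a B Y b w u \<longleftrightarrow>
     in_normal_form A X a B Y b u \<and>
     word_value (free_product A B) (fp_generators A B a b) u =
     word_value (free_product A B) (fp_generators A B a b) w"


section \<open>Deterministic multitape Turing machines\<close>

datatype ('c, 'l) symbol = Blank | Input 'l | Aux 'c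

datatype direction = Move_Left | Stay | Move_Right

record ('q, 'c, 'l) tm =
  num_tapes :: nat
  states :: "'q set"
  symbols :: "('c, 'l) symbol set"
  start :: 'q
  accept :: 'q
  reject :: 'q
  delta :: "'q \<Rightarrow> ('c, 'l) symbol list \<Rightarrow> 'q \<times> (('c, 'l) symbol \<times> direction) list"

definition well_formed :: "('q, 'c, 'l) tm \<Rightarrow> 'l set \<Rightarrow> bool" where
  "well_formed M L \<longleftrightarrow>
     num_tapes M \<ge> 1 \<and> finite (states M) \<and> finite (symbols M) \<and>
     {start M, accept M, reject M} \<subseteq> states M \<and> accept M \<noteq> reject M \<and>
     insert Blank (Input ` L) \<subseteq> symbols M \<and>
     (\<forall>q rs q' as.
        q \<in> states M - {accept M, reject M} \<and> length rs = num_tapes M \<and> set rs \<subseteq> symbols M \<and>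
        delta M q rs = (q', as) \<longrightarrow>
          q' \<in> states M \<and> length as = num_tapes M \<and> fst ` set as \<subseteq> symbols M)"

text \<open>A tape is two-way infinite; it is given by its contents and the position of its head.\<close>

type_synonym ('c, 'l) tape = "(int \<Rightarrow> ('c, 'l) symbol) \<times> int"
type_synonym ('q, 'c, 'l) config = "'q \<times> ('c, 'l) tape list"

definition read_tape :: "('c, 'l) tape \<Rightarrow> ('c, 'l) symbol" where
  "read_tape tp = fst tp (snd tp)"

primrec offset :: "direction \<Rightarrow> int" where
  "offset Move_Left = -1"
| "offset Stay = 0"
| "offset Move_Right = 1"

definition act_tape ::
    "('c, 'l) tape \<Rightarrow> ('c, 'l) symbol \<times> direction \<Rightarrow> ('c, 'l) tape" where
  "act_tape tp act = ((fst tp)(snd tp := fst act), snd tp + offset (snd act))"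

definition halting :: "('q, 'c, 'l) tm \<Rightarrow> ('q, 'c, 'l) config \<Rightarrow> bool" where
  "halting M c \<longleftrightarrow> fst c = accept M \<or> fst c = reject M"

definition step :: "('q, 'c, 'l) tm \<Rightarrow> ('q, 'c, 'l) config \<Rightarrow> ('q, 'c, 'l) config" where
  "step M c =
     (if halting M c then c
      else let (q', as) = delta M (fst c) (map read_tape (snd c))
           in (q', map2 act_tape (snd c) as))"

definition word_on_tape :: "'l list \<Rightarrow> int \<Rightarrow> ('c, 'l) symbol" where
  "word_on_tape w i = (if 0 \<le> i \<and> i < int (length w) then Input (w ! nat i) else Blank)"

definition initial :: "('q, 'c, 'l) tm \<Rightarrow> 'l list \<Rightarrow> ('q, 'c, 'l) config" where
  "initial M w =
     (start M, (word_on_tape w, 0) # replicate (num_tapes M - 1) (word_on_tape [], 0))"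

definition config_at :: "('q, 'c, 'l) tm \<Rightarrow> 'l list \<Rightarrow> nat \<Rightarrow> ('q, 'c, 'l) config" where
  "config_at M w k = (step M ^^ k) (initial M w)"

definition halts_on :: "('q, 'c, 'l) tm \<Rightarrow> 'l list \<Rightarrow> bool" where
  "halts_on M w \<longleftrightarrow> (\<exists>k. halting M (config_at M w k))"

definition run_time :: "('q, 'c, 'l) tm \<Rightarrow> 'l list \<Rightarrow> nat" where
  "run_time M w = (LEAST k. halting M (config_at M w k))"

definition final_config :: "('q, 'c, 'l) tm \<Rightarrow> 'l list \<Rightarrow> ('q, 'c, 'l) config" where
  "final_config M w = config_at M w (run_time M w)"

definition decides :: "('q, 'c, 'l) tm \<Rightarrow> 'l set \<Rightarrow> ('l list \<Rightarrow> bool) \<Rightarrow> bool" where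
  "decides M L P \<longleftrightarrow>
     well_formed M L \<and>
     (\<forall>w \<in> lists L. halts_on M w \<and> (fst (final_config M w) = accept M \<longleftrightarrow> P w))"

text \<open>
  The output is the content of the last tape, which must carry nothing but the output word,
  starting at cell 0.
\<close>

definition computes :: "('q, 'c, 'l) tm \<Rightarrow> 'l set \<Rightarrow> ('l list \<Rightarrow> 'l list \<Rightarrow> bool) \<Rightarrow> bool" where
  "computes M L R \<longleftrightarrow>
     well_formed M L \<and>
     (\<forall>w \<in> lists L. halts_on M w \<and>
        (\<exists>u. fst (last (snd (final_config M w))) = word_on_tape u \<and> R w u))"


section \<open>Complexity\<close>

text \<open>
  Machines have finitely many states and tape symbols, so taking states and auxiliary symbols
  from the natural numbers is no restriction.
\<close>

type_synonym 'l machine = "(nat, nat, 'l) tm"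

definition polynomial_time :: "'x letter machine \<Rightarrow> 'x set \<Rightarrow> bool" where
  "polynomial_time M X \<longleftrightarrow>
     (\<exists>d::nat. (\<lambda>n. real (Max (run_time M ` words_of_length X n))) \<in> O(\<lambda>n. real n ^ d))"

definition linear_on_average :: "'x letter machine \<Rightarrow> 'x set \<Rightarrow> bool" where
  "linear_on_average M X \<longleftrightarrow>
     (\<lambda>n. 1 / real (card (words_of_length X n)) * (\<Sum>w\<in>words_of_length X n. real (run_time M w)))
       \<in> O(\<lambda>n. real n)"

definition polynomial_time_word_problem ::
    "('g, 'm) monoid_scheme \<Rightarrow> 'x set \<Rightarrow> ('x \<Rightarrow> 'g) \<Rightarrow> bool" where
  "polynomial_time_word_problem G X g \<longleftrightarrow>
     (\<exists>M :: 'x letter machine. decides M (letters X) (trivial_word G g) \<and> polynomial_time M X)"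

definition average_linear_word_problem ::
    "('g, 'm) monoid_scheme \<Rightarrow> 'x set \<Rightarrow> ('x \<Rightarrow> 'g) \<Rightarrow> bool" where
  "average_linear_word_problem G X g \<longleftrightarrow>
     (\<exists>M :: 'x letter machine. decides M (letters X) (trivial_word G g) \<and> linear_on_average M X)"

definition average_linear_normal_form ::
    "('a, 'm) monoid_scheme \<Rightarrow> 'x set \<Rightarrow> ('x \<Rightarrow> 'a) \<Rightarrow>
     ('b, 'n) monoid_scheme \<Rightarrow> 'y set \<Rightarrow> ('y \<Rightarrow> 'b) \<Rightarrow> bool" where
  "average_linear_normal_form A X a B Y b \<longleftrightarrow>
     (\<exists>M :: ('x + 'y) letter machine.
        computes M (letters (X <+> Y)) (normal_form_of A X a B Y b) \<and>
        linear_on_average M (X <+> Y))"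

end

theory Submission
  imports Defs "HOL-Library.Countable"
begin

text \<open>
  The machine reads the input letter by letter and keeps on its last tape a word in normal form
  with the same value as the prefix read so far.  A new letter is appended to the last syllable
  (or starts a new one), the syllable is copied to the tapes of the given machine for its factor,
  and it is erased if that machine finds it to be trivial.  A letter costs polynomial time in the
  length of the tested syllable, so it suffices that this length has bounded moments on average.

  A tested syllable is never longer than some suffix of the prefix read so far whose value lies in
  \<open>A \<union> B\<close>.  Give an element of the free product the weight \<open>c\<^sup>i d\<^sup>j\<close>, where \<open>i\<close> and \<open>j\<close> count the syllables
  of its normal form from the two factors.  Unless all letters of \<open>A\<close> have the same value and all
  letters of \<open>B\<close> have the same value, \<open>c, d < 1\<close> can be chosen such that multiplication by a random
  letter decreases the expected weight by a factor \<open>\<rho> < 1\<close>; hence a random word of length \<open>k\<close> has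
  its value in \<open>A \<union> B\<close> with probability \<open>O(\<rho>\<^sup>k)\<close>.  In the exceptional case \<open>A\<close> and \<open>B\<close> have order
  two and the tested syllables have length at most two.
\<close>

section \<open>Reachability in bounded time\<close>

definition reach ::
    "('q, 'c, 'l) tm \<Rightarrow> nat \<Rightarrow> ('q, 'c, 'l) config \<Rightarrow> ('q, 'c, 'l) config \<Rightarrow> bool" where
  "reach M n c c' \<longleftrightarrow> (\<exists>j\<le>n. (step M ^^ j) c = c')"

lemma reach_refl [simp]: "reach M n c c"
  unfolding reach_def by (intro exI[of _ 0]) simp

lemma reach_mono: "reach M m c c' \<Longrightarrow> m \<le> n \<Longrightarrow> reach M n c c'"
  unfolding reach_def using le_trans by blast

lemma reach_trans: "reach M m c c' \<Longrightarrow> reach M n c' c'' \<Longrightarrow> reach M (m + n) c c''"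
  unfolding reach_def
proof (elim exE conjE)
  fix i j
  assume "i \<le> m" "j \<le> n" "(step M ^^ i) c = c'" "(step M ^^ j) c' = c''"
  then show "\<exists>k\<le>m + n. (step M ^^ k) c = c''"
    by (intro exI[of _ "j + i"]) (simp add: funpow_add)
qed

lemma reach_step: "reach M n (step M c) c' \<Longrightarrow> reach M (Suc n) c c'"
  using reach_trans[of M 1 c "step M c" n c'] by (force simp: reach_def)

lemma step_funpow_halting: "halting M c \<Longrightarrow> (step M ^^ j) c = c"
  by (induction j) (simp_all add: step_def)

lemma reach_halting:
  assumes "reach M n (initial M w) c" "halting M c"
  shows "halts_on M w" "run_time M w \<le> n" "final_config M w = c"
proof -
  obtain j where j: "j \<le> n" "config_at M w j = c"
    using assms(1) by (auto simp: reach_def config_at_def)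
  then have h: "halting M (config_at M w j)" using assms(2) by simp
  then show "halts_on M w" by (auto simp: halts_on_def)
  have le: "run_time M w \<le> j"
    unfolding run_time_def by (rule Least_le[of "\<lambda>k. halting M (config_at M w k)", OF h])
  then show "run_time M w \<le> n" using j(1) by simp
  have "halting M (config_at M w (run_time M w))"
    unfolding run_time_def by (rule LeastI[of "\<lambda>k. halting M (config_at M w k)", OF h])
  then have "(step M ^^ (j - run_time M w)) (config_at M w (run_time M w)) = config_at M w (run_time M w)"
    by (rule step_funpow_halting)
  moreover have "(step M ^^ (j - run_time M w)) (config_at M w (run_time M w)) = config_at M w j"
    using le fun_cong[OF funpow_add[of "j - run_time M w" "run_time M w" "step M"], of "initial M w"]
    by (simp add: config_at_def)
  ultimately show "final_config M w = c" using j(2) by (simp add: final_config_def)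
qed

lemma run_time_least: "j < run_time M w \<Longrightarrow> \<not> halting M (config_at M w j)"
  unfolding run_time_def by (rule not_less_Least)

lemma run_time_halting: "halts_on M w \<Longrightarrow> halting M (config_at M w (run_time M w))"
  unfolding run_time_def halts_on_def by (rule LeastI_ex)

section \<open>Reachable configurations\<close>

lemma well_formedI:
  assumes "num_tapes M \<ge> 1" "finite (states M)" "finite (symbols M)"
    "{start M, accept M, reject M} \<subseteq> states M" "accept M \<noteq> reject M"
    "insert Blank (Input ` L) \<subseteq> symbols M"
    "\<And>q rs. q \<in> states M - {accept M, reject M} \<Longrightarrow> length rs = num_tapes M \<Longrightarrow>
      set rs \<subseteq> symbols M \<Longrightarrow> fst (delta M q rs) \<in> states M \<and>
      length (snd (delta M q rs)) = num_tapes M \<and> fst ` set (snd (delta M q rs)) \<subseteq> symbols M"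
  shows "well_formed M L"
  unfolding well_formed_def
proof (intro conjI allI impI; (elim conjE)?)
  fix q rs q' as
  assume *: "q \<in> states M - {accept M, reject M}" "length rs = num_tapes M" "set rs \<subseteq> symbols M"
    and "delta M q rs = (q', as)"
  then show "q' \<in> states M" "length as = num_tapes M" "fst ` set as \<subseteq> symbols M"
    using assms(7)[OF *] by simp_all
qed (fact assms)+

lemma well_formedD:
  assumes "well_formed M L"
  shows "num_tapes M \<ge> 1" "finite (states M)" "finite (symbols M)"
    "{start M, accept M, reject M} \<subseteq> states M" "accept M \<noteq> reject M"
    "insert Blank (Input ` L) \<subseteq> symbols M"
    "\<forall>q rs q' as.
        q \<in> states M - {accept M, reject M} \<and> length rs = num_tapes M \<and> set rs \<subseteq> symbols M \<and>
        delta M q rs = (q', as) \<longrightarrow>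
          q' \<in> states M \<and> length as = num_tapes M \<and> fst ` set as \<subseteq> symbols M"
  by (rule assms[unfolded well_formed_def, THEN conjunct1]
      assms[unfolded well_formed_def, THEN conjunct2, THEN conjunct1]
      assms[unfolded well_formed_def, THEN conjunct2, THEN conjunct2, THEN conjunct1]
      assms[unfolded well_formed_def, THEN conjunct2, THEN conjunct2, THEN conjunct2, THEN conjunct1]
      assms[unfolded well_formed_def, THEN conjunct2, THEN conjunct2, THEN conjunct2, THEN conjunct2, THEN conjunct1]
      assms[unfolded well_formed_def, THEN conjunct2, THEN conjunct2, THEN conjunct2, THEN conjunct2, THEN conjunct2, THEN conjunct1]
      assms[unfolded well_formed_def, THEN conjunct2, THEN conjunct2, THEN conjunct2, THEN conjunct2, THEN conjunct2, THEN conjunct2])+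

lemma well_formed_delta:
  assumes "well_formed M L" "q \<in> states M - {accept M, reject M}" "length rs = num_tapes M"
    "set rs \<subseteq> symbols M"
  shows "fst (delta M q rs) \<in> states M" "length (snd (delta M q rs)) = num_tapes M"
    "fst ` set (snd (delta M q rs)) \<subseteq> symbols M"
  using well_formedD(7)[OF assms(1), rule_format, of q rs "fst (delta M q rs)" "snd (delta M q rs)"]
    assms(2-4) by simp_all

definition valid_config :: "('q, 'c, 'l) tm \<Rightarrow> ('q, 'c, 'l) config \<Rightarrow> bool" where
  "valid_config M c \<longleftrightarrow> fst c \<in> states M \<and> length (snd c) = num_tapes M \<and>
     (\<forall>tp\<in>set (snd c). range (fst tp) \<subseteq> symbols M)"

lemma valid_config_reads:
  assumes "valid_config M c"
  shows "length (map read_tape (snd c)) = num_tapes M" "set (map read_tape (snd c)) \<subseteq> symbols M"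
  using assms by (auto simp: valid_config_def read_tape_def)

lemma valid_config_delta:
  assumes "well_formed M L" "valid_config M c" "\<not> halting M c"
    "delta M (fst c) (map read_tape (snd c)) = (q, as)"
  shows "q \<in> states M" "length as = num_tapes M" "fst ` set as \<subseteq> symbols M"
proof -
  have "fst c \<in> states M - {accept M, reject M}"
    using assms(2,3) by (auto simp: valid_config_def halting_def)
  from well_formed_delta[OF assms(1) this valid_config_reads[OF assms(2)]]
  show "q \<in> states M" "length as = num_tapes M" "fst ` set as \<subseteq> symbols M"
    using assms(4) by simp_all
qed

lemma valid_config_step:
  assumes "well_formed M L" "valid_config M c"
  shows "valid_config M (step M c)"
proof (cases "halting M c")
  case False
  obtain q as where d: "delta M (fst c) (map read_tape (snd c)) = (q, as)" by fastforce
  note * = valid_config_delta[OF assms False d]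
  have "range (fst tp') \<subseteq> symbols M" if tp': "tp' \<in> set (map2 act_tape (snd c) as)" for tp'
  proof -
    obtain tp a where "(tp, a) \<in> set (zip (snd c) as)" "tp' = act_tape tp a"
      using tp' by auto
    moreover from this have "tp \<in> set (snd c)" "a \<in> set as"
      by (auto dest: set_zip_leftD set_zip_rightD)
    ultimately show ?thesis
      using assms(2) *(3) by (force simp: valid_config_def act_tape_def)
  qed
  then show ?thesis
    using assms(2) * False d by (simp add: step_def valid_config_def)
qed (use assms in \<open>simp add: step_def\<close>)

lemma valid_config_initial:
  assumes "well_formed M L" "w \<in> lists L"
  shows "valid_config M (initial M w)"
proof -
  have "range (word_on_tape v) \<subseteq> symbols M" if "v \<in> lists L" for v
  proof -
    have "v ! i \<in> L" if "i < length v" for i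
      using \<open>v \<in> lists L\<close> that by (simp add: in_lists_conv_set)
    then show ?thesis
      using well_formedD(6)[OF assms(1)] by (auto simp: word_on_tape_def image_subset_iff)
  qed
  from this[OF assms(2)] this[of "[]"] show ?thesis
    using well_formedD(1,4)[OF assms(1)] by (auto simp: valid_config_def initial_def)
qed

lemma valid_config_at:
  assumes "well_formed M L" "w \<in> lists L"
  shows "valid_config M (config_at M w j)"
  unfolding config_at_def
  by (induction j) (simp_all add: valid_config_initial[OF assms] valid_config_step[OF assms(1)])

section \<open>Renaming and padding machines\<close>

instance symbol :: (countable, countable) countable
  by countable_datatype

abbreviation encode_symbol :: "('c::countable, 'l) symbol \<Rightarrow> (nat, 'l) symbol" where
  "encode_symbol \<equiv> map_symbol to_nat id"

definition encode_config ::
    "('q::countable, 'c::countable, 'l) config \<Rightarrow> (nat, nat, 'l) config" where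
  "encode_config c = (to_nat (fst c), map (\<lambda>tp. (encode_symbol \<circ> fst tp, snd tp)) (snd c))"

definition encode_tm :: "('q::countable, 'c::countable, 'l) tm \<Rightarrow> 'l machine" where
  "encode_tm M = \<lparr>num_tapes = num_tapes M, states = to_nat ` states M,
     symbols = encode_symbol ` symbols M,
     start = to_nat (start M), accept = to_nat (accept M), reject = to_nat (reject M),
     delta = \<lambda>q rs. case delta M (from_nat q) (map (map_symbol from_nat id) rs) of
       (q', as) \<Rightarrow> (to_nat q', map (apfst encode_symbol) as)\<rparr>"

lemma decode_encode_symbol [simp]: "map_symbol from_nat id (encode_symbol s) = s"
  by (cases s) simp_all

lemma halting_encode: "halting (encode_tm M) (encode_config c) \<longleftrightarrow> halting M c"
  by (simp add: halting_def encode_tm_def encode_config_def)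

lemma step_encode: "step (encode_tm M) (encode_config c) = encode_config (step M c)"
proof (cases "halting M c")
  case True
  then show ?thesis by (simp add: step_def halting_encode)
next
  case False
  obtain q as where d: "delta M (fst c) (map read_tape (snd c)) = (q, as)" by fastforce
  have reads: "map (map_symbol from_nat id) (map read_tape (snd (encode_config c))) = map read_tape (snd c)"
    by (simp add: encode_config_def read_tape_def comp_def)
  have "delta (encode_tm M) (fst (encode_config c)) (map read_tape (snd (encode_config c)))
      = (to_nat q, map (apfst encode_symbol) as)"
    using reads d by (simp add: encode_tm_def) (simp add: encode_config_def)
  moreover have "map2 act_tape (snd (encode_config c)) (map (apfst encode_symbol) as)
      = map (\<lambda>tp. (encode_symbol \<circ> fst tp, snd tp)) (map2 act_tape (snd c) as)"
    by (simp add: encode_config_def zip_map1 zip_map2 split_def act_tape_def fun_eq_iff)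
  ultimately show ?thesis
    using False by (simp add: step_def halting_encode d) (simp add: encode_config_def)
qed

lemma encode_word_on_tape [simp]: "encode_symbol \<circ> word_on_tape u = word_on_tape u"
  by (auto simp: word_on_tape_def)

lemma config_at_encode: "config_at (encode_tm M) w j = encode_config (config_at M w j)"
proof -
  have "initial (encode_tm M) w = encode_config (initial M w)"
    by (simp add: initial_def encode_config_def) (simp add: encode_tm_def)
  then show ?thesis
    unfolding config_at_def by (induction j) (simp_all add: step_encode)
qed

lemma run_time_encode: "run_time (encode_tm M) w = run_time M w"
  by (simp add: run_time_def config_at_encode halting_encode)

lemma well_formed_encode:
  assumes "well_formed M L"
  shows "well_formed (encode_tm M) L"
proof (rule well_formedI)
  fix q rs
  assume h: "q \<in> states (encode_tm M) - {accept (encode_tm M), reject (encode_tm M)}"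
    "length rs = num_tapes (encode_tm M)" "set rs \<subseteq> symbols (encode_tm M)"
  obtain p where p: "p \<in> states M - {accept M, reject M}" "q = to_nat p"
    using h(1) by (fastforce simp: encode_tm_def)
  define rs' :: "('b, 'c) symbol list" where "rs' = map (map_symbol from_nat id) rs"
  have rs': "length rs' = num_tapes M"
    using h(2) by (simp add: rs'_def encode_tm_def)
  have "set rs \<subseteq> encode_symbol ` symbols M"
    using h(3) by (simp add: encode_tm_def)
  then have rs'_symbols: "set rs' \<subseteq> symbols M"
    by (fastforce simp: rs'_def)
  note * = well_formed_delta[OF assms p(1) rs' rs'_symbols]
  have d: "fst (delta (encode_tm M) q rs) = to_nat (fst (delta M p rs'))"
    "snd (delta (encode_tm M) q rs) = map (apfst encode_symbol) (snd (delta M p rs'))"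
    using p(2) by (simp_all add: encode_tm_def rs'_def split_def)
  moreover have "fst ` set (snd (delta (encode_tm M) q rs)) = encode_symbol ` fst ` set (snd (delta M p rs'))"
    by (simp add: d image_image)
  ultimately show "fst (delta (encode_tm M) q rs) \<in> states (encode_tm M) \<and>
      length (snd (delta (encode_tm M) q rs)) = num_tapes (encode_tm M) \<and>
      fst ` set (snd (delta (encode_tm M) q rs)) \<subseteq> symbols (encode_tm M)"
    using * by (simp add: encode_tm_def image_mono)
next
  from image_mono[OF well_formedD(6)[OF assms], of encode_symbol]
  show "insert Blank (Input ` L) \<subseteq> symbols (encode_tm M)"
    by (simp add: encode_tm_def image_image)
qed (use well_formedD(1-5)[OF assms] in \<open>simp_all add: encode_tm_def\<close>)

lemma decides_encode: "decides M L P \<Longrightarrow> decides (encode_tm M) L P"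
  by (auto simp: decides_def well_formed_encode halts_on_def final_config_def run_time_encode
      config_at_encode halting_encode) (auto simp: encode_config_def encode_tm_def)

lemma computes_encode:
  assumes "computes M L R"
  shows "computes (encode_tm M) L R"
  unfolding computes_def
proof (intro conjI ballI)
  show "well_formed (encode_tm M) L"
    using assms by (simp add: computes_def well_formed_encode)
  fix w assume w: "w \<in> lists L"
  show "halts_on (encode_tm M) w"
    using assms w by (auto simp: computes_def halts_on_def config_at_encode halting_encode)
  obtain u where u: "fst (last (snd (final_config M w))) = word_on_tape u" "R w u"
    using assms w by (auto simp: computes_def)
  have "snd (final_config M w) \<noteq> []"
    using valid_config_at[of M L w "run_time M w"] assms w
      well_formedD(1)[of M L]
    by (fastforce simp: computes_def final_config_def valid_config_def)
  moreover have "final_config (encode_tm M) w = encode_config (final_config M w)"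
    by (simp add: final_config_def config_at_encode run_time_encode)
  ultimately have "fst (last (snd (final_config (encode_tm M) w))) = word_on_tape u"
    using u(1) by (simp add: encode_config_def last_map)
  then show "\<exists>u. fst (last (snd (final_config (encode_tm M) w))) = word_on_tape u \<and> R w u"
    using u(2) by blast
qed

definition pad_tm :: "nat \<Rightarrow> ('q, 'c, 'l) tm \<Rightarrow> ('q, 'c, 'l) tm" where
  "pad_tm k M = M\<lparr>num_tapes := num_tapes M + k,
     delta := \<lambda>q rs. case delta M q (take (num_tapes M) rs) of
       (q', as) \<Rightarrow> (q', as @ map (\<lambda>r. (r, Stay)) (drop (num_tapes M) rs))\<rparr>"

lemma pad_tm_sel [simp]:
  "num_tapes (pad_tm k M) = num_tapes M + k" "states (pad_tm k M) = states M"
  "symbols (pad_tm k M) = symbols M" "start (pad_tm k M) = start M"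
  "accept (pad_tm k M) = accept M" "reject (pad_tm k M) = reject M"
  "halting (pad_tm k M) = halting M"
  by (simp_all add: pad_tm_def halting_def fun_eq_iff)

lemma well_formed_pad:
  assumes "well_formed M L"
  shows "well_formed (pad_tm k M) L"
proof (rule well_formedI; unfold pad_tm_sel)
  fix q rs
  assume h: "q \<in> states M - {accept M, reject M}" "length rs = num_tapes M + k" "set rs \<subseteq> symbols M"
  have "length (take (num_tapes M) rs) = num_tapes M"
    using h(2) by simp
  note * = well_formed_delta[OF assms h(1) this order_trans[OF set_take_subset h(3)]]
  moreover have "set (drop (num_tapes M) rs) \<subseteq> symbols M"
    by (rule order_trans[OF set_drop_subset h(3)])
  ultimately show "fst (delta (pad_tm k M) q rs) \<in> states M \<and>
      length (snd (delta (pad_tm k M) q rs)) = num_tapes M + k \<and>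
      fst ` set (snd (delta (pad_tm k M) q rs)) \<subseteq> symbols M"
    using h(2) by (simp add: pad_tm_def split_def image_Un image_image)
qed (use well_formedD(1-6)[OF assms] in simp_all)

lemma step_pad:
  assumes "well_formed M L" "valid_config M c" "step M c = (q', ts')"
  shows "step (pad_tm k M) (fst c, snd c @ bs) = (q', ts' @ bs)"
proof (cases "halting M c")
  case True
  then show ?thesis using assms(3) by (simp add: step_def halting_def)
next
  case False
  obtain q as where d: "delta M (fst c) (map read_tape (snd c)) = (q, as)" by fastforce
  have len: "length (snd c) = num_tapes M" using assms(2) by (simp add: valid_config_def)
  have as: "length as = num_tapes M" by (rule valid_config_delta[OF assms(1,2) False d])
  have "map2 act_tape bs (map ((\<lambda>r. (r, Stay)) \<circ> read_tape) bs) = bs"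
    by (induction bs) (simp_all add: act_tape_def read_tape_def)
  then show ?thesis
    using False d assms(3) len as
    by (auto simp: step_def halting_def pad_tm_def)
qed

lemma config_at_pad:
  assumes "well_formed M L" "w \<in> lists L"
  shows "config_at (pad_tm k M) w j =
    (fst (config_at M w j), snd (config_at M w j) @ replicate k (word_on_tape [], 0))"
proof (induction j)
  case 0
  have "num_tapes M \<ge> 1" using well_formedD(1)[OF assms(1)] by simp
  then have "num_tapes M + k - 1 = num_tapes M - 1 + k" by simp
  then show ?case by (simp add: config_at_def initial_def replicate_add)
next
  case (Suc j)
  have "config_at M w (Suc j) = step M (config_at M w j)" by (simp add: config_at_def)
  then have "step M (config_at M w j) = (fst (config_at M w (Suc j)), snd (config_at M w (Suc j)))"
    by simp
  from step_pad[OF assms(1) valid_config_at[OF assms] this] Suc show ?case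
    by (simp add: config_at_def)
qed

lemma run_time_pad:
  assumes "well_formed M L" "w \<in> lists L"
  shows "run_time (pad_tm k M) w = run_time M w"
  by (simp add: run_time_def config_at_pad[OF assms] halting_def)

lemma decides_pad:
  assumes "decides M L P"
  shows "decides (pad_tm k M) L P"
proof -
  have M: "well_formed M L" using assms by (simp add: decides_def)
  have "halts_on (pad_tm k M) w \<and> (fst (final_config (pad_tm k M) w) = accept (pad_tm k M) \<longleftrightarrow> P w)"
    if w: "w \<in> lists L" for w
    using assms w
    by (simp add: decides_def halts_on_def final_config_def run_time_pad[OF M w]
        config_at_pad[OF M w] halting_def del: in_lists_conv_set)
  then show ?thesis by (simp add: decides_def well_formed_pad[OF M] del: in_lists_conv_set)
qed

section \<open>The stack of syllables\<close>

definition fac :: "('x + 'y) letter \<Rightarrow> bool" where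
  "fac x = isl (fst x)"

definition strip :: "('x + 'x) letter \<Rightarrow> 'x letter" where
  "strip = apfst (case_sum id id)"

definition tested :: "('x + 'y) word list \<Rightarrow> ('x + 'y) letter \<Rightarrow> ('x + 'y) word" where
  "tested ws x = (if ws \<noteq> [] \<and> fac (hd (hd ws)) = fac x then hd ws @ [x] else [x])"

definition below :: "('x + 'y) word list \<Rightarrow> ('x + 'y) letter \<Rightarrow> ('x + 'y) word list" where
  "below ws x = (if ws \<noteq> [] \<and> fac (hd (hd ws)) = fac x then tl ws else ws)"

definition push ::
    "(('x + 'y) word \<Rightarrow> bool) \<Rightarrow> ('x + 'y) word list \<Rightarrow> ('x + 'y) letter \<Rightarrow> ('x + 'y) word list" where
  "push P ws x = (if P (tested ws x) then below ws x else tested ws x # below ws x)"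

definition block_test :: "(bool \<Rightarrow> 'x word \<Rightarrow> bool) \<Rightarrow> ('x + 'x) word \<Rightarrow> bool" where
  "block_test P v = P (fac (hd v)) (map strip v)"

definition run :: "(('x + 'y) word \<Rightarrow> bool) \<Rightarrow> ('x + 'y) word \<Rightarrow> ('x + 'y) word list" where
  "run P w = foldl (push P) [] w"

definition tests ::
    "(('x + 'y) word \<Rightarrow> bool) \<Rightarrow> ('x + 'y) word \<Rightarrow> ('x + 'y) word list" where
  "tests P w = map (\<lambda>p. tested (run P (take p w)) (w ! p)) [0..<length w]"

definition flat :: "'x word list \<Rightarrow> 'x word" where
  "flat ws = concat (rev ws)"

definition block :: "bool \<Rightarrow> ('x + 'y) word \<Rightarrow> bool" where
  "block c v \<longleftrightarrow> v \<noteq> [] \<and> (\<forall>x\<in>set v. fac x = c)"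

definition stacked :: "('x + 'y) word list \<Rightarrow> bool" where
  "stacked ws \<longleftrightarrow> (\<forall>v\<in>set ws. block (fac (hd v)) v) \<and>
     successively (\<lambda>v v'. fac (hd v) \<noteq> fac (hd v')) ws"

lemma run_Nil [simp]: "run P [] = []"
  and run_snoc [simp]: "run P (w @ [x]) = push P (run P w) x"
  by (simp_all add: run_def)

lemma tests_Nil [simp]: "tests P [] = []"
  by (simp add: tests_def)

lemma tests_snoc [simp]: "tests P (w @ [x]) = tests P w @ [tested (run P w) x]"
  by (auto simp: tests_def nth_append)

lemma flat_Nil [simp]: "flat [] = []"
  and flat_Cons [simp]: "flat (v # ws) = flat ws @ v"
  by (simp_all add: flat_def)

lemma set_flat: "set (flat ws) = \<Union> (set ` set ws)"
  by (auto simp: flat_def)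

lemma flat_below_tested: "flat (below ws x) @ tested ws x = flat ws @ [x]"
  by (cases ws) (auto simp: below_def tested_def)

lemma tested_nonempty [simp]: "tested ws x \<noteq> []"
  by (simp add: tested_def)

lemma stacked_Nil [simp]: "stacked []"
  by (simp add: stacked_def)

lemma block_Nil [simp]: "\<not> block c []"
  and block_snoc: "block c (v @ [x]) \<longleftrightarrow> fac x = c \<and> (v = [] \<or> block c v)"
  by (auto simp: block_def)

lemma block_hd: "block c v \<Longrightarrow> fac (hd v) = c"
  and block_last: "block c v \<Longrightarrow> fac (last v) = c"
  by (simp_all add: block_def)

lemma stacked_Cons:
  "stacked (v # ws) \<longleftrightarrow> block (fac (hd v)) v \<and> stacked ws \<and>
     (ws \<noteq> [] \<longrightarrow> fac (hd (hd ws)) \<noteq> fac (hd v))"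
  by (cases ws) (auto simp: stacked_def)

lemma stacked_below:
  assumes "stacked ws"
  shows "stacked (below ws x)"
proof (cases "ws \<noteq> [] \<and> fac (hd (hd ws)) = fac x")
  case True
  then show ?thesis using assms by (cases ws) (simp_all add: stacked_Cons below_def)
next
  case False
  then show ?thesis using assms unfolding below_def if_not_P[OF False] by simp
qed

lemma hd_below:
  assumes "stacked ws" "below ws x \<noteq> []"
  shows "fac (hd (hd (below ws x))) \<noteq> fac x"
proof (cases "ws \<noteq> [] \<and> fac (hd (hd ws)) = fac x")
  case True
  then show ?thesis using assms by (cases ws) (simp_all add: stacked_Cons below_def)
next
  case False
  then show ?thesis using assms(2) unfolding below_def if_not_P[OF False] by simp
qed

lemma block_tested:
  assumes "stacked ws"
  shows "block (fac x) (tested ws x)"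
proof (cases "ws \<noteq> [] \<and> fac (hd (hd ws)) = fac x")
  case True
  then have "block (fac x) (hd ws)" using assms by (cases ws) (simp_all add: stacked_Cons)
  then show ?thesis using True by (simp add: tested_def block_snoc)
next
  case False
  then show ?thesis unfolding tested_def if_not_P[OF False] by (simp add: block_def)
qed

lemma stacked_push:
  assumes "stacked ws"
  shows "stacked (push P ws x)"
  using stacked_below[OF assms, of x] hd_below[OF assms, of x]
    block_tested[OF assms, of x] block_hd[OF block_tested[OF assms, of x]]
  by (simp add: push_def stacked_Cons)

lemma stacked_run: "stacked (run P w)"
  by (induction w rule: rev_induct) (simp_all add: stacked_push)

lemma last_flat_below:
  assumes "stacked ws" "flat (below ws x) \<noteq> []"
  shows "fac (last (flat (below ws x))) \<noteq> fac x"
proof (cases "below ws x")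
  case (Cons v vs)
  then have v: "block (fac (hd v)) v" "fac (hd v) \<noteq> fac x"
    using stacked_below[OF assms(1), of x] hd_below[OF assms(1), of x] by (simp_all add: stacked_Cons)
  moreover have "v \<noteq> []" using v(1) by auto
  ultimately show ?thesis using Cons block_last[OF v(1)] by simp
qed (use assms in simp)

lemma set_tested: "set (tested ws x) \<subseteq> insert x (set (flat ws))"
  by (cases ws) (auto simp: tested_def)

lemma set_flat_push: "set (flat (push P ws x)) \<subseteq> insert x (set (flat ws))"
  using arg_cong[OF flat_below_tested[of ws x], of set] by (auto simp: push_def)

lemma set_flat_run: "set (flat (run P w)) \<subseteq> set w"
proof (induction w rule: rev_induct)
  case (snoc x w)
  then show ?case using set_flat_push[of P "run P w" x] by auto
qed simp

section \<open>A machine maintaining the stack\<close>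

datatype phase = Fetch | Copy bool | Sim bool nat | Ret bool bool | Erase bool
  | Clean_Right | Clean_Left | Fin | Acc | Rej

instance phase :: countable
  by countable_datatype

text \<open>
  The tapes are the input tape, the tapes of the simulated machine and the stack tape.  A cell
  visited during a simulation carries \<open>Aux s\<close>, even if its simulated content \<open>s\<close> is blank, so
  that the visited cells form an interval of non-blank cells which can be erased afterwards.
  \<open>Copy c\<close> copies the last syllable from right to left, \<open>Sim c q\<close> simulates \<open>M c\<close> in state \<open>q\<close>, and
  \<open>Ret c b\<close> returns to the end of the stack, where the syllable is erased if \<open>b\<close> holds.
\<close>

type_synonym inner_symbol = "(nat, nat letter) symbol"
type_synonym outer_symbol = "(inner_symbol, (nat + nat) letter) symbol"
type_synonym outer_tape = "(inner_symbol, (nat + nat) letter) tape"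

definition dec :: "outer_symbol \<Rightarrow> inner_symbol" where
  "dec r = (case r of Aux s \<Rightarrow> s | _ \<Rightarrow> Blank)"

abbreviation keep :: "('c, 'l) symbol \<Rightarrow> ('c, 'l) symbol \<times> direction" where
  "keep r \<equiv> (r, Stay)"

fun outer_trans ::
    "(bool \<Rightarrow> nat letter machine) \<Rightarrow> phase \<Rightarrow> outer_symbol \<Rightarrow> outer_symbol list \<Rightarrow> outer_symbol
      \<Rightarrow> phase \<times> (outer_symbol \<times> direction) \<times> (outer_symbol \<times> direction) list \<times> (outer_symbol \<times> direction)"
  where
  "outer_trans M Fetch i rs t = (case i of
     Input x \<Rightarrow> (Copy (fac x), (i, Move_Right), map keep rs, (i, Stay))
   | _ \<Rightarrow> (Fin, keep i, map keep rs, (t, Move_Left)))"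
| "outer_trans M (Copy c) i rs t =
    (let stop = (Sim c (start (M c)), keep i, (hd rs, Move_Right) # map keep (tl rs), (t, Move_Right))
     in case t of
       Input x \<Rightarrow> if fac x = c
         then (Copy c, keep i, (Aux (Input (strip x)), Move_Left) # map keep (tl rs), (t, Move_Left))
         else stop
     | _ \<Rightarrow> stop)"
| "outer_trans M (Sim c q) i rs t =
    (if q = accept (M c) \<or> q = reject (M c)
     then (Ret c (q = accept (M c)), keep i, map (\<lambda>r. (Aux (dec r), Stay)) rs, keep t)
     else if set (map dec rs) \<subseteq> symbols (M c)
     then (case delta (M c) q (map dec rs) of
       (q', as) \<Rightarrow> (Sim c q', keep i, map (apfst Aux) as, keep t))
     else (Rej, keep i, map keep rs, keep t))"
| "outer_trans M (Ret c b) i rs t =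
    (if t \<noteq> Blank then (Ret c b, keep i, map keep rs, (t, Move_Right))
     else if b then (Erase c, keep i, map keep rs, (t, Move_Left))
     else (Clean_Right, keep i, map keep rs, keep t))"
| "outer_trans M (Erase c) i rs t =
    (if \<exists>x. t = Input x \<and> fac x = c then (Erase c, keep i, map keep rs, (Blank, Move_Left))
     else (Clean_Right, keep i, map keep rs, (t, Move_Right)))"
| "outer_trans M Clean_Right i rs t =
    (if set rs \<subseteq> {Blank} then (Clean_Left, keep i, map (\<lambda>r. (r, Move_Left)) rs, keep t)
     else (Clean_Right, keep i, map (\<lambda>r. if r = Blank then keep r else (r, Move_Right)) rs, keep t))"
| "outer_trans M Clean_Left i rs t =
    (if set rs \<subseteq> {Blank} then (Fetch, keep i, map keep rs, keep t)
     else (Clean_Left, keep i, map (\<lambda>r. if r = Blank then keep r else (Blank, Move_Left)) rs, keep t))"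
| "outer_trans M Fin i rs t = (if t = Blank then Acc else Rej, keep i, map keep rs, keep t)"
| "outer_trans M Acc i rs t = (Acc, keep i, map keep rs, keep t)"
| "outer_trans M Rej i rs t = (Rej, keep i, map keep rs, keep t)"

definition outer_tm ::
    "(bool \<Rightarrow> nat letter machine) \<Rightarrow> nat \<Rightarrow> (nat + nat) letter set
      \<Rightarrow> (phase, inner_symbol, (nat + nat) letter) tm" where
  "outer_tm M K L = \<lparr>num_tapes = K + 2,
     states = {q. case q of Sim c p \<Rightarrow> p \<in> states (M c) | _ \<Rightarrow> True},
     symbols = {r. case r of Blank \<Rightarrow> True | Input x \<Rightarrow> x \<in> L | Aux s \<Rightarrow> \<exists>c. s \<in> symbols (M c)},
     start = Fetch, accept = Acc, reject = Rej,
     delta = \<lambda>q rs. case outer_trans M q (hd rs) (butlast (tl rs)) (last rs) of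
       (q', a, as, b) \<Rightarrow> (q', a # as @ [b])\<rparr>"

locale inner_machines =
  fixes M :: "bool \<Rightarrow> nat letter machine" and K :: nat and X :: "bool \<Rightarrow> nat set"
    and P :: "bool \<Rightarrow> nat word \<Rightarrow> bool"
  assumes tapes: "num_tapes (M c) = K"
    and decides: "decides (M c) (letters (X c)) (P c)"
    and finite_X: "finite (X c)"
begin

definition L :: "(nat + nat) letter set" where
  "L = letters (X True <+> X False)"

definition N :: "(phase, inner_symbol, (nat + nat) letter) tm" where
  "N = outer_tm M K L"

abbreviation test :: "(nat + nat) word \<Rightarrow> bool" where
  "test \<equiv> block_test P"

lemma well_formed_M: "well_formed (M c) (letters (X c))"
  using decides by (simp add: decides_def)

lemma K_pos: "K \<ge> 1"
  using well_formedD(1)[OF well_formed_M] tapes by simp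

lemma strip_letters: "x \<in> L \<Longrightarrow> strip x \<in> letters (X (fac x))"
  by (auto simp: L_def letters_def strip_def fac_def)

lemma N_simps [simp]:
  "num_tapes N = K + 2" "start N = Fetch" "accept N = Acc" "reject N = Rej"
  "delta N q rs = (case outer_trans M q (hd rs) (butlast (tl rs)) (last rs) of
       (q', a, as, b) \<Rightarrow> (q', a # as @ [b]))"
  by (simp_all add: N_def outer_tm_def)

lemma symbols_N: "r \<in> symbols N \<longleftrightarrow>
    (case r of Blank \<Rightarrow> True | Input x \<Rightarrow> x \<in> L | Aux s \<Rightarrow> \<exists>c. s \<in> symbols (M c))"
  by (simp add: N_def outer_tm_def)

lemma states_N: "q \<in> states N \<longleftrightarrow> (case q of Sim c p \<Rightarrow> p \<in> states (M c) | _ \<Rightarrow> True)"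
  by (simp add: N_def outer_tm_def)

lemma Blank_inner: "Blank \<in> symbols (M c)"
  using well_formedD(6)[OF well_formed_M] by auto

lemma dec_symbols: "r \<in> symbols N \<Longrightarrow> Aux (dec r) \<in> symbols N"
  using Blank_inner by (auto simp: symbols_N dec_def split: symbol.splits)

lemma outer_trans_valid:
  assumes "q \<in> states N" "i \<in> symbols N" "set rs \<subseteq> symbols N" "t \<in> symbols N" "length rs = K"
    and "outer_trans M q i rs t = (q', a, as, b)"
  shows "q' \<in> states N \<and> fst a \<in> symbols N \<and> fst ` set as \<subseteq> symbols N \<and> length as = K \<and> fst b \<in> symbols N"
proof -
  have keeps: "fst ` set (map keep rs') \<subseteq> symbols N" if "set rs' \<subseteq> symbols N" for rs' :: "outer_symbol list"
    using that by (auto simp: image_image)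
  obtain r rs' where rs: "rs = r # rs'" using assms(5) K_pos by (cases rs) auto
  have Blank: "Blank \<in> symbols N" by (simp add: symbols_N)
  show ?thesis
  proof (cases q)
    case Fetch
    then show ?thesis using assms by (auto simp: states_N split: symbol.splits)
  next
    case (Copy c)
    have st: "Sim c (start (M c)) \<in> states N"
      using well_formedD(4)[OF well_formed_M] by (auto simp: states_N)
    have "Aux (Input (strip x)) \<in> symbols N" if "Input x \<in> symbols N" "fac x = c" for x
    proof -
      have "x \<in> L" using that(1) by (auto simp: symbols_N)
      then have "Input (strip x) \<in> symbols (M c)"
        using strip_letters that(2) well_formedD(6)[OF well_formed_M, of c] by blast
      then show ?thesis by (auto simp: symbols_N)
    qed
    moreover have "Copy c \<in> states N" by (simp add: states_N)
    ultimately show ?thesis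
      using assms st rs Copy by (auto simp: Let_def split: symbol.splits if_splits)
  next
    case (Sim c p)
    then have p: "p \<in> states (M c)" using assms(1) by (auto simp: states_N)
    consider (halt) "p = accept (M c) \<or> p = reject (M c)"
      | (go) "\<not> (p = accept (M c) \<or> p = reject (M c))" "set (map dec rs) \<subseteq> symbols (M c)"
      | (junk) "\<not> (p = accept (M c) \<or> p = reject (M c))" "\<not> set (map dec rs) \<subseteq> symbols (M c)"
      by blast
    then show ?thesis
    proof cases
      case halt
      have "Ret c (p = accept (M c)) \<in> states N" by (simp add: states_N)
      moreover have "fst ` set (map (\<lambda>r. (Aux (dec r), Stay)) rs) \<subseteq> symbols N"
        using assms(3) dec_symbols by (auto simp: image_image)
      moreover have "(q', a, as, b) = (Ret c (p = accept (M c)), keep i, map (\<lambda>r. (Aux (dec r), Stay)) rs, keep t)"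
        using assms(6) halt unfolding Sim outer_trans.simps if_P[OF halt] by simp
      ultimately show ?thesis using assms(2,4,5) by simp
    next
      case go
      have "p \<in> states (M c) - {accept (M c), reject (M c)}" using p go(1) by blast
      note d = well_formed_delta[OF well_formed_M this _ go(2)]
      have "(q', a, as, b) = (Sim c (fst (delta (M c) p (map dec rs))), keep i,
          map (apfst Aux) (snd (delta (M c) p (map dec rs))), keep t)"
        using assms(6) unfolding Sim outer_trans.simps if_not_P[OF go(1)] if_P[OF go(2)] by (simp add: split_def)
      moreover have "fst ` set (map (apfst Aux) (snd (delta (M c) p (map dec rs)))) \<subseteq> symbols N"
        using d(3) unfolding length_map assms(5) tapes by (fastforce simp: symbols_N)
      moreover have "Sim c (fst (delta (M c) p (map dec rs))) \<in> states N"
        using d(1) assms(5) tapes[of c] by (simp add: states_N)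
      ultimately show ?thesis using assms(2,4,5) d(2) tapes[of c] by simp
    next
      case junk
      have "(q', a, as, b) = (Rej, keep i, map keep rs, keep t)"
        using assms(6) unfolding Sim outer_trans.simps if_not_P[OF junk(1)] if_not_P[OF junk(2)] by simp
      then show ?thesis using assms keeps by (simp add: states_N)
    qed
  next
    case (Ret c b')
    moreover have "Ret c b' \<in> states N" "Erase c \<in> states N" "Clean_Right \<in> states N"
      by (simp_all add: states_N)
    ultimately show ?thesis using assms keeps[OF assms(3)] by (auto split: if_splits)
  next
    case (Erase c)
    moreover have "Erase c \<in> states N" "Clean_Right \<in> states N"
      by (simp_all add: states_N)
    ultimately show ?thesis using assms keeps[OF assms(3)] Blank by (auto split: if_splits)
  next
    case Clean_Right
    moreover have "Clean_Left \<in> states N" "Clean_Right \<in> states N" by (auto simp: states_N)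
    ultimately show ?thesis using assms by (auto split: if_splits)
  next
    case Clean_Left
    moreover have "Clean_Left \<in> states N" "Fetch \<in> states N" by (auto simp: states_N)
    ultimately show ?thesis using assms Blank by (auto split: if_splits)
  qed (use assms keeps[OF assms(3)] in \<open>auto simp: states_N split: if_splits\<close>)
qed

lemma well_formed_N: "well_formed N L"
proof (rule well_formedI)
  have "finite (letters (X c))" for c
    using finite_X by (simp add: letters_def)
  moreover have "finite L"
    using finite_X by (simp add: L_def letters_def)
  moreover have "states N \<subseteq> {Fetch, Clean_Right, Clean_Left, Fin, Acc, Rej} \<union> range Copy \<union> range Erase
      \<union> range (case_prod Ret) \<union> (\<Union>c. Sim c ` states (M c))"
  proof
    fix q assume "q \<in> states N"
    then show "q \<in> {Fetch, Clean_Right, Clean_Left, Fin, Acc, Rej} \<union> range Copy \<union> range Erase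
      \<union> range (case_prod Ret) \<union> (\<Union>c. Sim c ` states (M c))"
      unfolding states_N by (cases q) (simp_all add: image_iff; blast)+
  qed
  moreover have "symbols N \<subseteq> insert Blank (Input ` L) \<union> (\<Union>c. Aux ` symbols (M c))"
  proof
    fix r assume "r \<in> symbols N"
    then show "r \<in> insert Blank (Input ` L) \<union> (\<Union>c. Aux ` symbols (M c))"
      unfolding symbols_N by (cases r) auto
  qed
  ultimately show "finite (states N)" "finite (symbols N)"
    using well_formedD(2,3)[OF well_formed_M]
    by (auto elim!: finite_subset intro!: finite_imageI)
next
  fix q rs
  assume q: "q \<in> states N - {accept N, reject N}" and len: "length rs = num_tapes N"
    and sym: "set rs \<subseteq> symbols N"
  obtain i rs' where rs: "rs = i # rs'" "length rs' = K + 1"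
    using len by (cases rs) auto
  then obtain rs'' t where rs': "rs' = rs'' @ [t]" "length rs'' = K"
    by (cases rs' rule: rev_cases) auto
  obtain q' a as b where tr: "outer_trans M q i rs'' t = (q', a, as, b)"
    by (cases "outer_trans M q i rs'' t") auto
  have "delta N q rs = (q', a # as @ [b])"
    using rs rs' tr by simp
  then show "fst (delta N q rs) \<in> states N \<and> length (snd (delta N q rs)) = num_tapes N \<and>
      fst ` set (snd (delta N q rs)) \<subseteq> symbols N"
    using outer_trans_valid[OF _ _ _ _ rs'(2) tr] q sym rs rs' by simp
qed (auto simp: states_N symbols_N)

end

section \<open>Tape operations\<close>

lemma act_tape_move: "act_tape tp (read_tape tp, d) = (fst tp, snd tp + offset d)"
  by (simp add: act_tape_def read_tape_def)

lemma act_tape_keep [simp]: "act_tape tp (keep (read_tape tp)) = tp"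
  by (simp add: act_tape_move)

lemma map2_act_tape: "map2 act_tape ts (map f (map read_tape ts)) = map (\<lambda>tp. act_tape tp (f (read_tape tp))) ts"
  by (induction ts) simp_all

lemma map2_act_tape_keep [simp]: "map2 act_tape ts (map keep (map read_tape ts)) = ts"
  unfolding map2_act_tape by simp

lemma word_on_tape_int [simp]:
  "word_on_tape u (int n) = (if n < length u then Input (u ! n) else Blank)"
  by (simp add: word_on_tape_def)

lemma word_on_tape_append:
  "(word_on_tape u)(int (length u) := Input x) = word_on_tape (u @ [x])"
  by (auto simp: word_on_tape_def fun_eq_iff nth_append nat_eq_iff)

lemma word_on_tape_erase:
  "(word_on_tape (u @ [x]))(int (length u) := Blank) = word_on_tape u"
  by (auto simp: word_on_tape_def fun_eq_iff nth_append)

lemma word_on_tape_pred: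
  "word_on_tape (r @ u) (int (length r) - 1) = (if r = [] then Blank else Input (last r))"
  by (cases r rule: rev_cases) (simp_all add: word_on_tape_def nth_append)

definition visited :: "nat \<Rightarrow> outer_tape \<Rightarrow> bool" where
  "visited m tp \<longleftrightarrow> (\<exists>lo hi. {i. fst tp i \<noteq> Blank} = {lo..<hi} \<and> lo - 1 \<le> snd tp \<and> snd tp \<le> hi \<and>
     lo \<le> hi \<and> hi - lo \<le> int m)"

definition sim_tape :: "nat \<Rightarrow> (nat, nat letter) tape \<Rightarrow> outer_tape \<Rightarrow> bool" where
  "sim_tape m tp tp' \<longleftrightarrow> (\<exists>k. snd tp' = snd tp + k \<and> (\<forall>i. dec (fst tp' (i + k)) = fst tp i)) \<and> visited m tp'"

lemma dec_simps [simp]: "dec (Aux s) = s" "dec Blank = Blank" "dec (Input x) = Blank"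
  by (simp_all add: dec_def)

lemma sim_tape_read: "sim_tape m tp tp' \<Longrightarrow> dec (read_tape tp') = read_tape tp"
  by (auto simp: sim_tape_def read_tape_def)

lemma visited_write:
  assumes "visited m tp"
  shows "\<exists>lo hi. {i. fst (act_tape tp (Aux s, d)) i \<noteq> Blank} = {lo..<hi} \<and>
    lo \<le> snd tp \<and> snd tp < hi \<and> hi - lo \<le> int (Suc m)"
proof -
  obtain lo hi where *: "{i. fst tp i \<noteq> Blank} = {lo..<hi}" "lo - 1 \<le> snd tp" "snd tp \<le> hi"
    "lo \<le> hi" "hi - lo \<le> int m"
    using assms unfolding visited_def by blast
  have "{i. fst (act_tape tp (Aux s, d)) i \<noteq> Blank} = insert (snd tp) {i. fst tp i \<noteq> Blank}"
    by (rule Set.set_eqI) (simp add: act_tape_def)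
  also have "\<dots> = {min lo (snd tp)..<max hi (snd tp + 1)}"
    unfolding *(1) using *(2-4) by (intro Set.set_eqI) (simp, arith)
  finally show ?thesis
    using *(2-5) by (intro exI[of _ "min lo (snd tp)"] exI[of _ "max hi (snd tp + 1)"] conjI)
      (assumption | linarith)+
qed

lemma offset_bounds: "- 1 \<le> offset d" "offset d \<le> 1"
  by (cases d; simp)+

lemma visited_act:
  assumes "visited m tp"
  shows "visited (Suc m) (act_tape tp (Aux s, d))"
proof -
  obtain lo hi where *: "{i. fst (act_tape tp (Aux s, d)) i \<noteq> Blank} = {lo..<hi}"
    "lo \<le> snd tp" "snd tp < hi" "hi - lo \<le> int (Suc m)"
    using visited_write[OF assms] by blast
  have "snd (act_tape tp (Aux s, d)) = snd tp + offset d" by (simp add: act_tape_def)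
  then show ?thesis
    unfolding visited_def using * offset_bounds[of d]
    by (intro exI[of _ lo] exI[of _ hi] conjI) linarith+
qed

lemma sim_tape_act:
  assumes "sim_tape m tp tp'"
  shows "sim_tape (Suc m) (act_tape tp (s, d)) (act_tape tp' (Aux s, d))"
proof -
  obtain k where k: "snd tp' = snd tp + k" "\<And>i. dec (fst tp' (i + k)) = fst tp i"
    using assms by (auto simp: sim_tape_def)
  have "\<forall>i. dec (fst (act_tape tp' (Aux s, d)) (i + k)) = fst (act_tape tp (s, d)) i"
    using k by (auto simp: act_tape_def)
  then show ?thesis
    using k(1) visited_act[of m tp' s d] assms by (auto simp: sim_tape_def act_tape_def)
qed

definition shifted_word :: "nat word \<Rightarrow> int \<Rightarrow> int \<Rightarrow> outer_symbol" where
  "shifted_word y k i = (if 0 \<le> i - k \<and> i - k < int (length y) then Aux (Input (y ! nat (i - k))) else Blank)"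

lemma shifted_word_Nil: "shifted_word [] k = (\<lambda>_. Blank)"
  by (auto simp: shifted_word_def)

lemma shifted_word_Cons:
  "(shifted_word y k)(k - 1 := Aux (Input x)) = shifted_word (x # y) (k - 1)"
proof
  fix i
  have "nat (i - (k - 1)) = Suc (nat (i - k))" if "i \<ge> k" using that by simp
  then show "((shifted_word y k)(k - 1 := Aux (Input x))) i = shifted_word (x # y) (k - 1) i"
    by (auto simp: shifted_word_def)
qed

lemma sim_tape_shifted_word: "sim_tape (length y) (word_on_tape y, 0) (shifted_word y k, k)"
proof -
  have "{i. shifted_word y k i \<noteq> Blank} = {k..<k + int (length y)}"
    by (auto simp: shifted_word_def)
  then have "visited (length y) (shifted_word y k, k)"
    unfolding visited_def by (intro exI[of _ k] exI[of _ "k + int (length y)"]) simp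
  then show ?thesis
    by (auto simp: sim_tape_def shifted_word_def word_on_tape_def)
qed

definition blank_tape :: "('c, 'l) tape \<Rightarrow> bool" where
  "blank_tape tp \<longleftrightarrow> fst tp = (\<lambda>_. Blank)"

lemma sim_tape_blank:
  assumes "blank_tape tp"
  shows "sim_tape m (word_on_tape [], 0) tp"
proof -
  have "visited m tp"
    using assms unfolding visited_def blank_tape_def
    by (intro exI[of _ "snd tp"] exI[of _ "snd tp"]) simp
  then show ?thesis
    using assms by (auto simp: sim_tape_def blank_tape_def word_on_tape_def)
qed

definition marked :: "nat \<Rightarrow> outer_tape \<Rightarrow> bool" where
  "marked m tp \<longleftrightarrow>
     (\<exists>lo hi. {i. fst tp i \<noteq> Blank} = {lo..<hi} \<and> lo \<le> snd tp \<and> snd tp < hi \<and> hi - lo \<le> int m)"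

lemma marked_write: "visited m tp \<Longrightarrow> marked (Suc m) (act_tape tp (Aux s, Stay))"
  using visited_write[of m tp s Stay] by (simp add: marked_def act_tape_def)

definition seek_right :: "outer_tape \<Rightarrow> outer_tape" where
  "seek_right tp = act_tape tp (if read_tape tp = Blank then keep (read_tape tp) else (read_tape tp, Move_Right))"

definition erase_left :: "outer_tape \<Rightarrow> outer_tape" where
  "erase_left tp = act_tape tp (if read_tape tp = Blank then keep (read_tape tp) else (Blank, Move_Left))"

lemma seek_right_fixed: "read_tape tp = Blank \<Longrightarrow> seek_right tp = tp"
  by (simp add: seek_right_def act_tape_def read_tape_def fun_upd_idem)

lemma erase_left_fixed: "read_tape tp = Blank \<Longrightarrow> erase_left tp = tp"
  by (simp add: erase_left_def act_tape_def read_tape_def fun_upd_idem)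

lemma seek_right_funpow:
  assumes "{i. g i \<noteq> Blank} = {lo..<hi}" "lo \<le> h" "h \<le> hi" "hi - h \<le> int m"
  shows "(seek_right ^^ m) (g, h) = (g, hi)"
  using assms(2-4)
proof (induction m arbitrary: h)
  case (Suc m)
  have b: "g i = Blank \<longleftrightarrow> i \<notin> {lo..<hi}" for i using assms(1) by blast
  show ?case
  proof (cases "h = hi")
    case True
    then have "seek_right (g, h) = (g, h)"
      using b by (intro seek_right_fixed) (simp add: read_tape_def)
    then show ?thesis using Suc True by (simp add: funpow_Suc_right del: funpow.simps)
  next
    case False
    then have "seek_right (g, h) = (g, h + 1)"
      using b Suc.prems by (simp add: seek_right_def read_tape_def act_tape_def)
    then show ?thesis using Suc.IH[of "h + 1"] Suc.prems False
      by (simp add: funpow_Suc_right del: funpow.simps)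
  qed
qed simp

lemma erase_left_funpow:
  assumes "{i. g i \<noteq> Blank} = {lo..h}" "h - lo < int m" "lo \<le> h + 1"
  shows "(erase_left ^^ m) (g, h) = ((\<lambda>_. Blank), lo - 1)"
  using assms
proof (induction m arbitrary: g h)
  case 0
  then have h: "h = lo - 1" by simp
  then have "{i. g i \<noteq> Blank} = {}" using 0 by simp
  then have "g = (\<lambda>_. Blank)" by (intro ext) blast
  then show ?case using h by simp
next
  case (Suc m)
  have b: "g i = Blank \<longleftrightarrow> i \<notin> {lo..h}" for i using Suc.prems(1) by blast
  show ?case
  proof (cases "h = lo - 1")
    case True
    have h: "g h = Blank" using b[of h] True by simp
    have g: "g = (\<lambda>_. Blank)" using b True by (intro ext) simp
    have e: "erase_left (g, h) = (g, h)"
      by (rule erase_left_fixed) (simp add: read_tape_def h)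
    have "(erase_left ^^ k) (g, h) = (g, h)" for k
      by (induction k) (simp_all only: e funpow.simps id_apply comp_apply)
    then show ?thesis using True g by (simp only:)
  next
    case False
    then have "g h \<noteq> Blank" using b[of h] Suc.prems(3) by simp
    then have e: "erase_left (g, h) = (g(h := Blank), h - 1)"
      by (simp add: erase_left_def read_tape_def act_tape_def)
    have "{i. (g(h := Blank)) i \<noteq> Blank} = {lo..h - 1}"
    proof (rule Set.set_eqI)
      fix i
      show "i \<in> {i. (g(h := Blank)) i \<noteq> Blank} \<longleftrightarrow> i \<in> {lo..h - 1}"
        using b[of i] by (cases "i = h") auto
    qed
    then have "(erase_left ^^ m) (g(h := Blank), h - 1) = ((\<lambda>_. Blank), lo - 1)"
      by (rule Suc.IH) (use Suc.prems(2,3) False in simp_all)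
    then show ?thesis
      by (simp only: funpow_Suc_right comp_apply e)
  qed
qed

lemma erase_marked:
  assumes "marked m tp"
  shows "read_tape ((seek_right ^^ m) tp) = Blank"
    "blank_tape ((erase_left ^^ m) (act_tape ((seek_right ^^ m) tp) (Blank, Move_Left)))"
proof -
  obtain lo hi where *: "{i. fst tp i \<noteq> Blank} = {lo..<hi}" "lo \<le> snd tp" "snd tp < hi" "hi - lo \<le> int m"
    using assms unfolding marked_def by blast
  have s: "(seek_right ^^ m) tp = (fst tp, hi)"
    using seek_right_funpow[OF *(1), of "snd tp" m] *(2-4) by simp
  have "hi \<notin> {i. fst tp i \<noteq> Blank}" unfolding *(1) by simp
  then have hi: "fst tp hi = Blank" by simp
  then show "read_tape ((seek_right ^^ m) tp) = Blank" by (simp add: s read_tape_def)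
  have "act_tape (fst tp, hi) (Blank, Move_Left) = (fst tp, hi - 1)"
    using hi by (simp add: act_tape_def fun_upd_idem)
  moreover have "{i. fst tp i \<noteq> Blank} = {lo..hi - 1}" unfolding *(1) by auto
  then have "(erase_left ^^ m) (fst tp, hi - 1) = ((\<lambda>_. Blank), lo - 1)"
    by (rule erase_left_funpow) (use *(2-4) in simp_all)
  ultimately show "blank_tape ((erase_left ^^ m) (act_tape ((seek_right ^^ m) tp) (Blank, Move_Left)))"
    by (simp only: s blank_tape_def fst_conv)
qed

lemma read_blank_tape: "blank_tape tp \<Longrightarrow> read_tape tp = Blank"
  by (simp add: blank_tape_def read_tape_def)

section \<open>Running the machine\<close>

lemma map2_act_tape_keep_comp [simp]: "map2 act_tape ts (map (keep \<circ> read_tape) ts) = ts"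
  using map2_act_tape_keep[of ts] by simp

lemma word_on_tape_int_add [simp]:
  "word_on_tape u (int m + int n) = (if m + n < length u then Input (u ! (m + n)) else Blank)"
  using word_on_tape_int[of u "m + n"] by simp

context inner_machines
begin

lemma step_N:
  assumes "q \<noteq> Acc" "q \<noteq> Rej" "length as = length ts"
    and "outer_trans M q (read_tape i) (map read_tape ts) (read_tape t) = (q', a, as, b)"
  shows "step N (q, i # ts @ [t]) = (q', act_tape i a # map2 act_tape ts as @ [act_tape t b])"
  using assms by (simp add: step_def halting_def)

lemma step_N_map:
  assumes "q \<noteq> Acc" "q \<noteq> Rej"
    and "outer_trans M q (read_tape i) (map read_tape ts) (read_tape t) = (q', a, map f (map read_tape ts), b)"
  shows "step N (q, i # ts @ [t]) =
    (q', act_tape i a # map (\<lambda>tp. act_tape tp (f (read_tape tp))) ts @ [act_tape t b])"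
  using step_N[OF assms(1,2) _ assms(3)] by (simp only: map2_act_tape length_map)

lemma step_N_keep:
  assumes "q \<noteq> Acc" "q \<noteq> Rej"
    and "outer_trans M q (read_tape i) (map read_tape ts) (read_tape t) = (q', a, map keep (map read_tape ts), b)"
  shows "step N (q, i # ts @ [t]) = (q', act_tape i a # ts @ [act_tape t b])"
  using step_N_map[OF assms] by simp

lemma reach_copy:
  assumes "\<forall>x\<in>set v. fac x = c" "r = [] \<or> fac (last r) \<noteq> c"
  shows "reach N (length v + 1)
    (Copy c, i # ((shifted_word y k, k - 1) # ts) @ [(word_on_tape (r @ v @ z), int (length (r @ v)) - 1)])
    (Sim c (start (M c)), i # ((shifted_word (map strip v @ y) (k - int (length v)), k - int (length v)) # ts)
       @ [(word_on_tape (r @ v @ z), int (length r))])"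
  using assms(1)
proof (induction v arbitrary: y k z rule: rev_induct)
  case Nil
  have t: "read_tape (word_on_tape (r @ z), int (length r) - 1) = (if r = [] then Blank else Input (last r))"
    by (simp add: read_tape_def word_on_tape_pred)
  have "step N (Copy c, i # ((shifted_word y k, k - 1) # ts) @ [(word_on_tape (r @ z), int (length r) - 1)])
    = (Sim c (start (M c)), act_tape i (keep (read_tape i)) #
        map2 act_tape ((shifted_word y k, k - 1) # ts)
          ((read_tape (shifted_word y k, k - 1), Move_Right) # map keep (map read_tape ts)) @
        [act_tape (word_on_tape (r @ z), int (length r) - 1)
          (read_tape (word_on_tape (r @ z), int (length r) - 1), Move_Right)])"
    using assms(2) by (intro step_N) (auto simp: t)
  then have "step N (Copy c, i # ((shifted_word y k, k - 1) # ts) @ [(word_on_tape (r @ z), int (length r) - 1)])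
    = (Sim c (start (M c)), i # ((shifted_word y k, k) # ts) @ [(word_on_tape (r @ z), int (length r))])"
    by (simp add: act_tape_move)
  then have "reach N (Suc 0)
     (Copy c, i # ((shifted_word y k, k - 1) # ts) @ [(word_on_tape (r @ z), int (length r) - 1)])
     (Sim c (start (M c)), i # ((shifted_word y k, k) # ts) @ [(word_on_tape (r @ z), int (length r))])"
    by (intro reach_step) simp
  then show ?case by simp
next
  case (snoc x v)
  let ?u = "r @ v @ x # z"
  have t: "read_tape (word_on_tape ?u, int (length (r @ v))) = Input x"
    by (simp add: read_tape_def nth_append)
  have x: "fac x = c" using snoc.prems by simp
  have "step N (Copy c, i # ((shifted_word y k, k - 1) # ts) @ [(word_on_tape ?u, int (length (r @ v)))])
    = (Copy c, act_tape i (keep (read_tape i)) #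
        map2 act_tape ((shifted_word y k, k - 1) # ts)
          ((Aux (Input (strip x)), Move_Left) # map keep (map read_tape ts)) @
        [act_tape (word_on_tape ?u, int (length (r @ v)))
          (read_tape (word_on_tape ?u, int (length (r @ v))), Move_Left)])"
    by (intro step_N) (simp_all add: t[simplified] x Let_def)
  moreover have "act_tape (shifted_word y k, k - 1) (Aux (Input (strip x)), Move_Left)
      = (shifted_word (strip x # y) (k - 1), (k - 1) - 1)"
    by (simp add: act_tape_def shifted_word_Cons)
  ultimately have "step N (Copy c, i # ((shifted_word y k, k - 1) # ts) @ [(word_on_tape ?u, int (length (r @ v)))])
    = (Copy c, i # ((shifted_word (strip x # y) (k - 1), (k - 1) - 1) # ts) @
        [(word_on_tape (r @ v @ (x # z)), int (length (r @ v)) - 1)])"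
    by (simp add: act_tape_move)
  moreover have "reach N (length v + 1)
    (Copy c, i # ((shifted_word (strip x # y) (k - 1), (k - 1) - 1) # ts) @
        [(word_on_tape (r @ v @ (x # z)), int (length (r @ v)) - 1)])
    (Sim c (start (M c)), i # ((shifted_word (map strip v @ strip x # y) (k - 1 - int (length v)), k - 1 - int (length v)) # ts)
       @ [(word_on_tape (r @ v @ (x # z)), int (length r))])"
    by (rule snoc.IH) (use snoc.prems in simp)
  ultimately have "reach N (Suc (length v + 1))
    (Copy c, i # ((shifted_word y k, k - 1) # ts) @ [(word_on_tape ?u, int (length (r @ v)))])
    (Sim c (start (M c)), i # ((shifted_word (map strip v @ strip x # y) (k - 1 - int (length v)), k - 1 - int (length v)) # ts)
       @ [(word_on_tape (r @ v @ (x # z)), int (length r))])"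
    by (intro reach_step) simp
  moreover have "k - 1 - int (length v) = k - int (length (v @ [x]))" by simp
  ultimately show ?case by simp
qed

lemma reach_ret:
  "reach N (length v) (Ret c b, i # ts @ [(word_on_tape (r @ v), int (length r))])
     (Ret c b, i # ts @ [(word_on_tape (r @ v), int (length (r @ v)))])"
proof (induction v arbitrary: r)
  case (Cons x v)
  have t: "read_tape (word_on_tape (r @ x # v), int (length r)) = Input x"
    by (simp add: read_tape_def)
  have "step N (Ret c b, i # ts @ [(word_on_tape (r @ x # v), int (length r))])
    = (Ret c b, act_tape i (keep (read_tape i)) # ts @
        [act_tape (word_on_tape (r @ x # v), int (length r))
          (read_tape (word_on_tape (r @ x # v), int (length r)), Move_Right)])"
    by (intro step_N_keep) (simp_all add: t)
  then have "step N (Ret c b, i # ts @ [(word_on_tape (r @ x # v), int (length r))])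
    = (Ret c b, i # ts @ [(word_on_tape ((r @ [x]) @ v), int (length (r @ [x])))])"
    by (simp add: act_tape_move add.commute)
  then show ?case
    using Cons.IH[of "r @ [x]"] by (simp add: reach_step)
qed simp

lemma reach_erase:
  assumes "\<forall>x\<in>set v. fac x = c" "r = [] \<or> fac (last r) \<noteq> c"
  shows "reach N (length v + 1)
    (Erase c, i # ts @ [(word_on_tape (r @ v), int (length (r @ v)) - 1)])
    (Clean_Right, i # ts @ [(word_on_tape r, int (length r))])"
  using assms(1)
proof (induction v rule: rev_induct)
  case Nil
  have t: "read_tape (word_on_tape r, int (length r) - 1) = (if r = [] then Blank else Input (last r))"
    using word_on_tape_pred[of r "[]"] by (simp add: read_tape_def)
  have "step N (Erase c, i # ts @ [(word_on_tape r, int (length r) - 1)])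
    = (Clean_Right, act_tape i (keep (read_tape i)) # ts @
        [act_tape (word_on_tape r, int (length r) - 1) (read_tape (word_on_tape r, int (length r) - 1), Move_Right)])"
    using assms(2) by (intro step_N_keep) (auto simp: t)
  then have "step N (Erase c, i # ts @ [(word_on_tape r, int (length r) - 1)])
    = (Clean_Right, i # ts @ [(word_on_tape r, int (length r))])"
    by (simp add: act_tape_move)
  then have "reach N (Suc 0) (Erase c, i # ts @ [(word_on_tape r, int (length r) - 1)])
      (Clean_Right, i # ts @ [(word_on_tape r, int (length r))])"
    by (intro reach_step) simp
  then show ?case by simp
next
  case (snoc x v)
  let ?t = "(word_on_tape ((r @ v) @ [x]), int (length (r @ v))) :: outer_tape"
  have t: "read_tape ?t = Input x"
    by (simp add: read_tape_def)
  have x: "fac x = c" using snoc.prems by simp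
  have "step N (Erase c, i # ts @ [?t])
    = (Erase c, act_tape i (keep (read_tape i)) # ts @ [act_tape ?t (Blank, Move_Left)])"
    by (intro step_N_keep) (simp_all add: t[simplified] x)
  moreover have "act_tape ?t (Blank, Move_Left) = (word_on_tape (r @ v), int (length (r @ v)) - 1)"
    by (simp only: act_tape_def fst_conv snd_conv word_on_tape_erase offset.simps) simp
  moreover have "reach N (length v + 1)
    (Erase c, i # ts @ [(word_on_tape (r @ v), int (length (r @ v)) - 1)])
    (Clean_Right, i # ts @ [(word_on_tape r, int (length r))])"
    by (rule snoc.IH) (use snoc.prems in simp)
  ultimately have "reach N (Suc (length v + 1)) (Erase c, i # ts @ [?t])
      (Clean_Right, i # ts @ [(word_on_tape r, int (length r))])"
    by (intro reach_step) (simp only: act_tape_keep)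
  then show ?case by simp
qed

lemma reach_loop:
  assumes "\<And>ts. \<lbrakk>length ts = K; \<not> (\<forall>tp\<in>set ts. read_tape tp = Blank)\<rbrakk> \<Longrightarrow>
      step N (q, i # ts @ [t]) = (q, i # map f ts @ [t])"
    and "\<And>tp. read_tape tp = Blank \<Longrightarrow> f tp = tp"
    and "length ts = K" "\<forall>tp\<in>set ts. read_tape ((f ^^ m) tp) = Blank"
  shows "reach N m (q, i # ts @ [t]) (q, i # map (f ^^ m) ts @ [t])"
  using assms(3,4)
proof (induction m arbitrary: ts)
  case (Suc m)
  show ?case
  proof (cases "\<forall>tp\<in>set ts. read_tape tp = Blank")
    case True
    have "(f ^^ n) tp = tp" if "tp \<in> set ts" for n tp
      by (induction n) (use that True assms(2) in simp_all)
    then have "map (f ^^ Suc m) ts = ts" by (intro map_idI) blast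
    then show ?thesis by (simp only: reach_refl)
  next
    case False
    have "reach N m (q, i # map f ts @ [t]) (q, i # map (f ^^ m) (map f ts) @ [t])"
      by (rule Suc.IH) (use Suc.prems in \<open>simp_all add: funpow_Suc_right del: funpow.simps\<close>)
    then have "reach N m (step N (q, i # ts @ [t])) (q, i # map (f ^^ Suc m) ts @ [t])"
      unfolding assms(1)[OF Suc.prems(1) False] by (simp add: funpow_Suc_right del: funpow.simps)
    then show ?thesis by (rule reach_step)
  qed
qed simp

lemma reads_blank: "set (map read_tape ts) \<subseteq> {Blank} \<longleftrightarrow> (\<forall>tp\<in>set ts. read_tape tp = Blank)"
  by auto

lemma reach_clean:
  assumes "length ts = K" "\<forall>tp\<in>set ts. marked m tp"
  shows "\<exists>ts'. length ts' = K \<and> (\<forall>tp\<in>set ts'. blank_tape tp) \<and>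
    reach N (m + (1 + (m + 1))) (Clean_Right, i # ts @ [t]) (Fetch, i # ts' @ [t])"
proof -
  let ?left = "\<lambda>tp :: outer_tape. act_tape tp (read_tape tp, Move_Left)"
  define rs where "rs = map (seek_right ^^ m) ts"
  define ls where "ls = map ?left rs"
  define es where "es = map (erase_left ^^ m) ls"
  have len: "length rs = K" "length ls = K" "length es = K"
    using assms(1) by (simp_all add: rs_def ls_def es_def)
  have rs: "\<forall>tp\<in>set rs. read_tape tp = Blank"
    using assms(2) erase_marked(1) by (auto simp: rs_def)
  have es: "\<forall>tp\<in>set es. blank_tape tp"
  proof
    fix tp assume "tp \<in> set es"
    then obtain tp' where tp': "tp' \<in> set ts" "tp = (erase_left ^^ m) (?left ((seek_right ^^ m) tp'))"
      by (auto simp: es_def ls_def rs_def)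
    then show "blank_tape tp"
      using erase_marked[of m tp'] assms(2) by simp
  qed
  have "reach N m (Clean_Right, i # ts @ [t]) (Clean_Right, i # rs @ [t])"
    unfolding rs_def
  proof (rule reach_loop)
    fix us :: "outer_tape list"
    assume b: "\<not> (\<forall>tp\<in>set us. read_tape tp = Blank)"
    show "step N (Clean_Right, i # us @ [t]) = (Clean_Right, i # map seek_right us @ [t])"
      using step_N_map[of Clean_Right i us t Clean_Right "keep (read_tape i)"
          "\<lambda>r. if r = Blank then keep r else (r, Move_Right)" "keep (read_tape t)"] b
      by (simp add: reads_blank[simplified] seek_right_def[abs_def])
  next
    show "\<forall>tp\<in>set ts. read_tape ((seek_right ^^ m) tp) = Blank"
      using rs by (simp add: rs_def)
  qed (use assms(1) seek_right_fixed in auto)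
  moreover have "reach N 1 (Clean_Right, i # rs @ [t]) (Clean_Left, i # ls @ [t])"
  proof -
    have "set (map read_tape rs) \<subseteq> {Blank}" using rs by auto
    then have "outer_trans M Clean_Right (read_tape i) (map read_tape rs) (read_tape t) =
        (Clean_Left, keep (read_tape i), map (\<lambda>r. (r, Move_Left)) (map read_tape rs), keep (read_tape t))"
      by (simp only: outer_trans.simps if_P)
    from step_N_map[OF _ _ this] have "step N (Clean_Right, i # rs @ [t]) = (Clean_Left, i # ls @ [t])"
      by (simp add: ls_def)
    then show ?thesis using reach_step[of N 0] by simp
  qed
  moreover have "reach N m (Clean_Left, i # ls @ [t]) (Clean_Left, i # es @ [t])"
    unfolding es_def
  proof (rule reach_loop)
    fix us :: "outer_tape list"
    assume b: "\<not> (\<forall>tp\<in>set us. read_tape tp = Blank)"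
    show "step N (Clean_Left, i # us @ [t]) = (Clean_Left, i # map erase_left us @ [t])"
      using step_N_map[of Clean_Left i us t Clean_Left "keep (read_tape i)"
          "\<lambda>r. if r = Blank then keep r else (Blank, Move_Left)" "keep (read_tape t)"] b
      by (simp add: reads_blank[simplified] erase_left_def[abs_def])
  next
    show "\<forall>tp\<in>set ls. read_tape ((erase_left ^^ m) tp) = Blank"
    proof
      fix tp assume "tp \<in> set ls"
      then show "read_tape ((erase_left ^^ m) tp) = Blank"
        using es by (intro read_blank_tape) (simp add: es_def)
    qed
  qed (use len erase_left_fixed in auto)
  moreover have "reach N 1 (Clean_Left, i # es @ [t]) (Fetch, i # es @ [t])"
  proof -
    have "step N (Clean_Left, i # es @ [t]) = (Fetch, i # es @ [t])"
    proof -
      have "set (map read_tape es) \<subseteq> {Blank}" using es read_blank_tape by auto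
      then have "outer_trans M Clean_Left (read_tape i) (map read_tape es) (read_tape t) =
          (Fetch, keep (read_tape i), map keep (map read_tape es), keep (read_tape t))"
        by (simp only: outer_trans.simps if_P)
      from step_N_keep[OF _ _ this] show ?thesis by simp
    qed
    then show ?thesis using reach_step[of N 0] by simp
  qed
  ultimately have "reach N (m + (1 + (m + 1))) (Clean_Right, i # ts @ [t]) (Fetch, i # es @ [t])"
    by (intro reach_trans)
  then show ?thesis using es len by blast
qed

end

context inner_machines
begin

lemma halts_M: "v \<in> lists (letters (X c)) \<Longrightarrow> halts_on (M c) v"
  using decides by (simp add: decides_def del: in_lists_conv_set)

lemma reach_sim:
  assumes "v \<in> lists (letters (X c))" "list_all2 (sim_tape m) (snd (initial (M c) v)) ts"
    and "j \<le> run_time (M c) v"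
  shows "\<exists>ts'. list_all2 (sim_tape (m + j)) (snd (config_at (M c) v j)) ts' \<and>
    reach N j (Sim c (start (M c)), i # ts @ [t]) (Sim c (fst (config_at (M c) v j)), i # ts' @ [t])"
  using assms(3)
proof (induction j)
  case 0
  then show ?case using assms(2) by (intro exI[of _ ts]) (simp add: config_at_def initial_def)
next
  case (Suc j)
  then obtain ts' where ts': "list_all2 (sim_tape (m + j)) (snd (config_at (M c) v j)) ts'"
    "reach N j (Sim c (start (M c)), i # ts @ [t]) (Sim c (fst (config_at (M c) v j)), i # ts' @ [t])"
    by auto
  let ?C = "config_at (M c) v j"
  have nh: "\<not> halting (M c) ?C" using Suc.prems by (intro run_time_least) simp
  have valid: "valid_config (M c) ?C" by (rule valid_config_at[OF well_formed_M assms(1)])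
  obtain q as where d: "delta (M c) (fst ?C) (map read_tape (snd ?C)) = (q, as)" by fastforce
  have len: "length as = length ts'"
    using valid_config_delta(2)[OF well_formed_M valid nh d] valid list_all2_lengthD[OF ts'(1)]
    by (simp add: valid_config_def)
  have step_c: "config_at (M c) v (Suc j) = (q, map2 act_tape (snd ?C) as)"
    using nh d by (simp add: config_at_def step_def)
  have "list_all2 (\<lambda>tp tp'. read_tape tp = dec (read_tape tp')) (snd ?C) ts'"
    using ts'(1) by (rule list_all2_mono) (simp add: sim_tape_read)
  then have reads: "map dec (map read_tape ts') = map read_tape (snd ?C)"
    by (induction rule: list_all2_induct) simp_all
  have tr: "outer_trans M (Sim c (fst ?C)) (read_tape i) (map read_tape ts') (read_tape t) =
      (Sim c q, keep (read_tape i), map (apfst Aux) as, keep (read_tape t))"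
  proof -
    have "\<not> (fst ?C = accept (M c) \<or> fst ?C = reject (M c))"
      using nh by (simp add: halting_def)
    moreover have "set (map dec (map read_tape ts')) \<subseteq> symbols (M c)"
      unfolding reads by (rule valid_config_reads(2)[OF valid])
    moreover have "delta (M c) (fst ?C) (map dec (map read_tape ts')) = (q, as)"
      unfolding reads by (rule d)
    ultimately show ?thesis
      by (simp only: outer_trans.simps if_False if_True prod.case)
  qed
  have "step N (Sim c (fst ?C), i # ts' @ [t]) = (Sim c q, act_tape i (keep (read_tape i)) #
      map2 act_tape ts' (map (apfst Aux) as) @ [act_tape t (keep (read_tape t))])"
    by (rule step_N[OF _ _ _ tr]) (simp_all add: len)
  then have "reach N (Suc 0) (Sim c (fst ?C), i # ts' @ [t]) (Sim c q, i #
      map2 act_tape ts' (map (apfst Aux) as) @ [t])"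
    by (intro reach_step) simp
  from reach_trans[OF ts'(2) this]
  have "reach N (Suc j) (Sim c (start (M c)), i # ts @ [t]) (Sim c q, i #
      map2 act_tape ts' (map (apfst Aux) as) @ [t])" by simp
  moreover have "list_all2 (sim_tape (m + Suc j)) (map2 act_tape (snd ?C) as) (map2 act_tape ts' (map (apfst Aux) as))"
  proof (rule list_all2_all_nthI)
    show "length (map2 act_tape (snd ?C) as) = length (map2 act_tape ts' (map (apfst Aux) as))"
      using list_all2_lengthD[OF ts'(1)] by simp
    fix n assume n: "n < length (map2 act_tape (snd ?C) as)"
    then have "sim_tape (m + j) (snd ?C ! n) (ts' ! n)"
      using list_all2_nthD[OF ts'(1)] by simp
    from sim_tape_act[OF this, of "fst (as ! n)" "snd (as ! n)"]
    show "sim_tape (m + Suc j) (map2 act_tape (snd ?C) as ! n) (map2 act_tape ts' (map (apfst Aux) as) ! n)"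
      using n list_all2_lengthD[OF ts'(1)] by (simp add: apfst_def map_prod_def split_def)
  qed
  ultimately show ?case unfolding step_c by auto
qed

definition test_cost :: "(nat + nat) word \<Rightarrow> nat" where
  "test_cost v = 9 * (length v + run_time (M (fac (hd v))) (map strip v) + 1)"

lemma reach_round:
  fixes W :: "int \<Rightarrow> outer_symbol"
  assumes ws: "stacked ws" "set (flat ws) \<subseteq> L" and x: "x \<in> L" "W p = Input x"
    and ts: "length ts = K" "\<forall>tp\<in>set ts. blank_tape tp"
  shows "\<exists>ts'. length ts' = K \<and> (\<forall>tp\<in>set ts'. blank_tape tp) \<and>
    reach N (test_cost (tested ws x))
      (Fetch, (W, p) # ts @ [(word_on_tape (flat ws), int (length (flat ws)))])
      (Fetch, (W, p + 1) # ts' @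
        [(word_on_tape (flat (push test ws x)), int (length (flat (push test ws x))))])"
proof -
  define c where "c = fac x"
  define v where "v = tested ws x"
  define r where "r = flat (below ws x)"
  define y where "y = map strip v"
  define T where "T = run_time (M c) y"
  define i where "i = (W, p + 1)"
  have rv: "r @ v = flat ws @ [x]" by (simp add: r_def v_def flat_below_tested)
  have blk: "block c v" unfolding v_def c_def by (rule block_tested[OF ws(1)])
  have v: "v \<noteq> []" "\<forall>x\<in>set v. fac x = c" using blk by (auto simp: block_def)
  have fac_v: "fac (hd v) = c" by (rule block_hd[OF blk])
  have r: "r = [] \<or> fac (last r) \<noteq> c"
    using last_flat_below[OF ws(1), of x] unfolding r_def c_def by blast
  have "set v \<subseteq> L" using set_tested[of ws x] ws(2) x(1) by (auto simp: v_def)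
  then have y: "y \<in> lists (letters (X c))"
    using v(2) strip_letters by (fastforce simp: y_def)
  obtain tp ts0 where ts0: "ts = tp # ts0" using ts(1) K_pos by (cases ts) auto
  define k where "k = snd tp + 1"
  have tp: "tp = (shifted_word [] k, k - 1)"
    using ts(2) ts0 by (simp add: k_def shifted_word_Nil blank_tape_def prod_eq_iff)
  define k' where "k' = k - int (length v)"
  let ?u = "(word_on_tape (r @ v), int (length r)) :: outer_tape"
  let ?e = "(word_on_tape (r @ v), int (length (r @ v))) :: outer_tape"

  have fetch: "reach N (Suc 0) (Fetch, (W, p) # ts @ [(word_on_tape (flat ws), int (length (flat ws)))])
      (Copy c, i # ts @ [(word_on_tape (r @ v), int (length (r @ v)) - 1)])"
  proof (rule reach_step)
    have "read_tape (W, p) = Input x" using x(2) by (simp add: read_tape_def)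
    then have "step N (Fetch, (W, p) # ts @ [(word_on_tape (flat ws), int (length (flat ws)))]) =
      (Copy c, act_tape (W, p) (read_tape (W, p), Move_Right) # ts @
        [act_tape (word_on_tape (flat ws), int (length (flat ws))) (Input x, Stay)])"
      by (intro step_N_keep) (simp_all add: c_def)
    moreover have "act_tape (word_on_tape (flat ws), int (length (flat ws))) (Input x :: outer_symbol, Stay)
      = (word_on_tape (r @ v), int (length (r @ v)) - 1)"
      unfolding rv by (simp add: act_tape_def word_on_tape_append)
    ultimately show "reach N 0 (step N (Fetch, (W, p) # ts @ [(word_on_tape (flat ws), int (length (flat ws)))]))
      (Copy c, i # ts @ [(word_on_tape (r @ v), int (length (r @ v)) - 1)])"
      by (simp add: act_tape_move i_def)
  qed

  have copy: "reach N (length v + 1)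
      (Copy c, i # ts @ [(word_on_tape (r @ v), int (length (r @ v)) - 1)])
      (Sim c (start (M c)), i # ((shifted_word y k', k') # ts0) @ [?u])"
    using reach_copy[OF v(2) r, of i "[]" k ts0 "[]"] by (simp only: ts0 tp y_def k'_def append_Nil2)

  have init: "list_all2 (sim_tape (length y)) (snd (initial (M c) y)) ((shifted_word y k', k') # ts0)"
  proof -
    have "list_all2 (sim_tape (length y)) (replicate (length ts0) (word_on_tape [], 0)) ts0"
      using ts(2) unfolding ts0
      by (auto intro!: list_all2_all_nthI sim_tape_blank)
    moreover have "num_tapes (M c) - 1 = length ts0" using tapes ts(1) ts0 by simp
    ultimately show ?thesis by (simp add: initial_def sim_tape_shifted_word)
  qed
  obtain ts1 where ts1: "list_all2 (sim_tape (length y + T)) (snd (config_at (M c) y T)) ts1"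
    and sim: "reach N T (Sim c (start (M c)), i # ((shifted_word y k', k') # ts0) @ [?u])
      (Sim c (fst (config_at (M c) y T)), i # ts1 @ [?u])"
    using reach_sim[OF y init, of T i ?u] unfolding T_def by blast
  define q where "q = fst (config_at (M c) y T)"
  have halt: "q = accept (M c) \<or> q = reject (M c)"
    using run_time_halting[OF halts_M[OF y]] by (simp add: halting_def q_def T_def)
  have acc: "q = accept (M c) \<longleftrightarrow> P c y"
    using decides[of c] y unfolding decides_def final_config_def q_def T_def by blast
  have P: "P c y \<longleftrightarrow> test v" by (simp add: block_test_def fac_v y_def)
  define ts2 where "ts2 = map (\<lambda>tp. act_tape tp (Aux (dec (read_tape tp)), Stay)) ts1"
  have ts1_len: "length ts1 = K"
    using list_all2_lengthD[OF ts1] valid_config_at[OF well_formed_M y, of T] tapes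
    by (simp add: valid_config_def)
  have ts1_visited: "\<forall>tp\<in>set ts1. visited (length y + T) tp"
    using ts1 by (fastforce simp: list_all2_conv_all_nth in_set_conv_nth sim_tape_def)
  have stop: "reach N (Suc 0) (Sim c q, i # ts1 @ [?u]) (Ret c (test v), i # ts2 @ [?u])"
  proof (rule reach_step)
    have "outer_trans M (Sim c q) (read_tape i) (map read_tape ts1) (read_tape ?u) =
        (Ret c (test v), keep (read_tape i), map (\<lambda>r. (Aux (dec r), Stay)) (map read_tape ts1), keep (read_tape ?u))"
      using halt acc P by (simp only: outer_trans.simps if_P)
    from step_N_map[OF _ _ this]
    show "reach N 0 (step N (Sim c q, i # ts1 @ [?u])) (Ret c (test v), i # ts2 @ [?u])"
      by (simp add: ts2_def)
  qed
  have ts2: "length ts2 = K" "\<forall>tp\<in>set ts2. marked (Suc (length y + T)) tp"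
    using ts1_len ts1_visited marked_write by (auto simp: ts2_def)

  let ?w = "flat (push test ws x)"
  have ret: "reach N (length v + 1 + (length v + 1)) (Ret c (test v), i # ts2 @ [?u])
     (Clean_Right, i # ts2 @ [(word_on_tape ?w, int (length ?w))])"
  proof -
    have blank: "read_tape ?e = Blank" unfolding read_tape_def fst_conv snd_conv word_on_tape_int by simp
    show ?thesis
    proof (cases "test v")
      case True
      have "step N (Ret c True, i # ts2 @ [?e]) = (Erase c, act_tape i (keep (read_tape i)) # ts2 @
          [act_tape ?e (read_tape ?e, Move_Left)])"
        by (rule step_N_keep) (simp_all only: outer_trans.simps blank if_True not_True_eq_False simp_thms if_False phase.distinct)
      also have "\<dots> = (Erase c, i # ts2 @ [(word_on_tape (r @ v), int (length (r @ v)) - 1)])"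
        by (simp only: act_tape_move act_tape_keep fst_conv snd_conv offset.simps) simp
      finally have e: "reach N 1 (Ret c True, i # ts2 @ [?e])
          (Erase c, i # ts2 @ [(word_on_tape (r @ v), int (length (r @ v)) - 1)])"
        using reach_step[of N 0] by simp
      have w: "?w = r" using True by (simp add: push_def r_def v_def)
      have "reach N (length v + 1 + (length v + 1)) (Ret c True, i # ts2 @ [?u])
          (Clean_Right, i # ts2 @ [(word_on_tape r, int (length r))])"
        by (rule reach_trans[OF reach_trans[OF reach_ret e] reach_erase[OF v(2) r]])
      then show ?thesis unfolding w using True by (simp only:)
    next
      case False
      have "step N (Ret c False, i # ts2 @ [?e]) = (Clean_Right, act_tape i (keep (read_tape i)) # ts2 @
          [act_tape ?e (keep (read_tape ?e))])"
        by (rule step_N_keep) (simp_all only: outer_trans.simps blank simp_thms if_False phase.distinct)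
      then have e: "reach N 1 (Ret c False, i # ts2 @ [?e]) (Clean_Right, i # ts2 @ [?e])"
        using reach_step[of N 0] by simp
      have w: "?w = r @ v" using False by (simp add: push_def r_def v_def)
      have "reach N (length v + 1) (Ret c False, i # ts2 @ [?u]) (Clean_Right, i # ts2 @ [?e])"
        by (rule reach_trans[OF reach_ret e])
      then have "reach N (length v + 1 + (length v + 1)) (Ret c False, i # ts2 @ [?u])
          (Clean_Right, i # ts2 @ [?e])"
        by (rule reach_mono) simp
      then show ?thesis unfolding w using False by (simp only:)
    qed
  qed

  obtain ts3 where ts3: "length ts3 = K" "\<forall>tp\<in>set ts3. blank_tape tp"
    and clean: "reach N (Suc (length y + T) + (1 + (Suc (length y + T) + 1)))
      (Clean_Right, i # ts2 @ [(word_on_tape ?w, int (length ?w))])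
      (Fetch, i # ts3 @ [(word_on_tape ?w, int (length ?w))])"
    using reach_clean[OF ts2, of i "(word_on_tape ?w, int (length ?w))"] by blast
  note all = reach_trans[OF fetch reach_trans[OF copy reach_trans[OF sim[folded q_def]
    reach_trans[OF stop reach_trans[OF ret clean]]]]]
  have "Suc 0 + (length v + 1 + (T + (Suc 0 + (length v + 1 + (length v + 1) +
      (Suc (length y + T) + (1 + (Suc (length y + T) + 1))))))) \<le> test_cost v"
    by (simp add: test_cost_def fac_v T_def y_def)
  from reach_mono[OF all this] show ?thesis
    using ts3 unfolding i_def v_def by blast
qed

lemma reach_prefix:
  assumes "w @ z \<in> lists L"
  shows "\<exists>ts. length ts = K \<and> (\<forall>tp\<in>set ts. blank_tape tp) \<and>
    reach N (sum_list (map test_cost (tests test w))) (initial N (w @ z))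
      (Fetch, (word_on_tape (w @ z), int (length w)) # ts @
        [(word_on_tape (flat (run test w)), int (length (flat (run test w))))])"
  using assms
proof (induction w arbitrary: z rule: rev_induct)
  case Nil
  have "initial N z = (Fetch, (word_on_tape z, 0) # replicate K (word_on_tape [], 0) @ [(word_on_tape [], 0)])"
    by (simp add: initial_def replicate_append_same[symmetric])
  moreover have "word_on_tape [] = (\<lambda>_. Blank :: outer_symbol)" by (auto simp: word_on_tape_def)
  ultimately show ?case
    by (intro exI[of _ "replicate K (word_on_tape [], 0)"]) (simp add: blank_tape_def)
next
  case (snoc x w)
  obtain ts where ts: "length ts = K" "\<forall>tp\<in>set ts. blank_tape tp"
    "reach N (sum_list (map test_cost (tests test w))) (initial N (w @ x # z))
      (Fetch, (word_on_tape (w @ x # z), int (length w)) # ts @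
        [(word_on_tape (flat (run test w)), int (length (flat (run test w))))])"
    using snoc.IH[of "x # z"] snoc.prems by auto
  have "set (flat (run test w)) \<subseteq> L" "x \<in> L"
    using set_flat_run[of test w] snoc.prems by (auto simp: in_lists_conv_set)
  moreover have "word_on_tape (w @ x # z) (int (length w)) = (Input x :: outer_symbol)"
    by simp
  ultimately obtain ts' where ts': "length ts' = K" "\<forall>tp\<in>set ts'. blank_tape tp"
    "reach N (test_cost (tested (run test w) x))
      (Fetch, (word_on_tape (w @ x # z), int (length w)) # ts @
        [(word_on_tape (flat (run test w)), int (length (flat (run test w))))])
      (Fetch, (word_on_tape (w @ x # z), int (length w) + 1) # ts' @
        [(word_on_tape (flat (push test (run test w) x)), int (length (flat (push test (run test w) x))))])"
    using reach_round[OF stacked_run _ _ _ ts(1,2)] by blast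
  show ?case
    using reach_trans[OF ts(3) ts'(3)] ts'(1,2)
    by (intro exI[of _ ts']) (simp add: add.commute)
qed

lemma machine_result:
  assumes "w \<in> lists L"
  shows "halts_on N w" "run_time N w \<le> sum_list (map test_cost (tests test w)) + 2"
    "fst (final_config N w) = Acc \<longleftrightarrow> flat (run test w) = []"
    "fst (last (snd (final_config N w))) = word_on_tape (flat (run test w))"
proof -
  let ?u = "flat (run test w)"
  obtain ts where ts: "reach N (sum_list (map test_cost (tests test w))) (initial N w)
      (Fetch, (word_on_tape w, int (length w)) # ts @ [(word_on_tape ?u, int (length ?u))])"
    using reach_prefix[of w "[]"] assms by auto
  define i where "i = (word_on_tape w :: int \<Rightarrow> outer_symbol, int (length w))"
  define t where "t = (word_on_tape ?u :: int \<Rightarrow> outer_symbol, int (length ?u) - 1)"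
  define q where "q = (if ?u = [] then Acc else Rej)"
  have "reach N 1 (Fetch, i # ts @ [(word_on_tape ?u, int (length ?u))]) (Fin, i # ts @ [t])"
  proof -
    have "read_tape i = Blank" by (simp add: i_def read_tape_def)
    then have "step N (Fetch, i # ts @ [(word_on_tape ?u, int (length ?u))]) =
      (Fin, act_tape i (keep (read_tape i)) # ts @
        [act_tape (word_on_tape ?u, int (length ?u)) (read_tape (word_on_tape ?u, int (length ?u)), Move_Left)])"
      by (intro step_N_keep) simp_all
    then show ?thesis
      using reach_step[of N 0] by (simp add: act_tape_move t_def)
  qed
  moreover have "reach N 1 (Fin, i # ts @ [t]) (q, i # ts @ [t])"
  proof -
    have "read_tape t = (if ?u = [] then Blank else Input (last ?u))"
      using word_on_tape_pred[of ?u "[]"] by (simp add: t_def read_tape_def)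
    then have "step N (Fin, i # ts @ [t]) = (q, act_tape i (keep (read_tape i)) # ts @ [act_tape t (keep (read_tape t))])"
      by (intro step_N_keep) (simp_all add: q_def)
    then show ?thesis using reach_step[of N 0] by simp
  qed
  ultimately have "reach N (sum_list (map test_cost (tests test w)) + (1 + 1)) (initial N w) (q, i # ts @ [t])"
    using reach_trans[OF ts[folded i_def] reach_trans] by blast
  moreover have "halting N (q, i # ts @ [t])" by (simp add: halting_def q_def)
  ultimately have *: "halts_on N w" "run_time N w \<le> sum_list (map test_cost (tests test w)) + (1 + 1)"
    "final_config N w = (q, i # ts @ [t])"
    by (rule reach_halting)+
  show "halts_on N w" by (rule *(1))
  show "run_time N w \<le> sum_list (map test_cost (tests test w)) + 2" using *(2) by simp
  show "fst (final_config N w) = Acc \<longleftrightarrow> ?u = []" by (simp add: *(3) q_def)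
  show "fst (last (snd (final_config N w))) = word_on_tape ?u" by (simp add: *(3) t_def)
qed

end

section \<open>Reduced sequences\<close>

context
  fixes A :: "('a, 'm) monoid_scheme" and B :: "('b, 'n) monoid_scheme"
begin

definition fp_one :: "'a + 'b \<Rightarrow> bool" where
  "fp_one z = (case z of Inl x \<Rightarrow> x = \<one>\<^bsub>A\<^esub> | Inr y \<Rightarrow> y = \<one>\<^bsub>B\<^esub>)"

definition fp_cons :: "'a + 'b \<Rightarrow> ('a + 'b) list \<Rightarrow> ('a + 'b) list" where
  "fp_cons z s = (if fp_one z then s else z # s)"

text \<open>The last entry of the represented product is the head of the list.\<close>

fun fp_push :: "('a + 'b) list \<Rightarrow> 'a + 'b \<Rightarrow> ('a + 'b) list" where
  "fp_push (Inl x # s) (Inl y) = fp_cons (Inl (x \<otimes>\<^bsub>A\<^esub> y)) s"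
| "fp_push (Inr x # s) (Inr y) = fp_cons (Inr (x \<otimes>\<^bsub>B\<^esub> y)) s"
| "fp_push s z = fp_cons z s"

definition fp_reduced :: "('a + 'b) list \<Rightarrow> bool" where
  "fp_reduced s \<longleftrightarrow> s \<in> fp_seqs A B \<and> (\<forall>z\<in>set s. \<not> fp_one z) \<and>
     successively (\<lambda>z z'. isl z \<noteq> isl z') s"

definition fp_normalise :: "('a + 'b) list \<Rightarrow> ('a + 'b) list" where
  "fp_normalise u = foldl fp_push [] u"

lemma fp_reduced_Nil [simp]: "fp_reduced []"
  by (simp add: fp_reduced_def)

lemma fp_reduced_Inl:
  "fp_reduced (Inl x # s) \<longleftrightarrow> x \<in> carrier A \<and> x \<noteq> \<one>\<^bsub>A\<^esub> \<and> fp_reduced s \<and> (s \<noteq> [] \<longrightarrow> \<not> isl (hd s))"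
  by (cases s) (auto simp: fp_reduced_def fp_one_def)

lemma fp_reduced_Inr:
  "fp_reduced (Inr y # s) \<longleftrightarrow> y \<in> carrier B \<and> y \<noteq> \<one>\<^bsub>B\<^esub> \<and> fp_reduced s \<and> (s \<noteq> [] \<longrightarrow> isl (hd s))"
  by (cases s) (auto simp: fp_reduced_def fp_one_def)

lemma fp_push_Inl: "s = [] \<or> \<not> isl (hd s) \<Longrightarrow> fp_push s (Inl x) = fp_cons (Inl x) s"
  by (cases "(s, Inl x :: 'a + 'b)" rule: fp_push.cases) auto

lemma fp_push_Inr: "s = [] \<or> isl (hd s) \<Longrightarrow> fp_push s (Inr x) = fp_cons (Inr x) s"
  by (cases "(s, Inr x :: 'a + 'b)" rule: fp_push.cases) auto

lemma fp_top_cases: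
  obtains (left) x r where "s = Inl x # r" | (right) y r where "s = Inr y # r" | (empty) "s = []"
proof (cases s)
  case (Cons z r)
  then show ?thesis using that by (cases z) auto
qed (use that in blast)

context
  assumes A: "group A" and B: "group B"
begin

interpretation A: group A by (rule A)
interpretation B: group B by (rule B)

lemma fp_reduced_push:
  assumes "fp_reduced s" "[z] \<in> fp_seqs A B"
  shows "fp_reduced (fp_push s z)"
proof (cases z)
  case (Inl x)
  then have x: "x \<in> carrier A" using assms(2) by simp
  show ?thesis
    using assms(1) x Inl
    by (cases s rule: fp_top_cases)
      (simp_all add: fp_cons_def fp_one_def fp_reduced_Inl fp_push_Inl)
next
  case (Inr y)
  then have y: "y \<in> carrier B" using assms(2) by simp
  show ?thesis
    using assms(1) y Inr
    by (cases s rule: fp_top_cases)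
      (simp_all add: fp_cons_def fp_one_def fp_reduced_Inr fp_push_Inr)
qed

lemma fp_reduced_foldl:
  assumes "fp_reduced s" "u \<in> fp_seqs A B"
  shows "fp_reduced (foldl fp_push s u)"
  using assms(2)
proof (induction u rule: rev_induct)
  case (snoc z u)
  then show ?case by (simp add: fp_reduced_push)
qed (use assms(1) in simp)

lemma fp_push_one:
  assumes "fp_reduced s"
  shows "fp_push s (Inl \<one>\<^bsub>A\<^esub>) = s" "fp_push s (Inr \<one>\<^bsub>B\<^esub>) = s"
  using assms by (cases s rule: fp_top_cases;
      simp add: fp_reduced_Inl fp_reduced_Inr fp_cons_def fp_one_def)+

lemma fp_push_mult_left:
  assumes "fp_reduced s" "x \<in> carrier A" "y \<in> carrier A"
  shows "fp_push (fp_push s (Inl x)) (Inl y) = fp_push s (Inl (x \<otimes>\<^bsub>A\<^esub> y))"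
proof (cases s rule: fp_top_cases)
  case (left g r)
  then have r: "r = [] \<or> \<not> isl (hd r)" and g: "g \<in> carrier A"
    using assms(1) by (auto simp: fp_reduced_Inl)
  have *: "g \<otimes>\<^bsub>A\<^esub> (x \<otimes>\<^bsub>A\<^esub> y) = g \<otimes>\<^bsub>A\<^esub> x \<otimes>\<^bsub>A\<^esub> y"
    using g assms(2,3) by (simp add: A.m_assoc)
  show ?thesis
    using left assms(3) fp_push_Inl[OF r]
    by (cases "g \<otimes>\<^bsub>A\<^esub> x = \<one>\<^bsub>A\<^esub>") (simp_all add: * fp_cons_def fp_one_def)
next
  case (right g r)
  then show ?thesis using assms(2,3)
    by (cases "x = \<one>\<^bsub>A\<^esub>") (simp_all add: fp_cons_def fp_one_def)
next
  case empty
  then show ?thesis using assms(2,3)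
    by (cases "x = \<one>\<^bsub>A\<^esub>") (simp_all add: fp_cons_def fp_one_def)
qed

lemma fp_push_mult_right:
  assumes "fp_reduced s" "x \<in> carrier B" "y \<in> carrier B"
  shows "fp_push (fp_push s (Inr x)) (Inr y) = fp_push s (Inr (x \<otimes>\<^bsub>B\<^esub> y))"
proof (cases s rule: fp_top_cases)
  case (right g r)
  then have r: "r = [] \<or> isl (hd r)" and g: "g \<in> carrier B"
    using assms(1) by (auto simp: fp_reduced_Inr)
  have *: "g \<otimes>\<^bsub>B\<^esub> (x \<otimes>\<^bsub>B\<^esub> y) = g \<otimes>\<^bsub>B\<^esub> x \<otimes>\<^bsub>B\<^esub> y"
    using g assms(2,3) by (simp add: B.m_assoc)
  show ?thesis
    using right assms(3) fp_push_Inr[OF r]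
    by (cases "g \<otimes>\<^bsub>B\<^esub> x = \<one>\<^bsub>B\<^esub>") (simp_all add: * fp_cons_def fp_one_def)
next
  case (left g r)
  then show ?thesis using assms(2,3)
    by (cases "x = \<one>\<^bsub>B\<^esub>") (simp_all add: fp_cons_def fp_one_def)
next
  case empty
  then show ?thesis using assms(2,3)
    by (cases "x = \<one>\<^bsub>B\<^esub>") (simp_all add: fp_cons_def fp_one_def)
qed

text \<open>The normal form theorem for free products, by van der Waerden's action on reduced sequences.\<close>

lemma foldl_fp_push_cong:
  assumes "(u, v) \<in> fp_rel A B" "fp_reduced s"
  shows "foldl fp_push s u = foldl fp_push s v"
  using assms
  by (induction arbitrary: s rule: fp_rel.induct)
    (simp_all add: fp_reduced_foldl fp_push_mult_left fp_push_mult_right fp_push_one)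

lemma fp_normalise_cong:
  assumes "fp_class A B u = fp_class A B v" "u \<in> fp_seqs A B" "v \<in> fp_seqs A B"
  shows "fp_normalise u = fp_normalise v"
  unfolding fp_normalise_def
  by (rule foldl_fp_push_cong)
    (use assms fp_class_eq_iff[OF A.is_monoid B.is_monoid] in simp_all)

lemma fp_reduced_normalise: "u \<in> fp_seqs A B \<Longrightarrow> fp_reduced (fp_normalise u)"
  by (simp add: fp_normalise_def fp_reduced_foldl)

end

end

section \<open>The stack in terms of the free product\<close>

locale factor_generators = A: group A + B: group B
  for A :: "('a, 'm) monoid_scheme" (structure) and B :: "('b, 'n) monoid_scheme" (structure) +
  fixes a :: "'x \<Rightarrow> 'a" and b :: "'x \<Rightarrow> 'b" and X Y :: "'x set"
  assumes a: "a ` X \<subseteq> carrier A - {\<one>\<^bsub>A\<^esub>}" and b: "b ` Y \<subseteq> carrier B - {\<one>\<^bsub>B\<^esub>}"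
begin

abbreviation "G \<equiv> free_product A B"
abbreviation "gens \<equiv> fp_generators A B a b"
abbreviation "W \<equiv> words (X <+> Y)"

definition letter_seq :: "('x + 'x) letter \<Rightarrow> 'a + 'b" where
  "letter_seq x = (if fac x then Inl (letter_value A a (strip x)) else Inr (letter_value B b (strip x)))"

abbreviation test :: "('x + 'x) word \<Rightarrow> bool" where
  "test \<equiv> block_test (\<lambda>c. if c then trivial_word A a else trivial_word B b)"

definition normal :: "('x + 'x) word \<Rightarrow> ('a + 'b) list" where
  "normal w = fp_normalise A B (map letter_seq w)"

lemma letter_cases:
  assumes "x \<in> letters (X <+> Y)"
  obtains (left) i e where "x = (Inl i, e)" "i \<in> X" "fac x" "strip x = (i, e)"
  | (right) i e where "x = (Inr i, e)" "i \<in> Y" "\<not> fac x" "strip x = (i, e)"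
  using assms by (cases x) (auto simp: letters_def fac_def strip_def)

lemma letter_value_left:
  assumes "l \<in> letters X"
  shows "letter_value A a l \<in> carrier A" "letter_value A a l \<noteq> \<one>\<^bsub>A\<^esub>"
  using assms a by (auto simp: letters_def letter_value_def image_subset_iff)

lemma letter_value_right:
  assumes "l \<in> letters Y"
  shows "letter_value B b l \<in> carrier B" "letter_value B b l \<noteq> \<one>\<^bsub>B\<^esub>"
  using assms b by (auto simp: letters_def letter_value_def image_subset_iff)

lemma strip_letters_left: "x \<in> letters (X <+> Y) \<Longrightarrow> fac x \<Longrightarrow> strip x \<in> letters X"
  by (erule letter_cases) (simp_all add: letters_def)

lemma strip_letters_right: "x \<in> letters (X <+> Y) \<Longrightarrow> \<not> fac x \<Longrightarrow> strip x \<in> letters Y"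
  by (erule letter_cases) (simp_all add: letters_def)

lemma letter_seq_closed:
  assumes "x \<in> letters (X <+> Y)"
  shows "[letter_seq x] \<in> fp_seqs A B"
  using strip_letters_left[OF assms] strip_letters_right[OF assms] letter_value_left letter_value_right
  by (simp add: letter_seq_def)

lemma words_Cons [simp]: "x # w \<in> W \<longleftrightarrow> x \<in> letters (X <+> Y) \<and> w \<in> W"
  and words_Nil [simp]: "[] \<in> W"
  and words_append [simp]: "u @ v \<in> W \<longleftrightarrow> u \<in> W \<and> v \<in> W"
  by (auto simp: words_def)

lemma seq_closed: "w \<in> W \<Longrightarrow> map letter_seq w \<in> fp_seqs A B"
proof (induction w)
  case (Cons x w)
  then show ?case using letter_seq_closed[of x] by (simp add: fp_seqs_def)
qed simp

lemma letter_value_free: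
  assumes "x \<in> letters (X <+> Y)"
  shows "letter_value G gens x = fp_class A B [letter_seq x]"
proof -
  have m: "monoid A" "monoid B" by (simp_all add: A.is_monoid B.is_monoid)
  interpret G: group G by (rule group_free_product[OF A.is_group B.is_group])
  interpret l: group_hom A G "fp_inl A B"
    by (intro group_hom.intro group_hom_axioms.intro A.is_group G.is_group fp_inl_hom m)
  interpret r: group_hom B G "fp_inr A B"
    by (intro group_hom.intro group_hom_axioms.intro B.is_group G.is_group fp_inr_hom m)
  show ?thesis
    using assms
  proof (cases rule: letter_cases)
    case (left i e)
    then have "a i \<in> carrier A" using a by auto
    then show ?thesis using left(1,3,4)
      by (simp add: letter_value_def letter_seq_def fp_generators_def fp_inl_def[symmetric])
  next
    case (right i e)
    then have "b i \<in> carrier B" using b by auto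
    then show ?thesis using right(1,3,4)
      by (simp add: letter_value_def letter_seq_def fp_generators_def fp_inr_def[symmetric])
  qed
qed

lemma word_value_free:
  assumes "w \<in> W"
  shows "word_value G gens w = fp_class A B (map letter_seq w)"
  using assms
proof (induction w)
  case Nil
  then show ?case by (simp add: one_free_product)
next
  case (Cons x w)
  then show ?case
    using mult_free_product[OF A.is_monoid B.is_monoid letter_seq_closed seq_closed]
    by (simp add: letter_value_free)
qed

lemma word_value_append:
  assumes "u \<in> W" "v \<in> W"
  shows "word_value G gens (u @ v) = word_value G gens u \<otimes>\<^bsub>G\<^esub> word_value G gens v"
  using assms by (simp add: word_value_free mult_free_product A.is_monoid B.is_monoid seq_closed)

lemma word_value_closed: "w \<in> W \<Longrightarrow> word_value G gens w \<in> carrier G"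
  by (simp add: word_value_free carrier_free_product seq_closed)

lemma normal_cong:
  assumes "u \<in> W" "v \<in> W" "word_value G gens u = word_value G gens v"
  shows "normal u = normal v"
  unfolding normal_def
  by (rule fp_normalise_cong[OF A.is_group B.is_group])
    (use assms in \<open>simp_all add: word_value_free seq_closed\<close>)

lemma normal_Nil [simp]: "normal [] = []"
  by (simp add: normal_def fp_normalise_def)

lemma normal_snoc [simp]: "normal (w @ [x]) = fp_push A B (normal w) (letter_seq x)"
  by (simp add: normal_def fp_normalise_def)

lemma word_value_left:
  assumes "v \<in> W" "\<forall>x\<in>set v. fac x"
  shows "map strip v \<in> words X" "word_value A a (map strip v) \<in> carrier A"
    "word_value G gens v = fp_inl A B (word_value A a (map strip v))"
proof -
  have "map strip v \<in> words X \<and> word_value A a (map strip v) \<in> carrier A \<and>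
    word_value G gens v = fp_inl A B (word_value A a (map strip v))"
    using assms
  proof (induction v)
    case Nil
    have "fp_class A B [] = fp_class A B [Inl \<one>\<^bsub>A\<^esub>]"
      using fp_rel.sym[OF fp_rel.one_left[of "[]" A B "[]"]]
      by (simp add: fp_class_eq_iff A.is_monoid B.is_monoid)
    then show ?case by (simp add: words_def fp_inl_def one_free_product)
  next
    case (Cons x v)
    then have x: "x \<in> letters (X <+> Y)" "fac x" by simp_all
    note l = strip_letters_left[OF x] letter_value_left[OF strip_letters_left[OF x]]
    have "letter_value G gens x = fp_inl A B (letter_value A a (strip x))"
      using x by (simp add: letter_value_free fp_inl_def letter_seq_def)
    then show ?case
      using Cons l hom_mult[OF fp_inl_hom[OF A.is_monoid B.is_monoid], of "letter_value A a (strip x)"]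
      by (simp add: words_def)
  qed
  then show "map strip v \<in> words X" "word_value A a (map strip v) \<in> carrier A"
    "word_value G gens v = fp_inl A B (word_value A a (map strip v))" by simp_all
qed

lemma word_value_right:
  assumes "v \<in> W" "\<forall>x\<in>set v. \<not> fac x"
  shows "map strip v \<in> words Y" "word_value B b (map strip v) \<in> carrier B"
    "word_value G gens v = fp_inr A B (word_value B b (map strip v))"
proof -
  have "map strip v \<in> words Y \<and> word_value B b (map strip v) \<in> carrier B \<and>
    word_value G gens v = fp_inr A B (word_value B b (map strip v))"
    using assms
  proof (induction v)
    case Nil
    have "fp_class A B [] = fp_class A B [Inr \<one>\<^bsub>B\<^esub>]"
      using fp_rel.sym[OF fp_rel.one_right[of "[]" A B "[]"]]
      by (simp add: fp_class_eq_iff A.is_monoid B.is_monoid)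
    then show ?case by (simp add: words_def fp_inr_def one_free_product)
  next
    case (Cons x v)
    then have x: "x \<in> letters (X <+> Y)" "\<not> fac x" by simp_all
    note l = strip_letters_right[OF x] letter_value_right[OF strip_letters_right[OF x]]
    have "letter_value G gens x = fp_inr A B (letter_value B b (strip x))"
      using x by (simp add: letter_value_free fp_inr_def letter_seq_def)
    then show ?case
      using Cons l hom_mult[OF fp_inr_hom[OF A.is_monoid B.is_monoid], of "letter_value B b (strip x)"]
      by (simp add: words_def)
  qed
  then show "map strip v \<in> words Y" "word_value B b (map strip v) \<in> carrier B"
    "word_value G gens v = fp_inr A B (word_value B b (map strip v))" by simp_all
qed

end

context factor_generators
begin

definition block_seq :: "('x + 'x) word \<Rightarrow> 'a + 'b" where
  "block_seq v = (if fac (hd v) then Inl (word_value A a (map strip v))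
     else Inr (word_value B b (map strip v)))"

lemma in_words_iff: "v \<in> W \<longleftrightarrow> set v \<subseteq> letters (X <+> Y)"
  by (auto simp: words_def)

lemma test_iff_one: "test v \<longleftrightarrow> fp_one A B (block_seq v)"
  by (simp add: block_test_def block_seq_def fp_one_def trivial_word_def)

lemma block_value:
  assumes "v \<in> W" "block c v"
  shows "word_value G gens v = fp_class A B [block_seq v]" "[block_seq v] \<in> fp_seqs A B"
proof -
  have hd: "fac (hd v) = c" by (rule block_hd[OF assms(2)])
  have all: "\<forall>x\<in>set v. fac x = c" using assms(2) by (simp add: block_def)
  have "word_value G gens v = fp_class A B [block_seq v] \<and> [block_seq v] \<in> fp_seqs A B"
  proof (cases c)
    case True
    then show ?thesis
      using word_value_left[OF assms(1)] all hd by (simp add: block_seq_def fp_inl_def)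
  next
    case False
    then show ?thesis
      using word_value_right[OF assms(1)] all hd by (simp add: block_seq_def fp_inr_def)
  qed
  then show "word_value G gens v = fp_class A B [block_seq v]" "[block_seq v] \<in> fp_seqs A B"
    by simp_all
qed

lemma normal_block:
  assumes "v \<in> W" "block c v"
  shows "normal v = fp_cons A B (block_seq v) []"
proof -
  have "normal v = fp_normalise A B [block_seq v]"
    unfolding normal_def
    by (rule fp_normalise_cong[OF A.is_group B.is_group])
      (use assms block_value[OF assms] in \<open>simp_all add: word_value_free seq_closed\<close>)
  then show ?thesis by (cases "block_seq v") (simp_all add: fp_normalise_def)
qed

lemma test_value:
  assumes "v \<in> W" "block c v" "test v"
  shows "word_value G gens v = \<one>\<^bsub>G\<^esub>"
proof -
  have "([block_seq v], []) \<in> fp_rel A B"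
    using assms(3) fp_rel.one_left[of "[]" A B "[]"] fp_rel.one_right[of "[]" A B "[]"]
    by (cases "block_seq v") (simp_all add: test_iff_one fp_one_def)
  then show ?thesis
    using block_value[OF assms(1,2)]
    by (simp add: one_free_product fp_class_eq_iff A.is_monoid B.is_monoid)
qed

lemma word_value_snoc_left:
  assumes "u \<in> words X" "l \<in> letters X"
  shows "word_value A a (u @ [l]) = word_value A a u \<otimes>\<^bsub>A\<^esub> letter_value A a l"
    and "word_value A a u \<in> carrier A"
proof -
  have "word_value A a (u @ [l]) = word_value A a u \<otimes>\<^bsub>A\<^esub> letter_value A a l \<and> word_value A a u \<in> carrier A"
    using assms by (induction u) (simp_all add: words_def letter_value_left A.m_assoc)
  then show "word_value A a (u @ [l]) = word_value A a u \<otimes>\<^bsub>A\<^esub> letter_value A a l"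
    "word_value A a u \<in> carrier A" by simp_all
qed

lemma word_value_snoc_right:
  assumes "u \<in> words Y" "l \<in> letters Y"
  shows "word_value B b (u @ [l]) = word_value B b u \<otimes>\<^bsub>B\<^esub> letter_value B b l"
    and "word_value B b u \<in> carrier B"
proof -
  have "word_value B b (u @ [l]) = word_value B b u \<otimes>\<^bsub>B\<^esub> letter_value B b l \<and> word_value B b u \<in> carrier B"
    using assms by (induction u) (simp_all add: words_def letter_value_right B.m_assoc)
  then show "word_value B b (u @ [l]) = word_value B b u \<otimes>\<^bsub>B\<^esub> letter_value B b l"
    "word_value B b u \<in> carrier B" by simp_all
qed

lemma block_seq_single:
  assumes "x \<in> letters (X <+> Y)"
  shows "block_seq [x] = letter_seq x"
  using strip_letters_left[OF assms] strip_letters_right[OF assms] letter_value_left letter_value_right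
  by (simp add: block_seq_def letter_seq_def)

lemma fp_push_block:
  assumes ws: "stacked ws" "set (flat ws) \<subseteq> letters (X <+> Y)" and x: "x \<in> letters (X <+> Y)"
  shows "fp_push A B (map block_seq ws) (letter_seq x) =
    fp_cons A B (block_seq (tested ws x)) (map block_seq (below ws x))"
proof (cases "ws \<noteq> [] \<and> fac (hd (hd ws)) = fac x")
  case True
  then obtain v vs where v: "ws = v # vs" "fac (hd v) = fac x" by (cases ws) auto
  have "block (fac x) v" using ws(1) v by (simp add: stacked_Cons)
  then have ne: "v \<noteq> []" and all: "\<forall>y\<in>set v. fac y = fac x" by (auto simp: block_def)
  have vW: "v \<in> W" using ws(2) v(1) by (simp add: in_words_iff)
  have tb: "tested ws x = v @ [x]" "below ws x = vs" using v by (simp_all add: tested_def below_def)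
  show ?thesis
  proof (cases "fac x")
    case True
    have "map strip v \<in> words X" using word_value_left(1)[OF vW] all True by simp
    from word_value_snoc_left(1)[OF this strip_letters_left[OF x True]] show ?thesis
      unfolding tb using v True ne by (simp add: block_seq_def letter_seq_def)
  next
    case False
    have "map strip v \<in> words Y" using word_value_right(1)[OF vW] all False by simp
    from word_value_snoc_right(1)[OF this strip_letters_right[OF x False]] show ?thesis
      unfolding tb using v False ne by (simp add: block_seq_def letter_seq_def)
  qed
next
  case False
  then have tb: "tested ws x = [x]" "below ws x = ws"
    unfolding tested_def below_def if_not_P[OF False] by simp_all
  have "fp_push A B (map block_seq ws) (letter_seq x) = fp_cons A B (letter_seq x) (map block_seq ws)"
  proof (cases ws)
    case (Cons v vs)
    then have "fac (hd v) \<noteq> fac x" using False by simp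
    then show ?thesis using Cons by (cases "fac x") (simp_all add: block_seq_def letter_seq_def)
  qed (cases "letter_seq x"; simp)
  then show ?thesis by (simp add: tb block_seq_single[OF x])
qed

lemma set_run_letters: "w \<in> W \<Longrightarrow> set (flat (run P w)) \<subseteq> letters (X <+> Y)"
  using set_flat_run[of P w] by (auto simp: in_words_iff)

lemma normal_run: "w \<in> W \<Longrightarrow> normal w = map block_seq (run test w)"
proof (induction w rule: rev_induct)
  case (snoc x w)
  then have w: "w \<in> W" "x \<in> letters (X <+> Y)" by simp_all
  show ?case
    using snoc.IH[OF w(1)] fp_push_block[OF stacked_run set_run_letters[OF w(1)] w(2)]
    by (simp add: push_def test_iff_one fp_cons_def)
qed simp

lemma flat_run_word: "w \<in> W \<Longrightarrow> flat (run P w) \<in> W"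
  using set_run_letters by (simp add: in_words_iff)

lemma tested_word:
  assumes "w \<in> W" "x \<in> letters (X <+> Y)"
  shows "tested (run P w) x \<in> W" "flat (below (run P w) x) \<in> W"
proof -
  have "flat (below (run P w) x) @ tested (run P w) x \<in> W"
    unfolding flat_below_tested using assms flat_run_word by simp
  then show "tested (run P w) x \<in> W" "flat (below (run P w) x) \<in> W" by simp_all
qed

lemma word_value_one_right:
  assumes "u \<in> W" "v \<in> W" "word_value G gens v = \<one>\<^bsub>G\<^esub>"
  shows "word_value G gens (u @ v) = word_value G gens u"
  using assms word_value_append[OF assms(1,2)] word_value_closed[OF assms(1)]
    group.is_monoid[OF group_free_product[OF A.is_group B.is_group]]
  by (simp add: monoid.r_one)

lemma run_value:
  assumes "w \<in> W"
  shows "word_value G gens (flat (run test w)) = word_value G gens w"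
  using assms
proof (induction w rule: rev_induct)
  case (snoc x w)
  then have w: "w \<in> W" "x \<in> letters (X <+> Y)" by simp_all
  let ?v = "tested (run test w) x" and ?u = "flat (below (run test w) x)"
  have W: "?v \<in> W" "?u \<in> W" by (rule tested_word[OF w])+
  have "word_value G gens (flat (push test (run test w) x)) = word_value G gens (?u @ ?v)"
    using word_value_one_right[OF W(2,1) test_value[OF W(1) block_tested[OF stacked_run]]]
    by (simp add: push_def)
  also have "\<dots> = word_value G gens (w @ [x])"
    unfolding flat_below_tested
    using word_value_append[of "flat (run test w)" "[x]"] word_value_append[of w "[x]"]
      snoc.IH[OF w(1)] w flat_run_word[OF w(1)] by simp
  finally show ?case by simp
qed simp

lemma run_empty_iff:
  assumes "w \<in> W"
  shows "flat (run test w) = [] \<longleftrightarrow> trivial_word G gens w"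
proof
  assume "flat (run test w) = []"
  then show "trivial_word G gens w"
    using run_value[OF assms] by (simp add: trivial_word_def)
next
  assume "trivial_word G gens w"
  then have "normal w = normal []"
    by (intro normal_cong) (use assms in \<open>simp_all add: trivial_word_def\<close>)
  then show "flat (run test w) = []"
    using normal_run[OF assms] by simp
qed

lemma not_test_run: "v \<in> set (run P w) \<Longrightarrow> \<not> P v"
proof (induction w rule: rev_induct)
  case (snoc x w)
  then show ?case
    by (cases "run P w") (auto simp: push_def below_def split: if_splits)
qed simp

lemma block_syllable:
  assumes "v \<in> W" "block c v" "\<not> test v"
  shows "c \<Longrightarrow> left_syllable A X a v" "\<not> c \<Longrightarrow> right_syllable B Y b v"
proof -
  have all: "\<forall>x\<in>set v. fac x = c" and hd: "fac (hd v) = c"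
    using assms(2) block_hd[OF assms(2)] by (simp_all add: block_def)
  show "left_syllable A X a v" if c
  proof -
    have "map (apfst Inl) (map strip v) = v"
      unfolding map_map
    proof (rule map_idI)
      fix x assume "x \<in> set v"
      then have "x \<in> letters (X <+> Y)" "fac x" using assms(1) all that by (auto simp: in_words_iff)
      then show "(apfst Inl \<circ> strip) x = x"
        by (cases x rule: letter_cases) simp_all
    qed
    then show ?thesis
      using word_value_left(1)[OF assms(1)] all hd that assms(3)
      unfolding left_syllable_def block_test_def by (intro bexI[of _ "map strip v"]) simp_all
  qed
  show "right_syllable B Y b v" if "\<not> c"
  proof -
    have "map (apfst Inr) (map strip v) = v"
      unfolding map_map
    proof (rule map_idI)
      fix x assume "x \<in> set v"
      then have "x \<in> letters (X <+> Y)" "\<not> fac x" using assms(1) all that by (auto simp: in_words_iff)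
      then show "(apfst Inr \<circ> strip) x = x"
        by (cases x rule: letter_cases) simp_all
    qed
    then show ?thesis
      using word_value_right(1)[OF assms(1)] all hd that assms(3)
      unfolding right_syllable_def block_test_def by (intro bexI[of _ "map strip v"]) simp_all
  qed
qed

lemma stacked_normal_form:
  assumes "stacked ws" "set (flat ws) \<subseteq> letters (X <+> Y)" "\<forall>v\<in>set ws. \<not> test v"
  shows "in_normal_form A X a B Y b (flat ws)"
proof -
  have W: "v \<in> W" if "v \<in> set ws" for v
    using assms(2) that by (fastforce simp: in_words_iff set_flat)
  have blk: "block (fac (hd v)) v" if "v \<in> set ws" for v
    using assms(1) that by (simp add: stacked_def)
  have L: "left_syllable A X a v" if "v \<in> set ws" "fac (hd v)" for v
    using block_syllable(1)[OF W blk] that assms(3) by blast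
  have R: "right_syllable B Y b v" if "v \<in> set ws" "\<not> fac (hd v)" for v
    using block_syllable(2)[OF W blk] that assms(3) by blast
  have "successively (\<lambda>v v'. fac (hd v) \<noteq> fac (hd v')) ws"
    using assms(1) by (simp add: stacked_def)
  then have "successively (\<lambda>v' v. left_syllable A X a v \<and> right_syllable B Y b v' \<or>
      right_syllable B Y b v \<and> left_syllable A X a v') ws"
    by (rule successively_mono) (use L R in blast)+
  then have "successively (\<lambda>v v'. left_syllable A X a v \<and> right_syllable B Y b v' \<or>
      right_syllable B Y b v \<and> left_syllable A X a v') (rev ws)"
    by (simp add: successively_rev)
  moreover have "\<forall>v\<in>set (rev ws). left_syllable A X a v \<or> right_syllable B Y b v"
    using L R by auto
  ultimately show ?thesis
    unfolding in_normal_form_def flat_def by blast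
qed

lemma run_normal_form:
  assumes "w \<in> W"
  shows "normal_form_of A X a B Y b w (flat (run test w))"
  using stacked_normal_form[OF stacked_run set_run_letters[OF assms]] not_test_run[of _ test w]
    run_value[OF assms]
  by (simp add: normal_form_of_def)

text \<open>
  Syllables on the stack need not be factors of the input.  They are compared with contiguous
  factors, over which one can sum when all inputs of a given length are considered.
\<close>

definition spans :: "('x + 'x) word \<Rightarrow> ('x + 'x) word \<Rightarrow> bool" where
  "spans v s \<longleftrightarrow> s \<in> W \<and> length v \<le> length s \<and> word_value G gens s = word_value G gens v"

lemma spans_step:
  assumes "list_all2 spans ws us" "stacked ws" "set (flat ws) \<subseteq> letters (X <+> Y)"
    "x \<in> letters (X <+> Y)"
  shows "\<exists>us' s. flat us' @ s = flat us @ [x] \<and> list_all2 spans (below ws x) us' \<and> spans (tested ws x) s"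
proof (cases "ws \<noteq> [] \<and> fac (hd (hd ws)) = fac x")
  case True
  then obtain v vs where v: "ws = v # vs" "fac (hd v) = fac x" by (cases ws) auto
  then obtain s ss where us: "us = s # ss" "spans v s" "list_all2 spans vs ss"
    using assms(1) by (auto simp: list_all2_Cons1)
  have "v \<in> W" using assms(3) v(1) by (simp add: in_words_iff)
  then have "spans (v @ [x]) (s @ [x])"
    using us(2) assms(4) word_value_append[of _ "[x]"] by (simp add: spans_def)
  then show ?thesis
    using v us by (intro exI[of _ ss] exI[of _ "s @ [x]"]) (simp add: tested_def below_def)
next
  case False
  then have tb: "tested ws x = [x]" "below ws x = ws"
    unfolding tested_def below_def if_not_P[OF False] by simp_all
  have "spans [x] [x]" using assms(4) by (simp add: spans_def)
  then show ?thesis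
    using assms(1) unfolding tb by (intro exI[of _ us] exI[of _ "[x]"]) simp
qed

lemma spans_run:
  assumes "w \<in> W"
  shows "\<exists>u us. w = u @ flat us \<and> list_all2 spans (run test w) us"
  using assms
proof (induction w rule: rev_induct)
  case Nil
  show ?case by (intro exI[of _ "[]"]) simp
next
  case (snoc x w)
  then have w: "w \<in> W" "x \<in> letters (X <+> Y)" by simp_all
  let ?ws = "run test w"
  obtain u us where u: "w = u @ flat us" "list_all2 spans ?ws us"
    using snoc.IH[OF w(1)] by blast
  obtain us' s where us': "flat us' @ s = flat us @ [x]" "list_all2 spans (below ?ws x) us'"
    "spans (tested ?ws x) s"
    using spans_step[OF u(2) stacked_run set_run_letters[OF w(1)] w(2)] by blast
  have w': "w @ [x] = u @ flat us' @ s" using u(1) us'(1) by simp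
  have "\<exists>u us. w @ [x] = u @ flat us \<and> list_all2 spans (push test ?ws x) us"
  proof (cases "test (tested ?ws x)")
    case True
    have s: "s \<in> W" "word_value G gens s = \<one>\<^bsub>G\<^esub>"
      using us'(3) test_value[OF tested_word(1)[OF w] block_tested[OF stacked_run] True]
      by (simp_all add: spans_def)
    show ?thesis
    proof (cases us')
      case Nil
      then show ?thesis using w' us'(2) True
        by (intro exI[of _ "u @ s"] exI[of _ "[]"]) (simp add: push_def)
    next
      case (Cons y ys)
      then obtain v vs where v: "below ?ws x = v # vs" "spans v y" "list_all2 spans vs ys"
        using us'(2) by (auto simp: list_all2_Cons2)
      then have "spans v (y @ s)"
        using s word_value_one_right[of y s] by (simp add: spans_def)
      then show ?thesis using w' Cons v True
        by (intro exI[of _ u] exI[of _ "(y @ s) # ys"]) (simp add: push_def)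
    qed
  next
    case False
    then show ?thesis using w' us'
      by (intro exI[of _ u] exI[of _ "s # us'"]) (simp add: push_def)
  qed
  then show ?case by (simp only: run_snoc)
qed

lemma tested_span:
  assumes "w \<in> W" "x \<in> letters (X <+> Y)"
  obtains u s where "w @ [x] = u @ s" "length (tested (run test w) x) \<le> length s"
    "length (normal s) \<le> 1"
proof -
  let ?ws = "run test w"
  obtain u us where u: "w = u @ flat us" "list_all2 spans ?ws us"
    using spans_run[OF assms(1)] by blast
  obtain us' s where us': "flat us' @ s = flat us @ [x]" "spans (tested ?ws x) s"
    using spans_step[OF u(2) stacked_run set_run_letters[OF assms(1)] assms(2)] by blast
  have "normal s = normal (tested ?ws x)"
    using us'(2) tested_word(1)[OF assms] by (intro normal_cong) (simp_all add: spans_def)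
  then have "length (normal s) \<le> 1"
    using normal_block[OF tested_word(1)[OF assms] block_tested[OF stacked_run]]
    by (simp add: fp_cons_def)
  then show ?thesis
    using that[of "u @ flat us'" s] u(1) us' by (simp add: spans_def)
qed

end

section \<open>Counting words\<close>

lemma finite_letters: "finite X \<Longrightarrow> finite (letters X)"
  by (simp add: letters_def)

lemma words_of_length_eq: "words_of_length X n = {w. set w \<subseteq> letters X \<and> length w = n}"
  by (auto simp: words_of_length_def words_def)

lemma finite_words_of_length: "finite X \<Longrightarrow> finite (words_of_length X n)"
  by (simp add: words_of_length_eq finite_lists_length_eq finite_letters)

lemma card_words_of_length: "finite X \<Longrightarrow> card (words_of_length X n) = card (letters X) ^ n"
  by (simp add: words_of_length_eq card_lists_length_eq finite_letters)

lemma sum_words_snoc: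
  "(\<Sum>w\<in>words_of_length X (Suc n). F w) = (\<Sum>w\<in>words_of_length X n. \<Sum>x\<in>letters X. F (w @ [x]))"
proof -
  have "words_of_length X (Suc n) = (\<lambda>(w, x). w @ [x]) ` (words_of_length X n \<times> letters X)"
  proof (intro equalityI subsetI)
    fix w assume w: "w \<in> words_of_length X (Suc n)"
    then obtain v x where "w = v @ [x]"
      by (cases w rule: rev_cases) (auto simp: words_of_length_eq)
    then show "w \<in> (\<lambda>(w, x). w @ [x]) ` (words_of_length X n \<times> letters X)"
      using w by (intro image_eqI[of _ _ "(v, x)"]) (simp_all add: words_of_length_eq)
  qed (auto simp: words_of_length_eq)
  moreover have "inj_on (\<lambda>(w, x). w @ [x]) (words_of_length X n \<times> letters X)"
    by (auto simp: inj_on_def)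
  ultimately show ?thesis
    by (simp add: sum.reindex sum.cartesian_product split_def)
qed

lemma sum_words_append:
  "(\<Sum>w\<in>words_of_length X (n + k). F w) = (\<Sum>u\<in>words_of_length X n. \<Sum>v\<in>words_of_length X k. F (u @ v))"
proof (induction k arbitrary: F)
  case 0
  have "words_of_length X 0 = {[]}" by (auto simp: words_of_length_eq)
  then show ?case by simp
next
  case (Suc k)
  show ?case by (simp add: sum_words_snoc Suc.IH)
qed

lemma power_times_geometric_bounded:
  fixes x :: real
  assumes "0 < x" "x < 1"
  shows "\<exists>C. \<forall>k. real (Suc k) ^ d * x ^ k \<le> C"
  using assms
proof (induction d arbitrary: x)
  case 0
  then have "x ^ k \<le> 1" for k by (simp add: power_le_one)
  then show ?case by (intro exI[of _ 1]) simp
next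
  case (Suc d)
  define y where "y = sqrt x"
  have y: "0 < y" "y < 1" "y * y = x"
    using Suc.prems by (simp_all add: y_def)
  obtain C where C: "\<And>k. real (Suc k) ^ d * y ^ k \<le> C"
    using Suc.IH[OF y(1,2)] by blast
  define e where "e = 1 / y - 1"
  have e: "e > 0" and e1: "1 + e = 1 / y" using y by (simp_all add: e_def)
  have D: "real (Suc k) * y ^ k \<le> 1 + 1 / e" for k
  proof -
    have "1 + real k * e \<le> (1 / y) ^ k"
      using Bernoulli_inequality[of e k] e e1 by simp
    moreover have "real (Suc k) \<le> (1 + 1 / e) * (1 + real k * e)"
      using e by (simp add: field_simps)
    ultimately have "real (Suc k) \<le> (1 + 1 / e) * (1 / y) ^ k"
      using e by (meson add_nonneg_nonneg divide_nonneg_pos less_eq_real_def mult_left_mono order_trans zero_le_one)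
    then show ?thesis using y by (simp add: field_simps power_one_over)
  qed
  have "real (Suc k) ^ Suc d * x ^ k \<le> C * (1 + 1 / e)" for k
  proof -
    have "real (Suc k) ^ Suc d * x ^ k = (real (Suc k) ^ d * y ^ k) * (real (Suc k) * y ^ k)"
      by (simp add: y(3)[symmetric] power_mult_distrib mult_ac)
    also have "\<dots> \<le> C * (1 + 1 / e)"
      by (intro mult_mono C D order_trans[OF _ C[of 0]]) (use y in simp_all)
    finally show ?thesis .
  qed
  then show ?case by blast
qed

lemma sum_power_times_geometric_bounded:
  fixes x :: real
  assumes "0 < x" "x < 1"
  shows "\<exists>C. \<forall>n. (\<Sum>k<n. real (Suc k) ^ d * x ^ k) \<le> C"
proof -
  define y where "y = sqrt x"
  have y: "0 < y" "y < 1" "y * y = x"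
    using assms by (simp_all add: y_def)
  obtain C where C: "\<And>k. real (Suc k) ^ d * y ^ k \<le> C"
    using power_times_geometric_bounded[OF y(1,2)] by blast
  have C0: "0 \<le> C" by (rule order_trans[OF _ C[of 0]]) simp
  have "(\<Sum>k<n. real (Suc k) ^ d * x ^ k) \<le> C * (1 / (1 - y))" for n
  proof -
    have "(\<Sum>k<n. real (Suc k) ^ d * x ^ k) \<le> (\<Sum>k<n. C * y ^ k)"
    proof (rule sum_mono)
      fix k
      have "real (Suc k) ^ d * x ^ k = (real (Suc k) ^ d * y ^ k) * y ^ k"
        by (simp add: y(3)[symmetric] power_mult_distrib mult_ac)
      also have "\<dots> \<le> C * y ^ k"
        by (rule mult_right_mono[OF C]) (use y in simp)
      finally show "real (Suc k) ^ d * x ^ k \<le> C * y ^ k" .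
    qed
    also have "\<dots> = C * ((1 - y ^ n) / (1 - y))"
      using y by (simp add: sum_distrib_left[symmetric] sum_gp_strict)
    also have "\<dots> \<le> C * (1 / (1 - y))"
      using y C0 by (intro mult_left_mono divide_right_mono) simp_all
    finally show ?thesis .
  qed
  then show ?thesis by blast
qed

section \<open>Decay of the probability of a single syllable\<close>

lemma weights_exist:
  fixes p q :: real
  assumes "p \<ge> 1" "q \<ge> 1"
  shows "\<exists>c d r. 0 < c \<and> c < 1 \<and> 0 < d \<and> d < 1 \<and> 0 < r \<and> r < p + q \<and> p * c + q * d \<le> r \<and>
    (\<forall>k. 0 \<le> k \<and> k \<le> p - 1 \<longrightarrow> p - k + k / c + q * d \<le> r) \<and>
    (\<forall>k. 0 \<le> k \<and> k \<le> q \<longrightarrow> q - k + k / d + p * c \<le> r)"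
proof -
  \<comment> \<open>To first order in \<open>\<epsilon>\<close>, the two main conditions are \<open>(p - 1) \<epsilon> < q \<delta> < p \<epsilon>\<close>.\<close>
  define \<epsilon> where "\<epsilon> = 1 / (4 * p\<^sup>2)"
  define \<delta> where "\<delta> = (p - 1/2) * \<epsilon> / q"
  have e: "0 < \<epsilon>" using assms by (simp add: \<epsilon>_def)
  have pe: "p * p * \<epsilon> = 1 / 4" using assms by (simp add: \<epsilon>_def power2_eq_square field_simps)
  have "1 * (p * \<epsilon>) \<le> p * (p * \<epsilon>)"
    by (rule mult_right_mono) (use assms e in simp_all)
  then have pe': "p * \<epsilon> \<le> 1 / 4" using pe by (simp only: mult.assoc mult_1)
  have "1 * \<epsilon> \<le> p * \<epsilon>" by (rule mult_right_mono) (use assms e in simp_all)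
  then have e1: "\<epsilon> \<le> 1 / 4" using pe' by simp
  have d: "0 < \<delta>" using assms e by (simp add: \<delta>_def)
  have qd: "q * \<delta> = (p - 1/2) * \<epsilon>" using assms by (simp add: \<delta>_def)
  have "p * \<delta> \<le> p * (q * \<delta>)"
    using assms d mult_right_mono[of 1 q \<delta>] by simp
  also have "\<dots> = p * p * \<epsilon> - p * \<epsilon> / 2" unfolding qd by (simp add: algebra_simps)
  finally have pd: "p * \<delta> < 1 / 4" using pe e assms by (smt (verit) half_gt_zero mult_pos_pos)
  have "1 * \<delta> \<le> p * \<delta>" by (rule mult_right_mono) (use assms d in simp_all)
  then have d1: "\<delta> < 1 / 4" using pd by simp
  define c where "c = 1 - \<epsilon>"
  define c' where "c' = 1 - \<delta>"
  have c: "0 < c" "c < 1" "0 < c'" "c' < 1"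
    using e e1 d d1 by (simp_all add: c_def c'_def)
  have A: "(p - 1) / c - (p - 1) < q * \<delta>"
  proof -
    have "\<epsilon> * (p - 1/2) < 1/2" using pe' e by (simp add: algebra_simps)
    moreover have "(p - 1/2) * c = (p - 1/2) - \<epsilon> * (p - 1/2)" by (simp add: c_def field_simps)
    ultimately have "(p - 1) < (p - 1/2) * c" by linarith
    then have "\<epsilon> * (p - 1) < \<epsilon> * ((p - 1/2) * c)" using e by (rule mult_strict_left_mono)
    moreover have "(q * \<delta> + (p - 1)) * c = \<epsilon> * ((p - 1/2) * c) + (p - 1) - \<epsilon> * (p - 1)"
      unfolding qd by (simp add: c_def field_simps)
    ultimately have "(p - 1) < (q * \<delta> + (p - 1)) * c" by linarith
    then have "(p - 1) / c < q * \<delta> + (p - 1)" using c by (simp only: pos_divide_less_eq)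
    then show ?thesis by linarith
  qed
  have B: "q / c' - q < p * \<epsilon>"
  proof -
    have "p - 1/2 < p * c'" using pd by (simp add: c'_def algebra_simps)
    then have "\<epsilon> * (p - 1/2) < \<epsilon> * (p * c')" using e by (rule mult_strict_left_mono)
    moreover have "(p * \<epsilon> + q) * c' = \<epsilon> * (p * c') + q - q * \<delta>" by (simp add: c'_def algebra_simps)
    moreover have "q * \<delta> = \<epsilon> * (p - 1/2)" using qd by (simp only: mult.commute)
    ultimately have "q < (p * \<epsilon> + q) * c'" by linarith
    then have "q / c' < p * \<epsilon> + q" using c by (simp only: pos_divide_less_eq)
    then show ?thesis by linarith
  qed
  define r where "r = max (p * c + q * c') (max (p + (p - 1) / c - (p - 1) + q * c') (q / c' + p * c))"
  have "p * c + q * c' < p * 1 + q * 1"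
    by (intro add_strict_mono mult_strict_left_mono) (use assms c in simp_all)
  then have "p * c + q * c' < p + q" by simp
  moreover have "p + (p - 1) / c - (p - 1) + q * c' < p + q"
    using A by (simp add: c'_def algebra_simps)
  moreover have "q / c' + p * c < p + q"
    using B by (simp add: c_def algebra_simps)
  ultimately have r: "r < p + q" by (simp add: r_def)
  have r0: "0 < r" using assms c by (simp add: r_def less_max_iff_disj add_pos_pos)
  have kA: "p - k + k / c + q * c' \<le> r" if "0 \<le> k" "k \<le> p - 1" for k
  proof -
    have "k * (1 / c - 1) \<le> (p - 1) * (1 / c - 1)"
      using that c by (intro mult_right_mono) simp_all
    then have "p - k + k / c + q * c' \<le> p + (p - 1) / c - (p - 1) + q * c'"
      by (simp add: algebra_simps)
    then show ?thesis by (simp add: r_def)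
  qed
  have kB: "q - k + k / c' + p * c \<le> r" if "0 \<le> k" "k \<le> q" for k
  proof -
    have "k * (1 / c' - 1) \<le> q * (1 / c' - 1)"
      using that c by (intro mult_right_mono) simp_all
    then have "q - k + k / c' + p * c \<le> q / c' + p * c"
      by (simp add: algebra_simps)
    then show ?thesis by (simp add: r_def)
  qed
  have "p * c + q * c' \<le> r" by (simp add: r_def)
  then show ?thesis using c r r0 kA kB by blast
qed

definition weight :: "real \<Rightarrow> real \<Rightarrow> ('a + 'b) list \<Rightarrow> real" where
  "weight c d s = (\<Prod>z\<leftarrow>s. if isl z then c else d)"

lemma weight_simps [simp]:
  "weight c d [] = 1" "weight c d (Inl x # s) = c * weight c d s" "weight c d (Inr y # s) = d * weight c d s"
  by (simp_all add: weight_def)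

lemma weight_pos: "0 < c \<Longrightarrow> 0 < d \<Longrightarrow> 0 < weight c d s"
  unfolding weight_def by (induction s) simp_all

lemma sum_letters_Plus:
  assumes "finite X" "finite Y"
  shows "(\<Sum>x\<in>letters (X <+> Y). F x) = (\<Sum>l\<in>letters X. F (apfst Inl l)) + (\<Sum>l\<in>letters Y. F (apfst Inr l))"
proof -
  have "letters (X <+> Y) = apfst Inl ` letters X \<union> apfst Inr ` letters Y"
    by (force simp: letters_def)
  moreover have "apfst Inl ` letters X \<inter> apfst Inr ` letters Y = {}" by auto
  moreover have "sum F (apfst Inl ` letters X) = (\<Sum>l\<in>letters X. F (apfst Inl l))"
    "sum F (apfst Inr ` letters Y) = (\<Sum>l\<in>letters Y. F (apfst Inr l))"
    by (subst sum.reindex; auto simp: inj_on_def)+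
  ultimately show ?thesis
    using finite_letters[OF assms(1)] finite_letters[OF assms(2)]
    by (simp add: sum.union_disjoint)
qed

lemma sum_two_values:
  fixes u v :: real
  assumes "finite S"
  shows "(\<Sum>x\<in>S. if Q x then u else v) = real (card {x\<in>S. Q x}) * u + (real (card S) - real (card {x\<in>S. Q x})) * v"
proof -
  have "card {x\<in>S. Q x} \<le> card S" using assms by (intro card_mono) auto
  moreover have "S - {x\<in>S. Q x} = {x\<in>S. \<not> Q x}" by auto
  then have "card {x\<in>S. \<not> Q x} = card S - card {x\<in>S. Q x}"
    using assms card_Diff_subset[of "{x\<in>S. Q x}" S] by simp
  ultimately show ?thesis
    using assms by (simp add: sum.If_cases Int_def of_nat_diff Collect_conj_eq[symmetric])
qed

context factor_generators
begin

lemma letter_seq_apfst [simp]: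
  "letter_seq (apfst Inl l) = Inl (letter_value A a l)" "letter_seq (apfst Inr l) = Inr (letter_value B b l)"
  by (cases l; simp add: letter_seq_def fac_def strip_def)+

lemma sum_weight_push:
  fixes c d r :: real
  assumes fin: "finite X" "finite Y" and s: "fp_reduced A B s"
    and cd: "0 < c" "0 < d"
    and r: "real (card (letters X)) * c + real (card (letters Y)) * d \<le> r"
      "\<And>g. g \<in> carrier A \<Longrightarrow> let k = real (card {l\<in>letters X. g \<otimes>\<^bsub>A\<^esub> letter_value A a l = \<one>\<^bsub>A\<^esub>})
        in real (card (letters X)) - k + k / c + real (card (letters Y)) * d \<le> r"
      "\<And>g. g \<in> carrier B \<Longrightarrow> let k = real (card {l\<in>letters Y. g \<otimes>\<^bsub>B\<^esub> letter_value B b l = \<one>\<^bsub>B\<^esub>})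
        in real (card (letters Y)) - k + k / d + real (card (letters X)) * c \<le> r"
  shows "(\<Sum>x\<in>letters (X <+> Y). weight c d (fp_push A B s (letter_seq x))) \<le> r * weight c d s"
proof -
  let ?w = "weight c d"
  let ?m = "real (card (letters X))" and ?n = "real (card (letters Y))"
  have newA: "(\<Sum>l\<in>letters X. ?w (fp_cons A B (Inl (letter_value A a l)) q)) = ?m * (c * ?w q)" for q
  proof -
    have "(\<Sum>l\<in>letters X. ?w (fp_cons A B (Inl (letter_value A a l)) q)) = (\<Sum>l\<in>letters X. c * ?w q)"
      by (intro sum.cong) (simp_all add: fp_cons_def fp_one_def letter_value_left)
    then show ?thesis by simp
  qed
  have newB: "(\<Sum>l\<in>letters Y. ?w (fp_cons A B (Inr (letter_value B b l)) q)) = ?n * (d * ?w q)" for q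
  proof -
    have "(\<Sum>l\<in>letters Y. ?w (fp_cons A B (Inr (letter_value B b l)) q)) = (\<Sum>l\<in>letters Y. d * ?w q)"
      by (intro sum.cong) (simp_all add: fp_cons_def fp_one_def letter_value_right)
    then show ?thesis by simp
  qed
  show ?thesis
  proof (cases s rule: fp_top_cases)
    case empty
    then show ?thesis using r(1) newA[of "[]"] newB[of "[]"]
      by (simp add: sum_letters_Plus[OF fin])
  next
    case (left g q)
    then have g: "g \<in> carrier A" using s by (simp add: fp_reduced_Inl)
    define k where "k = real (card {l\<in>letters X. g \<otimes>\<^bsub>A\<^esub> letter_value A a l = \<one>\<^bsub>A\<^esub>})"
    have "(\<Sum>l\<in>letters X. ?w (fp_cons A B (Inl (g \<otimes>\<^bsub>A\<^esub> letter_value A a l)) q))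
      = (\<Sum>l\<in>letters X. if g \<otimes>\<^bsub>A\<^esub> letter_value A a l = \<one>\<^bsub>A\<^esub> then ?w q else c * ?w q)"
      by (intro sum.cong) (simp_all add: fp_cons_def fp_one_def)
    also have "\<dots> = k * ?w q + (?m - k) * (c * ?w q)"
      unfolding k_def by (rule sum_two_values[OF finite_letters[OF fin(1)]])
    finally have "(\<Sum>x\<in>letters (X <+> Y). ?w (fp_push A B s (letter_seq x)))
        = k * ?w q + (?m - k) * (c * ?w q) + ?n * (d * (c * ?w q))"
      using left newB[of s] by (simp add: sum_letters_Plus[OF fin])
    also have "\<dots> = (?m - k + k / c + ?n * d) * (c * ?w q)"
      using cd by (simp add: field_simps)
    also have "\<dots> \<le> r * (c * ?w q)"
      using r(2)[OF g] weight_pos[OF cd, of q] cd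
      by (intro mult_right_mono) (simp_all add: k_def Let_def)
    finally show ?thesis using left by simp
  next
    case (right g q)
    then have g: "g \<in> carrier B" using s by (simp add: fp_reduced_Inr)
    define k where "k = real (card {l\<in>letters Y. g \<otimes>\<^bsub>B\<^esub> letter_value B b l = \<one>\<^bsub>B\<^esub>})"
    have "(\<Sum>l\<in>letters Y. ?w (fp_cons A B (Inr (g \<otimes>\<^bsub>B\<^esub> letter_value B b l)) q))
      = (\<Sum>l\<in>letters Y. if g \<otimes>\<^bsub>B\<^esub> letter_value B b l = \<one>\<^bsub>B\<^esub> then ?w q else d * ?w q)"
      by (intro sum.cong) (simp_all add: fp_cons_def fp_one_def)
    also have "\<dots> = k * ?w q + (?n - k) * (d * ?w q)"
      unfolding k_def by (rule sum_two_values[OF finite_letters[OF fin(2)]])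
    finally have "(\<Sum>x\<in>letters (X <+> Y). ?w (fp_push A B s (letter_seq x)))
        = k * ?w q + (?n - k) * (d * ?w q) + ?m * (c * (d * ?w q))"
      using right newA[of s] by (simp add: sum_letters_Plus[OF fin])
    also have "\<dots> = (?n - k + k / d + ?m * c) * (d * ?w q)"
      using cd by (simp add: field_simps)
    also have "\<dots> \<le> r * (d * ?w q)"
      using r(3)[OF g] weight_pos[OF cd, of q] cd
      by (intro mult_right_mono) (simp_all add: k_def Let_def)
    finally show ?thesis using right by simp
  qed
qed

lemma card_letters_pos:
  assumes "finite Z" "Z \<noteq> {}"
  shows "1 \<le> real (card (letters Z))"
proof -
  have "finite (letters Z)" "letters Z \<noteq> {}"
    using assms by (simp_all add: letters_def)
  then have "0 < card (letters Z)" by (simp add: card_gt_0_iff)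
  then show ?thesis by linarith
qed

lemma card_cancel_left:
  assumes "finite X" "g \<in> carrier A" "\<nexists>h. \<forall>l\<in>letters X. letter_value A a l = h"
  shows "real (card {l\<in>letters X. g \<otimes>\<^bsub>A\<^esub> letter_value A a l = \<one>\<^bsub>A\<^esub>}) \<le> real (card (letters X)) - 1"
proof -
  have "{l\<in>letters X. g \<otimes>\<^bsub>A\<^esub> letter_value A a l = \<one>\<^bsub>A\<^esub>} \<noteq> letters X"
  proof
    assume "{l\<in>letters X. g \<otimes>\<^bsub>A\<^esub> letter_value A a l = \<one>\<^bsub>A\<^esub>} = letters X"
    then have *: "g \<otimes>\<^bsub>A\<^esub> letter_value A a l = \<one>\<^bsub>A\<^esub>" if "l \<in> letters X" for l using that by blast
    have "\<forall>l\<in>letters X. letter_value A a l = inv\<^bsub>A\<^esub> g"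
      using * assms(2) letter_value_left(1) A.inv_equality A.inv_comm A.inv_inv by metis
    then show False using assms(3) by blast
  qed
  then have "card {l\<in>letters X. g \<otimes>\<^bsub>A\<^esub> letter_value A a l = \<one>\<^bsub>A\<^esub>} < card (letters X)"
    by (intro psubset_card_mono finite_letters assms(1)) auto
  then show ?thesis by linarith
qed

lemma card_cancel_right:
  assumes "finite Y" "g \<in> carrier B" "\<nexists>h. \<forall>l\<in>letters Y. letter_value B b l = h"
  shows "real (card {l\<in>letters Y. g \<otimes>\<^bsub>B\<^esub> letter_value B b l = \<one>\<^bsub>B\<^esub>}) \<le> real (card (letters Y)) - 1"
proof -
  have "{l\<in>letters Y. g \<otimes>\<^bsub>B\<^esub> letter_value B b l = \<one>\<^bsub>B\<^esub>} \<noteq> letters Y"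
  proof
    assume "{l\<in>letters Y. g \<otimes>\<^bsub>B\<^esub> letter_value B b l = \<one>\<^bsub>B\<^esub>} = letters Y"
    then have *: "g \<otimes>\<^bsub>B\<^esub> letter_value B b l = \<one>\<^bsub>B\<^esub>" if "l \<in> letters Y" for l using that by blast
    have "\<forall>l\<in>letters Y. letter_value B b l = inv\<^bsub>B\<^esub> g"
      using * assms(2) letter_value_right(1) B.inv_equality B.inv_comm B.inv_inv by metis
    then show False using assms(3) by blast
  qed
  then have "card {l\<in>letters Y. g \<otimes>\<^bsub>B\<^esub> letter_value B b l = \<one>\<^bsub>B\<^esub>} < card (letters Y)"
    by (intro psubset_card_mono finite_letters assms(1)) auto
  then show ?thesis by linarith
qed

lemma card_letters_Plus:
  assumes "finite X" "finite Y"
  shows "card (letters (X <+> Y)) = card (letters X) + card (letters Y)"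
  using sum_letters_Plus[OF assms, of "\<lambda>_. 1 :: nat"] by simp

lemma card_short_normal:
  assumes fin: "finite X" "finite Y" and ne: "X \<noteq> {}" "Y \<noteq> {}"
    and nt: "\<not> ((\<exists>h. \<forall>l\<in>letters X. letter_value A a l = h) \<and> (\<exists>h. \<forall>l\<in>letters Y. letter_value B b l = h))"
  shows "\<exists>C \<rho>. 0 < \<rho> \<and> \<rho> < 1 \<and> 0 < C \<and> (\<forall>k. real (card {w\<in>words_of_length (X <+> Y) k. length (normal w) \<le> 1})
    \<le> C * (\<rho> * real (card (letters (X <+> Y)))) ^ k)"
proof -
  let ?m = "real (card (letters X))" and ?n = "real (card (letters Y))"
  let ?kA = "\<lambda>g. real (card {l\<in>letters X. g \<otimes>\<^bsub>A\<^esub> letter_value A a l = \<one>\<^bsub>A\<^esub>})"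
  let ?kB = "\<lambda>g. real (card {l\<in>letters Y. g \<otimes>\<^bsub>B\<^esub> letter_value B b l = \<one>\<^bsub>B\<^esub>})"
  have m: "1 \<le> ?m" "1 \<le> ?n" using card_letters_pos fin ne by blast+
  have k: "?kA g \<le> ?m" "?kB h \<le> ?n" for g h
    using fin by (auto intro!: card_mono finite_letters)
  have "\<exists>c d r. 0 < c \<and> c < 1 \<and> 0 < d \<and> d < 1 \<and> 0 < r \<and> r < ?m + ?n \<and> ?m * c + ?n * d \<le> r \<and>
      (\<forall>g\<in>carrier A. ?m - ?kA g + ?kA g / c + ?n * d \<le> r) \<and>
      (\<forall>g\<in>carrier B. ?n - ?kB g + ?kB g / d + ?m * c \<le> r)"
  proof (cases "\<exists>h. \<forall>l\<in>letters X. letter_value A a l = h")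
    case False
    obtain c d r where *: "0 < c" "c < 1" "0 < d" "d < 1" "0 < r" "r < ?m + ?n" "?m * c + ?n * d \<le> r"
      "\<And>k. 0 \<le> k \<Longrightarrow> k \<le> ?m - 1 \<Longrightarrow> ?m - k + k / c + ?n * d \<le> r"
      "\<And>k. 0 \<le> k \<Longrightarrow> k \<le> ?n \<Longrightarrow> ?n - k + k / d + ?m * c \<le> r"
      using weights_exist[OF m] by blast
    then show ?thesis
      using card_cancel_left[OF fin(1) _ False] k
      by (intro exI[of _ c] exI[of _ d] exI[of _ r]) simp
  next
    case True
    then have nB: "\<nexists>h. \<forall>l\<in>letters Y. letter_value B b l = h" using nt by blast
    obtain d c r where *: "0 < d" "d < 1" "0 < c" "c < 1" "0 < r" "r < ?n + ?m" "?n * d + ?m * c \<le> r"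
      "\<And>k. 0 \<le> k \<Longrightarrow> k \<le> ?n - 1 \<Longrightarrow> ?n - k + k / d + ?m * c \<le> r"
      "\<And>k. 0 \<le> k \<Longrightarrow> k \<le> ?m \<Longrightarrow> ?m - k + k / c + ?n * d \<le> r"
      using weights_exist[OF m(2,1)] by blast
    then show ?thesis
      using card_cancel_right[OF fin(2) _ nB] k
      by (intro exI[of _ c] exI[of _ d] exI[of _ r]) (simp add: add.commute)
  qed
  then obtain c d r where cd: "0 < c" "c < 1" "0 < d" "d < 1" and r: "0 < r" "r < ?m + ?n"
    "?m * c + ?n * d \<le> r"
    and rA: "\<And>g. g \<in> carrier A \<Longrightarrow> ?m - ?kA g + ?kA g / c + ?n * d \<le> r"
    and rB: "\<And>g. g \<in> carrier B \<Longrightarrow> ?n - ?kB g + ?kB g / d + ?m * c \<le> r"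
    by blast
  have sum: "(\<Sum>w\<in>words_of_length (X <+> Y) k. weight c d (normal w)) \<le> r ^ k" for k
  proof (induction k)
    case 0
    have "words_of_length (X <+> Y) 0 = {[]}" by (auto simp: words_of_length_eq)
    then show ?case by simp
  next
    case (Suc k)
    have "(\<Sum>w\<in>words_of_length (X <+> Y) (Suc k). weight c d (normal w)) =
      (\<Sum>w\<in>words_of_length (X <+> Y) k. \<Sum>x\<in>letters (X <+> Y). weight c d (fp_push A B (normal w) (letter_seq x)))"
      by (simp add: sum_words_snoc)
    also have "\<dots> \<le> (\<Sum>w\<in>words_of_length (X <+> Y) k. r * weight c d (normal w))"
    proof (rule sum_mono)
      fix w assume "w \<in> words_of_length (X <+> Y) k"
      then have "fp_reduced A B (normal w)"
        unfolding normal_def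
        by (intro fp_reduced_normalise[OF A.is_group B.is_group] seq_closed) (simp add: words_of_length_def)
      then show "(\<Sum>x\<in>letters (X <+> Y). weight c d (fp_push A B (normal w) (letter_seq x))) \<le> r * weight c d (normal w)"
        by (rule sum_weight_push[OF fin _ cd(1,3) r(3)]) (simp_all add: Let_def rA rB)
    qed
    also have "\<dots> \<le> r * r ^ k"
      unfolding sum_distrib_left[symmetric] using r(1) Suc.IH by simp
    finally show ?case by simp
  qed
  define M where "M = real (card (letters (X <+> Y)))"
  have M: "M = ?m + ?n" by (simp add: M_def card_letters_Plus[OF fin])
  define \<rho> where "\<rho> = r / M"
  have \<rho>: "0 < \<rho>" "\<rho> < 1" "\<rho> * M = r" using r m by (simp_all add: \<rho>_def M)
  define e where "e = min c d"
  have e: "0 < e" using cd by (simp add: e_def)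
  have short: "e \<le> weight c d s" if "length s \<le> 1" for s :: "('a + 'b) list"
  proof (cases s)
    case Nil
    then show ?thesis using cd by (simp add: e_def)
  next
    case (Cons z s')
    then show ?thesis using that by (cases z) (simp_all add: e_def)
  qed
  have "real (card {w\<in>words_of_length (X <+> Y) k. length (normal w) \<le> 1}) \<le> 1 / e * (\<rho> * M) ^ k" for k
  proof -
    let ?S = "{w\<in>words_of_length (X <+> Y) k. length (normal w) \<le> 1}"
    have fw: "finite (words_of_length (X <+> Y) k)" using fin by (simp add: finite_words_of_length)
    then have "real (card ?S) * e \<le> (\<Sum>w\<in>?S. weight c d (normal w))"
      using sum_bounded_below[of ?S e "\<lambda>w. weight c d (normal w)"] short by simp
    also have "\<dots> \<le> (\<Sum>w\<in>words_of_length (X <+> Y) k. weight c d (normal w))"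
      using weight_pos[OF cd(1,3)] fw
      by (intro sum_mono2) (auto intro: less_imp_le)
    also have "\<dots> \<le> r ^ k" by (rule sum)
    finally show ?thesis unfolding \<rho>(3) using e by (simp add: field_simps)
  qed
  then show ?thesis using \<rho> e unfolding M_def by (intro exI[of _ "1 / e"] exI[of _ \<rho>]) simp
qed

end

section \<open>The average cost of the tests\<close>

context factor_generators
begin

lemma words_of_length_words: "w \<in> words_of_length (X <+> Y) n \<Longrightarrow> w \<in> W \<and> length w = n"
  by (simp add: words_of_length_def)

lemma length_tested_degenerate:
  assumes "\<exists>h. \<forall>l\<in>letters X. letter_value A a l = h" "\<exists>h. \<forall>l\<in>letters Y. letter_value B b l = h"
    and w: "w \<in> W" "x \<in> letters (X <+> Y)"
  shows "length (tested (run test w) x) \<le> 2"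
proof -
  have pair: "test [y, z]" if yz: "y \<in> letters (X <+> Y)" "z \<in> letters (X <+> Y)" "fac y = fac z" for y z
  proof (cases "fac y")
    case True
    obtain h where h: "\<And>l. l \<in> letters X \<Longrightarrow> letter_value A a l = h" using assms(1) by blast
    have l: "strip y \<in> letters X" "strip z \<in> letters X"
      using strip_letters_left yz True by auto
    define i where "i = fst (strip y)"
    have i: "i \<in> X" using l(1) by (auto simp: letters_def i_def)
    then have "a i = h" "inv\<^bsub>A\<^esub> a i = h"
      using h[of "(i, True)"] h[of "(i, False)"] by (simp_all add: letters_def letter_value_def)
    moreover have "a i \<in> carrier A" using i a by auto
    ultimately have hh: "h \<otimes>\<^bsub>A\<^esub> h = \<one>\<^bsub>A\<^esub>" "h \<in> carrier A"
      using A.r_inv[of "a i"] by simp_all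
    show ?thesis
      using True yz(3) l hh by (simp add: block_test_def trivial_word_def h)
  next
    case False
    obtain h where h: "\<And>l. l \<in> letters Y \<Longrightarrow> letter_value B b l = h" using assms(2) by blast
    have l: "strip y \<in> letters Y" "strip z \<in> letters Y"
      using strip_letters_right yz False by auto
    define i where "i = fst (strip y)"
    have i: "i \<in> Y" using l(1) by (auto simp: letters_def i_def)
    then have "b i = h" "inv\<^bsub>B\<^esub> b i = h"
      using h[of "(i, True)"] h[of "(i, False)"] by (simp_all add: letters_def letter_value_def)
    moreover have "b i \<in> carrier B" using i b by auto
    ultimately have hh: "h \<otimes>\<^bsub>B\<^esub> h = \<one>\<^bsub>B\<^esub>" "h \<in> carrier B"
      using B.r_inv[of "b i"] by simp_all
    show ?thesis
      using False yz(3) l hh by (simp add: block_test_def trivial_word_def h)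
  qed
  have short: "length v = 1" if "w \<in> W" "v \<in> set (run test w)" for w v
    using that
  proof (induction w arbitrary: v rule: rev_induct)
    case (snoc x w)
    then have w: "w \<in> W" "x \<in> letters (X <+> Y)" by simp_all
    let ?ws = "run test w"
    have IH: "\<And>v. v \<in> set ?ws \<Longrightarrow> length v = 1" using snoc.IH[OF w(1)] .
    show ?case
    proof (cases "?ws \<noteq> [] \<and> fac (hd (hd ?ws)) = fac x")
      case True
      then obtain v' vs where v': "?ws = v' # vs" by (cases ?ws) auto
      obtain y where y: "v' = [y]" using IH[of v'] v' by (auto simp: length_Suc_conv)
      have "y \<in> letters (X <+> Y)" using set_run_letters[OF w(1), of test] v' y by simp
      then have "test [y, x]" using pair w(2) True v' y by simp
      moreover have "tested ?ws x = [y, x]" "below ?ws x = vs"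
        using True v' y by (simp_all add: tested_def below_def)
      ultimately have "run test (w @ [x]) = vs" by (simp add: push_def)
      then show ?thesis using snoc.prems(2) IH v' by simp
    next
      case False
      then have "tested ?ws x = [x]" "below ?ws x = ?ws"
        unfolding tested_def below_def if_not_P[OF False] by simp_all
      then show ?thesis using snoc.prems(2) IH by (auto simp: push_def split: if_splits)
    qed
  qed simp
  show ?thesis
    using short[OF w(1)] by (cases "run test w") (auto simp: tested_def)
qed

lemma sum_last_test:
  fixes h :: "nat \<Rightarrow> real"
  assumes fin: "finite X" "finite Y" and h: "mono h" "\<And>k. 0 \<le> h k"
    and short: "\<And>k. real (card {w\<in>words_of_length (X <+> Y) k. length (normal w) \<le> 1}) \<le> g k"
  shows "(\<Sum>w\<in>words_of_length (X <+> Y) n. \<Sum>x\<in>letters (X <+> Y). h (length (tested (run test w) x)))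
    \<le> (\<Sum>k<n + 2. real (card (letters (X <+> Y))) ^ (Suc n - k) * (g k * h k))"
proof -
  let ?Z = "X <+> Y"
  let ?M = "real (card (letters ?Z))"
  define ind where "ind s = (if length (normal s) \<le> 1 then 1 else 0 :: real)" for s
  define F where "F w = (\<Sum>k<n + 2. ind (drop (Suc n - k) w) * h k)" for w
  have fZ: "finite (words_of_length ?Z k)" "card (words_of_length ?Z k) = card (letters ?Z) ^ k" for k
    using fin by (simp_all add: finite_words_of_length card_words_of_length)
  have "(\<Sum>w\<in>words_of_length ?Z n. \<Sum>x\<in>letters ?Z. h (length (tested (run test w) x)))
    \<le> (\<Sum>w\<in>words_of_length ?Z n. \<Sum>x\<in>letters ?Z. F (w @ [x]))"
  proof (intro sum_mono)
    fix w x assume w: "w \<in> words_of_length ?Z n" and x: "x \<in> letters ?Z"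
    then have "w \<in> W" and n: "length w = n" using words_of_length_words by auto
    from tested_span[OF this(1) x] obtain u s where s: "w @ [x] = u @ s"
      "length (tested (run test w) x) \<le> length s" "length (normal s) \<le> 1" .
    have len: "Suc n = length u + length s" using arg_cong[OF s(1), of length] n by simp
    then have "drop (Suc n - length s) (w @ [x]) = s" by (simp add: s(1))
    then have "h (length s) = ind (drop (Suc n - length s) (w @ [x])) * h (length s)"
      using s(3) by (simp add: ind_def)
    also have "\<dots> \<le> F (w @ [x])"
      unfolding F_def by (rule member_le_sum) (use len h in \<open>auto simp: ind_def\<close>)
    finally show "h (length (tested (run test w) x)) \<le> F (w @ [x])"
      using monoD[OF h(1) s(2)] by simp
  qed
  also have "\<dots> = (\<Sum>w\<in>words_of_length ?Z (Suc n). F w)"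
    by (simp only: sum_words_snoc)
  also have "\<dots> = (\<Sum>k<n + 2. \<Sum>w\<in>words_of_length ?Z (Suc n). ind (drop (Suc n - k) w) * h k)"
    unfolding F_def by (rule sum.swap)
  also have "\<dots> \<le> (\<Sum>k<n + 2. ?M ^ (Suc n - k) * (g k * h k))"
  proof (rule sum_mono)
    fix k assume "k \<in> {..<n + 2}"
    then have k: "Suc n = (Suc n - k) + k" by simp
    have "(\<Sum>w\<in>words_of_length ?Z (Suc n). ind (drop (Suc n - k) w) * h k)
      = (\<Sum>w\<in>words_of_length ?Z ((Suc n - k) + k). ind (drop (Suc n - k) w) * h k)"
      by (rule arg_cong[OF k, of "\<lambda>m. \<Sum>w\<in>words_of_length ?Z m. ind (drop (Suc n - k) w) * h k"])
    also have "\<dots> = (\<Sum>u\<in>words_of_length ?Z (Suc n - k). \<Sum>s\<in>words_of_length ?Z k. ind (drop (Suc n - k) (u @ s)) * h k)"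
      by (rule sum_words_append)
    also have "\<dots> = (\<Sum>u\<in>words_of_length ?Z (Suc n - k). \<Sum>s\<in>words_of_length ?Z k. ind s * h k)"
      by (intro sum.cong) (simp_all add: words_of_length_def)
    also have "\<dots> = ?M ^ (Suc n - k) * ((\<Sum>s\<in>words_of_length ?Z k. ind s) * h k)"
      by (simp add: fZ sum_distrib_right)
    also have "(\<Sum>s\<in>words_of_length ?Z k. ind s) = real (card {w\<in>words_of_length ?Z k. length (normal w) \<le> 1})"
      unfolding ind_def by (subst sum.inter_filter[symmetric]) (simp_all add: fZ)
    finally show "(\<Sum>w\<in>words_of_length ?Z (Suc n). ind (drop (Suc n - k) w) * h k)
        \<le> ?M ^ (Suc n - k) * (g k * h k)"
      using short[of k] h(2)[of k] by (simp add: mult_left_mono mult_right_mono)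
  qed
  finally show ?thesis .
qed

lemma sum_tests_linear:
  assumes fin: "finite X" "finite Y" and ne: "X \<noteq> {}" "Y \<noteq> {}"
  shows "\<exists>C. \<forall>n. (\<Sum>w\<in>words_of_length (X <+> Y) n. \<Sum>v\<leftarrow>tests test w. real (Suc (length v)) ^ d)
    \<le> C * real n * real (card (letters (X <+> Y))) ^ n"
proof -
  let ?Z = "X <+> Y"
  define M where "M = real (card (letters ?Z))"
  have M: "1 \<le> M"
    unfolding M_def using card_letters_pos[of ?Z] fin ne by auto
  define h where "h k = real (Suc k) ^ d" for k
  have h: "mono h" "\<And>k. 0 \<le> h k"
    by (auto simp: h_def mono_def intro!: power_mono)
  obtain C where C: "\<And>n. (\<Sum>w\<in>words_of_length ?Z n. \<Sum>x\<in>letters ?Z. h (length (tested (run test w) x))) \<le> C * M ^ Suc n"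
  proof (cases "(\<exists>h. \<forall>l\<in>letters X. letter_value A a l = h) \<and> (\<exists>h. \<forall>l\<in>letters Y. letter_value B b l = h)")
    case True
    have "(\<Sum>w\<in>words_of_length ?Z n. \<Sum>x\<in>letters ?Z. h (length (tested (run test w) x))) \<le> h 2 * M ^ Suc n" for n
    proof -
      have "(\<Sum>w\<in>words_of_length ?Z n. \<Sum>x\<in>letters ?Z. h (length (tested (run test w) x)))
        \<le> (\<Sum>w\<in>words_of_length ?Z n. \<Sum>x\<in>letters ?Z. h 2)"
        using length_tested_degenerate True words_of_length_words
        by (intro sum_mono monoD[OF h(1)]) blast
      also have "\<dots> = h 2 * M ^ Suc n"
        using fin by (simp add: card_words_of_length M_def)
      finally show ?thesis .
    qed
    then show ?thesis by (rule that)
  next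
    case False
    obtain D \<rho> where \<rho>: "0 < \<rho>" "\<rho> < 1" "0 < D" and
      short: "\<And>k. real (card {w\<in>words_of_length ?Z k. length (normal w) \<le> 1}) \<le> D * (\<rho> * M) ^ k"
      using card_short_normal[OF fin ne False] unfolding M_def by blast
    obtain E where E: "\<And>n. (\<Sum>k<n. real (Suc k) ^ d * \<rho> ^ k) \<le> E"
      using sum_power_times_geometric_bounded[OF \<rho>(1,2)] by blast
    have "(\<Sum>w\<in>words_of_length ?Z n. \<Sum>x\<in>letters ?Z. h (length (tested (run test w) x))) \<le> (D * E) * M ^ Suc n" for n
    proof -
      have "(\<Sum>w\<in>words_of_length ?Z n. \<Sum>x\<in>letters ?Z. h (length (tested (run test w) x)))
        \<le> (\<Sum>k<n + 2. M ^ (Suc n - k) * (D * (\<rho> * M) ^ k * h k))"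
        using sum_last_test[OF fin h short] unfolding M_def .
      also have "\<dots> = (\<Sum>k<n + 2. D * M ^ Suc n * (real (Suc k) ^ d * \<rho> ^ k))"
      proof (rule sum.cong)
        fix k assume "k \<in> {..<n + 2}"
        then have "M ^ Suc n = M ^ (Suc n - k) * M ^ k"
          by (simp flip: power_add)
        then show "M ^ (Suc n - k) * (D * (\<rho> * M) ^ k * h k) = D * M ^ Suc n * (real (Suc k) ^ d * \<rho> ^ k)"
          unfolding h_def power_mult_distrib by (simp only: mult_ac)
      qed simp
      also have "\<dots> \<le> D * M ^ Suc n * E"
        unfolding sum_distrib_left[symmetric] by (intro mult_left_mono E) (use \<rho>(3) M in simp)
      finally show ?thesis by (simp only: mult_ac)
    qed
    then show ?thesis by (rule that)
  qed
  have "(\<Sum>w\<in>words_of_length ?Z n. \<Sum>v\<leftarrow>tests test w. h (length v)) \<le> C * real n * M ^ n" for n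
  proof (induction n)
    case 0
    have "words_of_length ?Z 0 = {[]}" by (auto simp: words_of_length_eq)
    then show ?case by simp
  next
    case (Suc n)
    have "(\<Sum>w\<in>words_of_length ?Z (Suc n). \<Sum>v\<leftarrow>tests test w. h (length v))
      = (\<Sum>w\<in>words_of_length ?Z n. M * (\<Sum>v\<leftarrow>tests test w. h (length v))
          + (\<Sum>x\<in>letters ?Z. h (length (tested (run test w) x))))"
      by (simp add: sum_words_snoc sum.distrib M_def)
    also have "\<dots> \<le> M * (C * real n * M ^ n) + C * M ^ Suc n"
      unfolding sum.distrib sum_distrib_left[symmetric]
      by (intro add_mono mult_left_mono C Suc.IH) (use M in simp)
    also have "\<dots> = C * real (Suc n) * M ^ Suc n" by (simp add: algebra_simps)
    finally show ?case .
  qed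
  then show ?thesis unfolding h_def M_def by blast
qed

end

section \<open>Polynomial time bounds\<close>

lemma polynomial_time_bound:
  assumes "finite X" "polynomial_time M X"
  shows "\<exists>C d. 0 \<le> C \<and> (\<forall>w\<in>words X. real (run_time M w) \<le> C * real (Suc (length w)) ^ d)"
proof -
  define f where "f n = real (Max (insert 0 (run_time M ` words_of_length X n)))" for n
  have fin: "finite (run_time M ` words_of_length X n)" for n
    using finite_words_of_length[OF assms(1)] by simp
  obtain d where "(\<lambda>n. real (Max (run_time M ` words_of_length X n))) \<in> O(\<lambda>n. real n ^ d)"
    using assms(2) by (auto simp: polynomial_time_def)
  then obtain c where c: "eventually (\<lambda>n. norm (real (Max (run_time M ` words_of_length X n))) \<le> c * norm (real n ^ d)) at_top"
    by (rule landau_o.bigE)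
  then obtain m where m: "\<And>n. n \<ge> m \<Longrightarrow> real (Max (run_time M ` words_of_length X n)) \<le> c * real n ^ d"
    by (auto simp: eventually_at_top_linorder)
  define C where "C = max 0 c + (\<Sum>n<m. f n)"
  have f0: "0 \<le> f n" for n by (simp add: f_def)
  have C0: "0 \<le> C" by (simp add: C_def f0 sum_nonneg)
  have "real (run_time M w) \<le> C * real (Suc (length w)) ^ d" if w: "w \<in> words X" for w
  proof -
    let ?n = "length w"
    have wn: "w \<in> words_of_length X ?n" using w by (simp add: words_of_length_def)
    show ?thesis
    proof (cases "?n < m")
      case True
      have "real (run_time M w) \<le> f ?n"
        unfolding f_def using wn fin by (intro of_nat_mono Max_ge) auto
      also have "\<dots> \<le> (\<Sum>n<m. f n)" using True f0 by (intro member_le_sum) auto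
      also have "\<dots> \<le> C" by (simp add: C_def)
      also have "\<dots> \<le> C * real (Suc ?n) ^ d"
        using C0 by (intro mult_le_cancel_left1[THEN iffD2]) (simp add: one_le_power)
      finally show ?thesis .
    next
      case False
      have "real (run_time M w) \<le> real (Max (run_time M ` words_of_length X ?n))"
        using wn fin by (intro of_nat_mono Max_ge) auto
      also have "\<dots> \<le> c * real ?n ^ d" using m False by simp
      also have "\<dots> \<le> C * real (Suc ?n) ^ d"
        using f0 by (intro mult_mono power_mono) (simp_all add: C_def sum_nonneg add_increasing2 C0[unfolded C_def])
      finally show ?thesis .
    qed
  qed
  then show ?thesis using C0 by blast
qed

lemma (in factor_generators) tests_blocks:
  assumes "w \<in> W" "v \<in> set (tests P w)"
  shows "v \<in> W" "block (fac (hd v)) v"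
proof -
  obtain p where p: "p < length w" "v = tested (run P (take p w)) (w ! p)"
    using assms(2) by (auto simp: tests_def)
  have "take p w \<in> W" "w ! p \<in> letters (X <+> Y)"
    using assms(1) p(1) by (auto simp: in_words_iff dest: in_set_takeD)
  then show "v \<in> W" unfolding p(2) by (rule tested_word)
  have blk: "block (fac (w ! p)) v" unfolding p(2) by (rule block_tested[OF stacked_run])
  show "block (fac (hd v)) v" unfolding block_hd[OF blk] by (rule blk)
qed

lemma generators_nonempty:
  assumes "group H" "carrier H \<noteq> {\<one>\<^bsub>H\<^esub>}" "generated_by_nontrivial H Z g"
  shows "Z \<noteq> {}"
  using assms group.generate_empty[OF assms(1)] by (auto simp: generated_by_nontrivial_def)

theorem theorem6:
  fixes A :: "('a, 'm) monoid_scheme" and B :: "('b, 'n) monoid_scheme"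
    and a :: "nat \<Rightarrow> 'a" and b :: "nat \<Rightarrow> 'b" and s t :: nat
  assumes "group A" and "group B"
    and "carrier A \<noteq> {\<one>\<^bsub>A\<^esub>}" and "carrier B \<noteq> {\<one>\<^bsub>B\<^esub>}"
    and "generated_by_nontrivial A {1..s} a"
    and "generated_by_nontrivial B {1..t} b"
    and "polynomial_time_word_problem A {1..s} a"
    and "polynomial_time_word_problem B {1..t} b"
  shows "average_linear_word_problem (free_product A B) ({1..s} <+> {1..t}) (fp_generators A B a b) \<and>
         average_linear_normal_form A {1..s} a B {1..t} b"
proof -
  define X Y where "X = {1..s}" and "Y = {1..t}"
  have fin: "finite X" "finite Y" by (simp_all add: X_def Y_def)
  have ne: "X \<noteq> {}" "Y \<noteq> {}"
    using generators_nonempty[OF assms(1,3,5)] generators_nonempty[OF assms(2,4,6)]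
    by (simp_all add: X_def Y_def)
  interpret F: factor_generators A B a b X Y
    using assms(1,2,5,6)
    by (simp add: factor_generators_def factor_generators_axioms_def generated_by_nontrivial_def X_def Y_def)
  obtain MA where MA: "decides MA (letters X) (trivial_word A a)" "polynomial_time MA X"
    using assms(7) by (auto simp: polynomial_time_word_problem_def X_def)
  obtain MB where MB: "decides MB (letters Y) (trivial_word B b)" "polynomial_time MB Y"
    using assms(8) by (auto simp: polynomial_time_word_problem_def Y_def)
  define M where "M c = (if c then pad_tm (num_tapes MB) MA else pad_tm (num_tapes MA) MB)" for c
  define Z where "Z c = (if c then X else Y)" for c
  let ?P = "\<lambda>c. if c then trivial_word A a else trivial_word B b"
  interpret I: inner_machines M "num_tapes MA + num_tapes MB" Z ?P
    by unfold_locales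
      (use decides_pad[OF MA(1)] decides_pad[OF MB(1)] fin in \<open>simp_all add: M_def Z_def\<close>)
  let ?L = "letters (X <+> Y)"
  have L: "I.L = ?L" by (simp add: I.L_def Z_def)
  have W: "lists ?L = words (X <+> Y)" by (simp add: words_def)
  note result = I.machine_result[unfolded L W]
  have decides: "decides I.N ?L (trivial_word F.G F.gens)"
    unfolding decides_def W using I.well_formed_N result F.run_empty_iff by (simp add: L)
  have computes: "computes I.N ?L (normal_form_of A X a B Y b)"
    unfolding computes_def W using I.well_formed_N result F.run_normal_form by (auto simp: L)

  obtain CA dA where CA: "0 \<le> CA" "\<And>w. w \<in> words X \<Longrightarrow> real (run_time MA w) \<le> CA * real (Suc (length w)) ^ dA"
    using polynomial_time_bound[OF fin(1) MA(2)] by blast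
  obtain CB dB where CB: "0 \<le> CB" "\<And>w. w \<in> words Y \<Longrightarrow> real (run_time MB w) \<le> CB * real (Suc (length w)) ^ dB"
    using polynomial_time_bound[OF fin(2) MB(2)] by blast
  define d where "d = Suc (dA + dB)"
  define D where "D = 9 * (1 + CA + CB)"
  have cost: "real (I.test_cost v) \<le> D * real (Suc (length v)) ^ d"
    if v: "v \<in> words (X <+> Y)" "block (fac (hd v)) v" for v
  proof -
    let ?n = "real (Suc (length v))"
    have all: "\<forall>x\<in>set v. fac x = fac (hd v)" using v(2) unfolding block_def by blast
    have mono: "?n ^ e \<le> ?n ^ d" if "e \<le> d" for e
      using that by (intro power_increasing) simp_all
    have time: "real (run_time (M (fac (hd v))) (map strip v)) \<le> (CA + CB) * ?n ^ d"
    proof (cases "fac (hd v)")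
      case True
      then have w: "map strip v \<in> words X" using F.word_value_left(1)[OF v(1)] all by blast
      have "run_time (M True) (map strip v) = run_time MA (map strip v)"
        using run_time_pad[of MA "letters X"] MA(1) w by (simp add: M_def decides_def words_def)
      also have "real (run_time MA (map strip v)) \<le> CA * ?n ^ dA" using CA(2)[OF w] by simp
      also have "\<dots> \<le> (CA + CB) * ?n ^ d"
        using mono[of dA] CA(1) CB(1) by (intro mult_mono) (simp_all add: d_def)
      finally show ?thesis using True by simp
    next
      case False
      then have w: "map strip v \<in> words Y" using F.word_value_right(1)[OF v(1)] all by blast
      have "run_time (M False) (map strip v) = run_time MB (map strip v)"
        using run_time_pad[of MB "letters Y"] MB(1) w by (simp add: M_def decides_def words_def)
      also have "real (run_time MB (map strip v)) \<le> CB * ?n ^ dB" using CB(2)[OF w] by simp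
      also have "\<dots> \<le> (CA + CB) * ?n ^ d"
        using mono[of dB] CA(1) CB(1) by (intro mult_mono) (simp_all add: d_def)
      finally show ?thesis using False by simp
    qed
    have "real (I.test_cost v) = 9 * (?n + real (run_time (M (fac (hd v))) (map strip v)))"
      by (simp add: I.test_cost_def)
    also have "\<dots> \<le> 9 * (?n ^ d + (CA + CB) * ?n ^ d)"
      by (intro mult_left_mono add_mono time) (use mono[of 1] in \<open>simp_all add: d_def\<close>)
    also have "\<dots> = D * ?n ^ d" by (simp add: D_def algebra_simps)
    finally show ?thesis .
  qed
  have D: "0 \<le> D" using CA(1) CB(1) by (simp add: D_def)

  obtain C where C: "\<And>n. (\<Sum>w\<in>words_of_length (X <+> Y) n. \<Sum>v\<leftarrow>tests I.test w. real (Suc (length v)) ^ d)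
      \<le> C * real n * real (card ?L) ^ n"
    using F.sum_tests_linear[OF fin ne] by blast
  have time: "real (run_time I.N w) \<le> D * (\<Sum>v\<leftarrow>tests I.test w. real (Suc (length v)) ^ d) + 2"
    if w: "w \<in> words (X <+> Y)" for w
  proof -
    have "real (run_time I.N w) \<le> real (sum_list (map I.test_cost (tests I.test w)) + 2)"
      using result(2)[OF w] by (rule of_nat_mono)
    also have "\<dots> = (\<Sum>v\<leftarrow>tests I.test w. real (I.test_cost v)) + 2"
    proof -
      have "real (sum_list (map f vs)) = (\<Sum>v\<leftarrow>vs. real (f v))"
        for f :: "(nat + nat) word \<Rightarrow> nat" and vs
        by (induction vs) simp_all
      then show ?thesis by simp
    qed
    also have "(\<Sum>v\<leftarrow>tests I.test w. real (I.test_cost v)) \<le> (\<Sum>v\<leftarrow>tests I.test w. D * real (Suc (length v)) ^ d)"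
      by (rule sum_list_mono) (use cost F.tests_blocks[OF w] in blast)
    finally show ?thesis by (simp add: sum_list_const_mult)
  qed
  have average: "linear_on_average (encode_tm I.N) (X <+> Y)"
    unfolding linear_on_average_def
  proof (rule bigoI)
    show "eventually (\<lambda>n. norm (1 / real (card (words_of_length (X <+> Y) n)) *
        (\<Sum>w\<in>words_of_length (X <+> Y) n. real (run_time (encode_tm I.N) w)))
        \<le> (D * C + 2) * norm (real n)) at_top"
      using eventually_ge_at_top[of 1]
    proof eventually_elim
      case (elim n)
      let ?S = "words_of_length (X <+> Y) n" and ?m = "real (card ?L) ^ n"
      have card: "real (card ?S) = ?m" using fin by (simp add: card_words_of_length)
      have pos: "0 < ?m"
        using F.card_letters_pos[of "X <+> Y"] fin ne by (intro zero_less_power) fastforce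
      have "(\<Sum>w\<in>?S. real (run_time I.N w)) \<le>
        (\<Sum>w\<in>?S. D * (\<Sum>v\<leftarrow>tests I.test w. real (Suc (length v)) ^ d) + 2)"
        using time F.words_of_length_words by (intro sum_mono) blast
      also have "\<dots> = D * (\<Sum>w\<in>?S. \<Sum>v\<leftarrow>tests I.test w. real (Suc (length v)) ^ d) + 2 * ?m"
        by (simp add: sum.distrib sum_distrib_left card)
      also have "\<dots> \<le> D * (C * real n * ?m) + 2 * (real n * ?m)"
        using elim pos by (intro add_mono mult_left_mono[OF C D]) simp_all
      also have "\<dots> = (D * C + 2) * real n * ?m" by (simp add: algebra_simps)
      finally have "1 / ?m * (\<Sum>w\<in>?S. real (run_time I.N w)) \<le> (D * C + 2) * real n"
        using pos by (simp add: field_simps)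
      moreover have "0 \<le> 1 / ?m * (\<Sum>w\<in>?S. real (run_time I.N w))"
        using pos by (intro mult_nonneg_nonneg sum_nonneg) simp_all
      ultimately show ?case by (simp add: card run_time_encode)
    qed
  qed
  show ?thesis
    using decides_encode[OF decides] computes_encode[OF computes] average
    unfolding average_linear_word_problem_def average_linear_normal_form_def X_def Y_def by blast
qed

end
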